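(* Let $(E,w)$ be a row-finite weighted graph and $K$ a field. Then the weighted Leavitt path algebra $L_K(E,w)$ is isomorphic (as a $K$-algebra) to an unweighted Leavitt path algebra (that is, to $L_K(F)$ for some graph $F$) if and only if $(E,w)$ satisfies Condition (LPA).
   Context: A $K$-algebra is an associative (not necessarily commutative or unital) $K$-algebra. Graphs. A (directed) graph is a quadruple $E=(E^0,E^1,s,r)$ where $E^0$ (vertices) and $E^1$ (edges) are sets and $s,r:E^1\to E^0$ are maps (source, range). $E$ is row-finite if $s^{-1}(v)$ is finite for every $v\in E^0$. All graphs (in particular $F$ in the claim) are assumed to be row-finite. A weighted graph is a pair $(E,w)$ with $E$ a graph and $w:E^1\to\{1,2,3,\dots\}$ a map; it is called row-finite if $E$ is. For $v\in E^0$ set $w(v):=\max\{w(e)\mid e\in s^{-1}(v)\}$, with $\max\emptyset=0$. Unweighted Leavitt path algebra. $L_K(E)$ is the $K$-algebra presented by generators $\{v,e,e^*\mid v\in E^0,e\in E^1\}$ and relations (i) $uv=\delta_{uv}u$ ($u,v\in E^0$); (ii) $s(e)e=e=er(e)$, $r(e)e^*=e^*=e^*s(e)$ ($e\in E^1$); (iii) $e^*f=\delta_{ef}r(e)$ ($v\in E^0$, $e,f\in s^{-1}(v)$); (iv) $\sum_{e\in s^{-1}(v)}ee^*=v$ ($v\in E^0$, $s^{-1}(v)\neq\emptyset$). Weighted Leavitt path algebra. $L_K(E,w)$ is the $K$-algebra presented by generators $\{v,e_i,e_i^*\mid v\in E^0,e\in E^1,1\le i\le w(e)\}$ and relations (i)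 $uv=\delta_{uv}u$ ($u,v\in E^0$); (ii) $s(e)e_i=e_i=e_ir(e)$, $r(e)e_i^*=e_i^*=e_i^*s(e)$ ($e\in E^1$, $1\le i\le w(e)$); (iii) $\sum_{1\le i\le w(v)}e_i^*f_i=\delta_{ef}r(e)$ ($v\in E^0$, $e,f\in s^{-1}(v)$); (iv) $\sum_{e\in s^{-1}(v)}e_ie_j^*=\delta_{ij}v$ ($v\in E^0$, $1\le i,j\le w(v)$). In (iii) and (iv), $e_i$ and $e_i^*$ are set to zero whenever $i>w(e)$. Paths. A path is either a single vertex $v$ (length $0$, with source and range $v$) or a word $p=x_1\dots x_n$ ($n\ge1$) of edges with $r(x_i)=s(x_{i+1})$ for $1\le i\le n-1$ (length $n$, $s(p)=s(x_1)$, $r(p)=r(x_n)$). A cycle based at $v$ is a path $x_1\dots x_n$ of positive length with source and range $v$ such that $s(x_i)\ne s(x_j)$ for $i\neq j$. Write $u\ge v$ if there is a path from $u$ to $v$; $T(u):=\{v\in E^0\mid u\ge v\}$ and $T(X):=\bigcup_{v\in X}T(v)$ for $X\subseteq E^0$. Edges $e,f$ are in line if $e=f$ or $r(e)\ge s(f)$ or $r(f)\ge s(e)$. An edge $e$ is weighted if $w(e)>1$; $E^1_w$ denotes the set of weighted edges. A vertex $v$ emits an edge $e$ if $s(e)=v$. Condition (LPA). $(E,w)$ satisfies Condition (LPA) if all of the following hold: (LPA1) Any vertex $v\in E^0$ emits at most one weighted edge. (LPA2) Any vertex $v\in T(r(E^1_w))$ emits at most one edge. (LPA3) If two weighted edges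 $e,f\in E^1_w$ are not in line, then $T(r(e))\cap T(r(f))=\emptyset$. (LPA4) If $e\in E^1_w$ and $c$ is a cycle based at some vertex $v\in T(r(e))$, then $e$ belongs to $c$ (i.e. $e$ is one of the edges of $c$). *)

theory Defs
  imports "HOL-Library.Poly_Mapping" "Graph_Theory.Arc_Walk"
begin

section \<open>Associative algebras given by generators and relations\<close>

text \<open>
  Algebras are not required to be unital, so the record has no unit. The scalars are a type
  \<open>'k\<close> of class \<open>field\<close>.
\<close>

record ('k, 'a) alg =
  alg_carrier :: "'a set"
  alg_add :: "'a \<Rightarrow> 'a \<Rightarrow> 'a"
  alg_mult :: "'a \<Rightarrow> 'a \<Rightarrow> 'a"
  alg_scale :: "'k \<Rightarrow> 'a \<Rightarrow> 'a"

definition alg_hom :: "('k, 'a) alg \<Rightarrow> ('k, 'b) alg \<Rightarrow> ('a \<Rightarrow> 'b) \<Rightarrow> bool" where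
  "alg_hom A B \<phi> \<longleftrightarrow>
     \<phi> ` alg_carrier A \<subseteq> alg_carrier B \<and>
     (\<forall>x \<in> alg_carrier A. \<forall>y \<in> alg_carrier A.
        \<phi> (alg_add A x y) = alg_add B (\<phi> x) (\<phi> y) \<and>
        \<phi> (alg_mult A x y) = alg_mult B (\<phi> x) (\<phi> y)) \<and>
     (\<forall>k. \<forall>x \<in> alg_carrier A. \<phi> (alg_scale A k x) = alg_scale B k (\<phi> x))"

definition alg_isomorphic :: "('k, 'a) alg \<Rightarrow> ('k, 'b) alg \<Rightarrow> bool" where
  "alg_isomorphic A B \<longleftrightarrow> (\<exists>\<phi>. alg_hom A B \<phi> \<and> bij_betw \<phi> (alg_carrier A) (alg_carrier B))"

text \<open>
  With words under concatenation as exponents, \<open>'x word \<Rightarrow>\<^sub>0 'k\<close> is the free unital algebra on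
  \<open>'x\<close>: the product of finitely supported functions from the library is convolution.
\<close>

datatype 'x word = Word (letters: "'x list")

instantiation word :: (type) monoid_add
begin

definition zero_word :: "'a word" where
  "0 = Word []"

definition plus_word :: "'a word \<Rightarrow> 'a word \<Rightarrow> 'a word" where
  "u + v = Word (letters u @ letters v)"

instance
  by standard (simp_all add: zero_word_def plus_word_def)

end

definition gen :: "'x \<Rightarrow> 'x word \<Rightarrow>\<^sub>0 'k::field" where
  "gen x = Poly_Mapping.single (Word [x]) 1"

text \<open>
  The free (non-unital) algebra on \<open>X\<close> consists of the combinations of nonempty words over \<open>X\<close>.
\<close>

definition free_alg :: "'x set \<Rightarrow> ('x word \<Rightarrow>\<^sub>0 'k::field) set" where
  "free_alg X = {p. \<forall>u \<in> Poly_Mapping.keys p. letters u \<noteq> [] \<and> set (letters u) \<subseteq> X}"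

definition scale :: "'k::field \<Rightarrow> ('x word \<Rightarrow>\<^sub>0 'k) \<Rightarrow> ('x word \<Rightarrow>\<^sub>0 'k)" where
  "scale k p = Poly_Mapping.single 0 k * p"

text \<open>The two-sided ideal of \<open>free_alg X\<close> generated by \<open>R \<subseteq> free_alg X\<close>.\<close>

inductive_set gen_ideal :: "'x set \<Rightarrow> ('x word \<Rightarrow>\<^sub>0 'k::field) set \<Rightarrow> ('x word \<Rightarrow>\<^sub>0 'k) set"
  for X :: "'x set" and R :: "('x word \<Rightarrow>\<^sub>0 'k) set" where
  zero: "0 \<in> gen_ideal X R"
| rel: "p \<in> R \<Longrightarrow> p \<in> gen_ideal X R"
| add: "\<lbrakk>p \<in> gen_ideal X R; q \<in> gen_ideal X R\<rbrakk> \<Longrightarrow> p + q \<in> gen_ideal X R"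
| scale: "p \<in> gen_ideal X R \<Longrightarrow> scale k p \<in> gen_ideal X R"
| left: "\<lbrakk>a \<in> free_alg X; p \<in> gen_ideal X R\<rbrakk> \<Longrightarrow> a * p \<in> gen_ideal X R"
| right: "\<lbrakk>p \<in> gen_ideal X R; a \<in> free_alg X\<rbrakk> \<Longrightarrow> p * a \<in> gen_ideal X R"

definition ideal_coset :: "'x set \<Rightarrow> ('x word \<Rightarrow>\<^sub>0 'k::field) set \<Rightarrow> ('x word \<Rightarrow>\<^sub>0 'k) \<Rightarrow> ('x word \<Rightarrow>\<^sub>0 'k) set" where
  "ideal_coset X R a = (\<lambda>p. a + p) ` gen_ideal X R"

text \<open>
  The algebra with generators \<open>X\<close> and relations \<open>p = 0\<close> for \<open>p \<in> R\<close>. Operations on cosets are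
  the unions over all representatives; all the cosets in such a union coincide.
\<close>

definition presented_alg ::
    "'x set \<Rightarrow> ('x word \<Rightarrow>\<^sub>0 'k::field) set \<Rightarrow> ('k, ('x word \<Rightarrow>\<^sub>0 'k) set) alg" where
  "presented_alg X R =
     \<lparr> alg_carrier = ideal_coset X R ` free_alg X,
       alg_add = (\<lambda>A B. \<Union>a\<in>A. \<Union>b\<in>B. ideal_coset X R (a + b)),
       alg_mult = (\<lambda>A B. \<Union>a\<in>A. \<Union>b\<in>B. ideal_coset X R (a * b)),
       alg_scale = (\<lambda>k A. \<Union>a\<in>A. ideal_coset X R (scale k a)) \<rparr>"


section \<open>Weighted graphs\<close>

definition row_finite :: "('v, 'e) pre_digraph \<Rightarrow> bool" where
  "row_finite E \<longleftrightarrow> (\<forall>v \<in> verts E. finite (out_arcs E v))"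

definition weighted_graph :: "('v, 'e) pre_digraph \<Rightarrow> ('e \<Rightarrow> nat) \<Rightarrow> bool" where
  "weighted_graph E w \<longleftrightarrow> wf_digraph E \<and> (\<forall>e \<in> arcs E. 1 \<le> w e)"

definition vertex_weight :: "('v, 'e) pre_digraph \<Rightarrow> ('e \<Rightarrow> nat) \<Rightarrow> 'v \<Rightarrow> nat" where
  "vertex_weight E w v = (if out_arcs E v = {} then 0 else Max (w ` out_arcs E v))"


section \<open>Leavitt path algebras\<close>

datatype ('v, 'e) lpa_gen = Vertex 'v | Edge 'e | Ghost 'e

definition lpa_gens :: "('v, 'e) pre_digraph \<Rightarrow> ('v, 'e) lpa_gen set" where
  "lpa_gens E = Vertex ` verts E \<union> Edge ` arcs E \<union> Ghost ` arcs E"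

definition lpa_rels :: "('v, 'e) pre_digraph \<Rightarrow> (('v, 'e) lpa_gen word \<Rightarrow>\<^sub>0 'k::field) set" where
  "lpa_rels E =
     (let vx = (\<lambda>v. gen (Vertex v)); ed = (\<lambda>e. gen (Edge e)); gh = (\<lambda>e. gen (Ghost e)) in
       {vx u * vx v - (if u = v then vx u else 0) | u v. u \<in> verts E \<and> v \<in> verts E}
     \<union> {vx (tail E e) * ed e - ed e | e. e \<in> arcs E}
     \<union> {ed e * vx (head E e) - ed e | e. e \<in> arcs E}
     \<union> {vx (head E e) * gh e - gh e | e. e \<in> arcs E}
     \<union> {gh e * vx (tail E e) - gh e | e. e \<in> arcs E}
     \<union> {gh e * ed f - (if e = f then vx (head E e) else 0) | v e f.
          v \<in> verts E \<and> e \<in> out_arcs E v \<and> f \<in> out_arcs E v}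
     \<union> {(\<Sum>e \<in> out_arcs E v. ed e * gh e) - vx v | v. v \<in> verts E \<and> out_arcs E v \<noteq> {}})"

definition leavitt_path_alg ::
    "('v, 'e) pre_digraph \<Rightarrow> ('k::field, (('v, 'e) lpa_gen word \<Rightarrow>\<^sub>0 'k) set) alg" where
  "leavitt_path_alg E = presented_alg (lpa_gens E) (lpa_rels E)"

datatype ('v, 'e) wlpa_gen = WVertex 'v | WEdge 'e nat | WGhost 'e nat

definition wlpa_gens :: "('v, 'e) pre_digraph \<Rightarrow> ('e \<Rightarrow> nat) \<Rightarrow> ('v, 'e) wlpa_gen set" where
  "wlpa_gens E w =
     WVertex ` verts E
     \<union> {WEdge e i | e i. e \<in> arcs E \<and> 1 \<le> i \<and> i \<le> w e}
     \<union> {WGhost e i | e i. e \<in> arcs E \<and> 1 \<le> i \<and> i \<le> w e}"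

definition wlpa_rels ::
    "('v, 'e) pre_digraph \<Rightarrow> ('e \<Rightarrow> nat) \<Rightarrow> (('v, 'e) wlpa_gen word \<Rightarrow>\<^sub>0 'k::field) set" where
  "wlpa_rels E w =
     (let vx = (\<lambda>v. gen (WVertex v));
          ed = (\<lambda>e i. if i \<le> w e then gen (WEdge e i) else 0);
          gh = (\<lambda>e i. if i \<le> w e then gen (WGhost e i) else 0) in
       {vx u * vx v - (if u = v then vx u else 0) | u v. u \<in> verts E \<and> v \<in> verts E}
     \<union> {vx (tail E e) * ed e i - ed e i | e i. e \<in> arcs E \<and> 1 \<le> i \<and> i \<le> w e}
     \<union> {ed e i * vx (head E e) - ed e i | e i. e \<in> arcs E \<and> 1 \<le> i \<and> i \<le> w e}
     \<union> {vx (head E e) * gh e i - gh e i | e i. e \<in> arcs E \<and> 1 \<le> i \<and> i \<le> w e}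
     \<union> {gh e i * vx (tail E e) - gh e i | e i. e \<in> arcs E \<and> 1 \<le> i \<and> i \<le> w e}
     \<union> {(\<Sum>i = 1..vertex_weight E w v. gh e i * ed f i) - (if e = f then vx (head E e) else 0) | v e f.
          v \<in> verts E \<and> e \<in> out_arcs E v \<and> f \<in> out_arcs E v}
     \<union> {(\<Sum>e \<in> out_arcs E v. ed e i * gh e j) - (if i = j then vx v else 0) | v i j.
          v \<in> verts E \<and> i \<in> {1..vertex_weight E w v} \<and> j \<in> {1..vertex_weight E w v}})"

definition weighted_leavitt_path_alg ::
    "('v, 'e) pre_digraph \<Rightarrow> ('e \<Rightarrow> nat) \<Rightarrow> ('k::field, (('v, 'e) wlpa_gen word \<Rightarrow>\<^sub>0 'k) set) alg" where
  "weighted_leavitt_path_alg E w = presented_alg (wlpa_gens E w) (wlpa_rels E w)"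


section \<open>Condition (LPA)\<close>

definition path_to :: "('v, 'e) pre_digraph \<Rightarrow> 'v \<Rightarrow> 'v \<Rightarrow> bool" where
  "path_to E u v \<longleftrightarrow> (\<exists>p. pre_digraph.awalk E u p v)"

definition tree :: "('v, 'e) pre_digraph \<Rightarrow> 'v set \<Rightarrow> 'v set" where
  "tree E X = (\<Union>u \<in> X. {v \<in> verts E. path_to E u v})"

text \<open>
  The library's notion of cycle has no base point, hence this definition, in which a cycle
  visits no vertex twice.
\<close>

definition cycle_based_at :: "('v, 'e) pre_digraph \<Rightarrow> 'v \<Rightarrow> 'e list \<Rightarrow> bool" where
  "cycle_based_at E v c \<longleftrightarrow>
     c \<noteq> [] \<and> pre_digraph.awalk E v c v \<and>
     (\<forall>i < length c. \<forall>j < length c. i \<noteq> j \<longrightarrow> tail E (c ! i) \<noteq> tail E (c ! j))"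

definition in_line :: "('v, 'e) pre_digraph \<Rightarrow> 'e \<Rightarrow> 'e \<Rightarrow> bool" where
  "in_line E e f \<longleftrightarrow> e = f \<or> path_to E (head E e) (tail E f) \<or> path_to E (head E f) (tail E e)"

definition weighted_edges :: "('v, 'e) pre_digraph \<Rightarrow> ('e \<Rightarrow> nat) \<Rightarrow> 'e set" where
  "weighted_edges E w = {e \<in> arcs E. w e > 1}"

definition LPA1 :: "('v, 'e) pre_digraph \<Rightarrow> ('e \<Rightarrow> nat) \<Rightarrow> bool" where
  "LPA1 E w \<longleftrightarrow>
     (\<forall>v \<in> verts E. \<forall>e \<in> weighted_edges E w. \<forall>f \<in> weighted_edges E w.
        tail E e = v \<and> tail E f = v \<longrightarrow> e = f)"

definition LPA2 :: "('v, 'e) pre_digraph \<Rightarrow> ('e \<Rightarrow> nat) \<Rightarrow> bool" where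
  "LPA2 E w \<longleftrightarrow>
     (\<forall>v \<in> tree E (head E ` weighted_edges E w).
        \<forall>e \<in> out_arcs E v. \<forall>f \<in> out_arcs E v. e = f)"

definition LPA3 :: "('v, 'e) pre_digraph \<Rightarrow> ('e \<Rightarrow> nat) \<Rightarrow> bool" where
  "LPA3 E w \<longleftrightarrow>
     (\<forall>e \<in> weighted_edges E w. \<forall>f \<in> weighted_edges E w.
        \<not> in_line E e f \<longrightarrow> tree E {head E e} \<inter> tree E {head E f} = {})"

definition LPA4 :: "('v, 'e) pre_digraph \<Rightarrow> ('e \<Rightarrow> nat) \<Rightarrow> bool" where
  "LPA4 E w \<longleftrightarrow>
     (\<forall>e \<in> weighted_edges E w. \<forall>v \<in> tree E {head E e}. \<forall>c.
        cycle_based_at E v c \<longrightarrow> e \<in> set c)"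

definition condition_LPA :: "('v, 'e) pre_digraph \<Rightarrow> ('e \<Rightarrow> nat) \<Rightarrow> bool" where
  "condition_LPA E w \<longleftrightarrow> LPA1 E w \<and> LPA2 E w \<and> LPA3 E w \<and> LPA4 E w"


section \<open>Being isomorphic to an unweighted Leavitt path algebra\<close>

text \<open>
  A formula cannot quantify over types, so the vertices and edges of the graph \<open>F\<close> in an existential
  statement must range over fixed types; here both are words in the generators of the weighted
  algebra. This universe misses no isomorphism class: such words span \<open>L\<^sub>K(E, w)\<close>, while the
  vertices and edges of \<open>F\<close> are linearly independent in \<open>L\<^sub>K(F)\<close>, so that every \<open>F\<close>
  with \<open>L\<^sub>K(F) \<cong> L\<^sub>K(E, w)\<close> has a copy in it.
\<close>

type_synonym ('v, 'e) universe = "('v, 'e) wlpa_gen word"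

definition lpa_model ::
    "'k::field itself \<Rightarrow> ('v, 'e) pre_digraph \<Rightarrow> ('e \<Rightarrow> nat) \<Rightarrow> ('c, 'd) pre_digraph \<Rightarrow> bool" where
  "lpa_model K E w F \<longleftrightarrow>
     wf_digraph F \<and> row_finite F \<and>
     alg_isomorphic
       (weighted_leavitt_path_alg E w :: ('k, (('v, 'e) wlpa_gen word \<Rightarrow>\<^sub>0 'k) set) alg)
       (leavitt_path_alg F :: ('k, (('c, 'd) lpa_gen word \<Rightarrow>\<^sub>0 'k) set) alg)"

end

theory Submission
  imports Defs "HOL-Library.Function_Algebras"
begin

text \<open>
  To show that (LPA) is necessary, we use a property of the multiplicative semigroup of the algebra. By the
  reduction theorem, every nonzero element of an unweighted Leavitt path algebra can be multiplied
  from both sides to a vertex or to a nonzero Laurent polynomial in a cycle without exits, which lies in a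
  commutative corner without nilpotents. In the weighted algebra the words without subwords
  \<open>\<alpha>\<^sub>i\<alpha>\<^sub>j\<^sup>*\<close> (\<open>\<alpha>\<close> a chosen edge of maximal weight at its source) and \<open>e\<^sub>1\<^sup>*f\<^sub>1\<close> form a basis. If (LPA) fails, there is
  a basis word \<open>p\<close> that starts with a letter \<open>e\<^sub>2\<close> and whose products with basis words on either side
  need no reduction; comparing words shows that no multiple of \<open>p\<close> is of the two kinds above.

  If (LPA) holds, the edges that are weighted or start behind a weighted edge have pairwise distinct
  ranges, so that they can be reversed: the relation \<open>\<Sum>\<^sub>i g\<^sub>i\<^sup>*g\<^sub>i = r(g)\<close> becomes relation (iv) for the reversed
  edges \<open>g\<^sub>1\<^sup>*, \<dots>, g\<^sub>n\<^sup>*\<close> with source \<open>r(g)\<close>. A source of a weighted edge \<open>g\<close> that emits further edges is split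
  into the two orthogonal idempotents \<open>g\<^sub>1g\<^sub>1\<^sup>*\<close> and \<open>v - g\<^sub>1g\<^sub>1\<^sup>*\<close>.
\<close>

section \<open>Free algebras\<close>

text \<open>An isomorphism of algebras need respect neither vertices nor a grading, so necessity has
  to rest on a property stated by products alone. Idempotent multiples would not suffice: in the
  Laurent polynomials, the algebra of a single loop, \<open>1 + x\<close> has no nonzero idempotent
  multiple. The letter \<open>e_2\<close> is chosen because no forbidden pair has it as second
  letter, so nothing multiplied from the left interacts with the word; the last letter is chosen to
  have the same effect on the right.

  Reversal needs distinct ranges, since relation (iii) expresses \<open>r(g)\<close> by the
  \<open>g_i\<close> alone, whereas relation (iv) at a vertex of the new graph sums over all edges
  leaving it. If \<open>g\<close> is weighted and its source \<open>v\<close> emits further edges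
  \<open>f\<close>, these have weight 1. Relation (iv) then gives \<open>g_i g_i^* = v\<close> for
  \<open>i \<ge> 2\<close>, but \<open>g_1 g_1^*\<close> is \<open>v\<close> minus the sum of the
  \<open>f f^*\<close>. So the reversed edge \<open>g_i^*\<close> ends at all of \<open>v\<close>
  for \<open>i \<ge> 2\<close>, \<open>g_1^*\<close> ends only at an idempotent below
  \<open>v\<close>, and the edges \<open>f\<close> leave from its complement. This is the origin of
  the two halves.\<close>

abbreviation "keys \<equiv> Poly_Mapping.keys"
abbreviation "lookup \<equiv> Poly_Mapping.lookup"

abbreviation mon :: "'x list \<Rightarrow> 'x word \<Rightarrow>\<^sub>0 'k::field" where
  "mon xs \<equiv> Poly_Mapping.single (Word xs) 1"

abbreviation const :: "'k::field \<Rightarrow> 'x word \<Rightarrow>\<^sub>0 'k" where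
  "const k \<equiv> Poly_Mapping.single 0 k"

lemma poly_mapping_keys_induct:
  assumes "keys p \<subseteq> S" "P 0"
    and single: "\<And>u k. u \<in> S \<Longrightarrow> P (Poly_Mapping.single u k)"
    and add: "\<And>p q. P p \<Longrightarrow> P q \<Longrightarrow> P (p + q)"
  shows "P (p :: 'a \<Rightarrow>\<^sub>0 'b::comm_monoid_add)"
  using assms(1)
proof (induction p rule: Poly_Mapping.update_induct)
  case const
  show ?case by fact
next
  case (update f a b)
  have "Poly_Mapping.update a b f = f + Poly_Mapping.single a b"
    using update(1)
    by (intro poly_mapping_eqI)
       (auto simp: lookup_update lookup_add lookup_single when_def in_keys_iff)
  moreover have "keys f \<subseteq> S" "a \<in> S"
    using update by (auto simp: keys_update split: if_splits)
  ultimately show ?case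
    using update.IH single add by metis
qed

lemmas poly_mapping_single_induct = poly_mapping_keys_induct[where S = UNIV, simplified, case_names zero single add]

lemma word_add [simp]: "Word xs + Word ys = Word (xs @ ys)"
  by (simp add: plus_word_def)

lemma mon_Nil [simp]: "mon [] = 1"
  by (simp flip: zero_word_def)

lemma mon_Cons: "mon (x # xs) = gen x * mon xs"
  by (simp add: gen_def mult_single)

lemma single_conv_mon: "Poly_Mapping.single u k = const k * mon (letters u)"
  by (cases u) (simp add: mult_single)

lemma const_central: "const k * p = p * const k"
proof (induction p rule: poly_mapping_single_induct)
  case (single u l)
  then show ?case by (simp add: mult_single mult.commute)
qed (simp_all add: distrib_left distrib_right)

lemma const_mult: "const k * const l = const (k * l)"
  by (simp add: mult_single)

lemma const_left_commute: "p * (const k * q) = const k * (p * q)"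
  by (metis const_central mult.assoc)

text \<open>Here \<open>c\<close> is the structure map of the target algebra.\<close>

locale free_eval =
  fixes c :: "'k::field \<Rightarrow> 'r::ring_1" and s :: "'x \<Rightarrow> 'r"
  assumes c_add: "c (k + l) = c k + c l"
    and c_mult: "c (k * l) = c k * c l"
    and c_one: "c 1 = 1"
    and c_comm: "c k * s x = s x * c k"
begin

definition ev :: "('x word \<Rightarrow>\<^sub>0 'k) \<Rightarrow> 'r" where
  "ev p = (\<Sum>u \<in> keys p. c (lookup p u) * prod_list (map s (letters u)))"

lemma c_zero [simp]: "c 0 = 0"
  using c_add[of 0 0] by simp

lemma ev_superset:
  assumes "finite S" "keys p \<subseteq> S"
  shows "ev p = (\<Sum>u \<in> S. c (lookup p u) * prod_list (map s (letters u)))"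
  unfolding ev_def using assms
  by (intro sum.mono_neutral_left) (auto simp: in_keys_iff)

lemma ev_zero [simp]: "ev 0 = 0"
  by (simp add: ev_def)

lemma ev_add: "ev (p + q) = ev p + ev q"
proof -
  let ?S = "keys p \<union> keys q"
  have "keys (p + q) \<subseteq> ?S" by (rule Poly_Mapping.keys_add)
  then show ?thesis
    by (simp add: ev_superset[where S = ?S] lookup_add c_add distrib_right sum.distrib)
qed

lemma ev_single: "ev (Poly_Mapping.single u k) = c k * prod_list (map s (letters u))"
  by (subst ev_superset[where S = "{u}"]) auto

lemma ev_gen [simp]: "ev (gen x) = s x"
  by (simp add: gen_def ev_single c_one)

lemma c_comm_list: "c k * prod_list (map s xs) = prod_list (map s xs) * c k"
proof (induction xs)
  case (Cons x xs)
  have "c k * (s x * prod_list (map s xs)) = s x * (c k * prod_list (map s xs))"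
    by (metis c_comm mult.assoc)
  then show ?case using Cons by (simp add: mult.assoc)
qed simp

lemma ev_mult: "ev (p * q) = ev p * ev q"
proof (induction p rule: poly_mapping_single_induct)
  case (single u k)
  show ?case
  proof (induction q rule: poly_mapping_single_induct)
    case (single v l)
    have "letters (u + v) = letters u @ letters v" by (simp add: plus_word_def)
    then show ?case
      by (simp add: mult_single ev_single c_mult mult.assoc)
         (metis c_comm_list mult.assoc)
  qed (simp_all add: distrib_left ev_add)
qed (simp_all add: distrib_right ev_add)

lemma ev_uminus: "ev (- p) = - ev p"
  using ev_add[of p "- p"] by (simp add: eq_neg_iff_add_eq_0 add.commute)

lemma ev_diff: "ev (p - q) = ev p - ev q"
  using ev_add[of p "- q"] by (simp add: ev_uminus)

lemma ev_sum: "ev (sum f S) = (\<Sum>x\<in>S. ev (f x))"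
  by (induction S rule: infinite_finite_induct) (simp_all add: ev_add)

lemma ev_const: "ev (const k) = c k"
  by (simp add: ev_single zero_word_def)

lemma ev_scale: "ev (scale k p) = c k * ev p"
  by (simp add: scale_def ev_mult ev_const)

lemma ev_mon: "ev (mon xs) = prod_list (map s xs)"
  by (simp add: ev_single c_one)

lemma ev_ideal:
  assumes "p \<in> gen_ideal X R" "\<And>r. r \<in> R \<Longrightarrow> ev r = 0"
  shows "ev p = 0"
  using assms(1)
  by induction (simp_all add: assms(2) ev_add ev_scale ev_mult)

end

section \<open>Ideals and quotients\<close>

lemma free_alg_zero [simp]: "0 \<in> free_alg X"
  by (simp add: free_alg_def)

lemma free_alg_add: "p \<in> free_alg X \<Longrightarrow> q \<in> free_alg X \<Longrightarrow> p + q \<in> free_alg X"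
  using Poly_Mapping.keys_add[of p q] by (fastforce simp: free_alg_def)

lemma free_alg_mult: "p \<in> free_alg X \<Longrightarrow> q \<in> free_alg X \<Longrightarrow> p * q \<in> free_alg X"
  using keys_mult[of p q] by (fastforce simp: free_alg_def plus_word_def)

lemma keys_const_mult: "keys (const k * p) \<subseteq> keys p"
proof
  fix u assume "u \<in> keys (const k * p)"
  then obtain a b where "a \<in> keys (const k)" "b \<in> keys p" "u = a + b"
    using keys_mult[of "const k" p] by blast
  then show "u \<in> keys p" by (simp split: if_splits)
qed

lemma free_alg_const: "p \<in> free_alg X \<Longrightarrow> const k * p \<in> free_alg X"
  using keys_const_mult[of k p] by (auto simp: free_alg_def)

lemma free_alg_scale: "p \<in> free_alg X \<Longrightarrow> scale k p \<in> free_alg X"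
  by (simp add: scale_def free_alg_const)

lemma free_alg_uminus: "p \<in> free_alg X \<Longrightarrow> - p \<in> free_alg X"
  by (simp add: free_alg_def in_keys_iff)

lemma free_alg_diff: "p \<in> free_alg X \<Longrightarrow> q \<in> free_alg X \<Longrightarrow> p - q \<in> free_alg X"
  using free_alg_add[of p X "- q"] free_alg_uminus[of q X] by simp

lemma free_alg_sum: "(\<And>i. i \<in> S \<Longrightarrow> f i \<in> free_alg X) \<Longrightarrow> sum f S \<in> free_alg X"
  by (induction S rule: infinite_finite_induct) (simp_all add: free_alg_add)

lemma free_alg_gen [simp]: "gen x \<in> free_alg X \<longleftrightarrow> x \<in> X"
  by (auto simp: gen_def free_alg_def)

lemma free_alg_mon [simp]: "mon xs \<in> free_alg X \<longleftrightarrow> xs \<noteq> [] \<and> set xs \<subseteq> X"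
  by (auto simp: free_alg_def)

lemmas free_alg_intros = free_alg_zero free_alg_add free_alg_mult free_alg_const free_alg_scale
  free_alg_diff free_alg_sum

lemma free_alg_induct [consumes 1, case_names zero single add]:
  assumes "p \<in> free_alg X" "P 0"
    and "\<And>xs k. xs \<noteq> [] \<Longrightarrow> set xs \<subseteq> X \<Longrightarrow> P (const k * mon xs)"
    and "\<And>p q. P p \<Longrightarrow> P q \<Longrightarrow> P (p + q)"
  shows "P p"
proof (rule poly_mapping_keys_induct[where S = "{u. letters u \<noteq> [] \<and> set (letters u) \<subseteq> X}"])
  show "keys p \<subseteq> {u. letters u \<noteq> [] \<and> set (letters u) \<subseteq> X}"
    using assms(1) by (auto simp: free_alg_def)
  show "P (Poly_Mapping.single u k)" if "u \<in> {u. letters u \<noteq> [] \<and> set (letters u) \<subseteq> X}" for u k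
    using assms(3)[of "letters u" k] that single_conv_mon[of u k] by auto
qed (use assms in auto)

text \<open>Over the whole alphabet the ideal absorbs constants and foreign letters as well. By
  \<open>ideal_of_iff\<close> it meets \<open>free_alg X\<close> in the intended ideal, so most
  computations modulo the relations do not have to track membership in
  \<open>free_alg X\<close>.\<close>

abbreviation ideal_of :: "('x word \<Rightarrow>\<^sub>0 'k::field) set \<Rightarrow> ('x word \<Rightarrow>\<^sub>0 'k) set" where
  "ideal_of R \<equiv> gen_ideal UNIV R"

lemma gen_ideal_uminus: "p \<in> gen_ideal X R \<Longrightarrow> - p \<in> gen_ideal X R"
  using gen_ideal.scale[of p X R "-1"] by (simp add: scale_def single_uminus)

lemma gen_ideal_diff: "p \<in> gen_ideal X R \<Longrightarrow> q \<in> gen_ideal X R \<Longrightarrow> p - q \<in> gen_ideal X R"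
  using gen_ideal.add[of p X R "- q"] gen_ideal_uminus[of q X R] by simp

lemma gen_ideal_free_alg: "R \<subseteq> free_alg X \<Longrightarrow> gen_ideal X R \<subseteq> free_alg X"
proof
  fix p assume R: "R \<subseteq> free_alg X" and "p \<in> gen_ideal X R"
  from this(2) show "p \<in> free_alg X"
    by induction (use R in \<open>auto intro: free_alg_intros\<close>)
qed

text \<open>\<open>gen_ideal\<close> absorbs factors without constant term, and closure under
  scalars takes care of constant factors. The decomposition therefore makes
  \<open>ideal_of R\<close> an ideal of the unital free algebra.\<close>

lemma split_const: "\<exists>k q. q \<in> free_alg UNIV \<and> p = const k + q"
proof (induction p rule: poly_mapping_single_induct)
  case zero
  show ?case by (rule exI[of _ 0], rule exI[of _ 0]) simp
next
  case (single u k)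
  show ?case
  proof (cases "letters u = []")
    case True
    then have "u = 0" by (cases u) (simp add: zero_word_def)
    then show ?thesis by (intro exI[of _ k] exI[of _ 0]) simp
  next
    case False
    then show ?thesis
      by (intro exI[of _ 0] exI[of _ "Poly_Mapping.single u k"]) (auto simp: free_alg_def)
  qed
next
  case (add p q)
  then obtain k a l b where "a \<in> free_alg UNIV" "p = const k + a" "b \<in> free_alg UNIV" "q = const l + b"
    by blast
  then show ?case
    by (intro exI[of _ "k + l"] exI[of _ "a + b"]) (simp add: free_alg_add single_add)
qed

lemma ideal_of_left: "p \<in> ideal_of R \<Longrightarrow> a * p \<in> ideal_of R"
proof -
  assume p: "p \<in> ideal_of R"
  obtain k q where q: "q \<in> free_alg UNIV" "a = const k + q" using split_const by blast
  then show ?thesis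
    using gen_ideal.add[OF gen_ideal.scale[OF p, of k] gen_ideal.left[OF q(1) p]]
    by (simp add: distrib_right scale_def)
qed

lemma ideal_of_right: "p \<in> ideal_of R \<Longrightarrow> p * a \<in> ideal_of R"
proof -
  assume p: "p \<in> ideal_of R"
  obtain k q where q: "q \<in> free_alg UNIV" "a = const k + q" using split_const by blast
  then show ?thesis
    using gen_ideal.add[OF gen_ideal.scale[OF p, of k] gen_ideal.right[OF p q(1)]]
    by (simp add: distrib_left scale_def const_central)
qed

lemma gen_ideal_subset_ideal_of: "gen_ideal X R \<subseteq> ideal_of R"
proof
  fix p assume "p \<in> gen_ideal X R"
  then show "p \<in> ideal_of R"
    by induction (auto intro: gen_ideal.intros ideal_of_left ideal_of_right)
qed

lemma gen_ideal_diff_add: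
  "p - q \<in> ideal_of R \<Longrightarrow> p' - q' \<in> ideal_of R \<Longrightarrow> (p + p') - (q + q') \<in> ideal_of R"
  using gen_ideal.add[of "p - q" UNIV R "p' - q'"] by (simp add: algebra_simps)

lemma gen_ideal_diff_sym: "p - q \<in> gen_ideal X R \<Longrightarrow> q - p \<in> gen_ideal X R"
  using gen_ideal_uminus[of "p - q" X R] by simp

lemma ideal_of_mult:
  "p - q \<in> ideal_of R \<Longrightarrow> p' - q' \<in> ideal_of R \<Longrightarrow> p * p' - q * q' \<in> ideal_of R"
proof -
  assume a: "p - q \<in> ideal_of R" "p' - q' \<in> ideal_of R"
  have "p * p' - q * q' = (p - q) * p' + q * (p' - q')" by (simp add: algebra_simps)
  then show ?thesis using a by (auto intro: gen_ideal.add ideal_of_left ideal_of_right)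
qed

section \<open>Substitution homomorphisms between free algebras\<close>

definition sub :: "('x \<Rightarrow> 'y word \<Rightarrow>\<^sub>0 'k) \<Rightarrow> ('x word \<Rightarrow>\<^sub>0 'k::field) \<Rightarrow> 'y word \<Rightarrow>\<^sub>0 'k" where
  "sub s = free_eval.ev const s"

interpretation sub: free_eval const s
  rewrites "free_eval.ev const s = sub s"
  for s :: "'x \<Rightarrow> 'y word \<Rightarrow>\<^sub>0 'k::field"
proof -
  show "free_eval const s"
    by unfold_locales (simp_all add: single_add mult_single const_central)
  show "free_eval.ev const s = sub s" by (simp add: sub_def)
qed

lemma sub_free_alg:
  assumes "p \<in> free_alg X" "\<And>x. x \<in> X \<Longrightarrow> s x \<in> free_alg Y"
  shows "sub s p \<in> free_alg Y"
  using assms(1)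
proof (induction rule: free_alg_induct)
  case (single xs k)
  have "sub s (mon xs) \<in> free_alg Y"
    using single
  proof (induction xs rule: list_nonempty_induct)
    case (single x)
    then show ?case using assms(2) by (simp add: sub.ev_mon)
  next
    case (cons x xs)
    then show ?case using assms(2) by (auto simp: sub.ev_mon intro: free_alg_intros)
  qed
  then show ?case by (simp add: sub.ev_mult sub.ev_const free_alg_const)
qed (auto simp: sub.ev_add intro: free_alg_intros)

lemma sub_gen_ideal:
  assumes "p \<in> gen_ideal X R" "\<And>r. r \<in> R \<Longrightarrow> sub s r \<in> ideal_of Q"
  shows "sub s p \<in> ideal_of Q"
  using assms(1)
  by induction (auto simp: sub.ev_add sub.ev_mult sub.ev_scale
      intro: assms(2) gen_ideal.intros(1,3) ideal_of_left ideal_of_right)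

text \<open>The substitution that kills the letters outside \<open>X\<close> retracts one ideal onto the other.\<close>

lemma ideal_of_iff:
  assumes R: "R \<subseteq> free_alg X" and p: "p \<in> free_alg X"
  shows "p \<in> ideal_of R \<longleftrightarrow> p \<in> gen_ideal X R"
proof
  define s where "s x = (if x \<in> X then gen x else 0 :: 'a word \<Rightarrow>\<^sub>0 'b)" for x
  have id: "sub s q = q" if "q \<in> free_alg X" for q
    using that
  proof (induction rule: free_alg_induct)
    case (single xs k)
    have "prod_list (map s xs) = mon xs" if "set xs \<subseteq> X"
      using that by (induction xs) (auto simp: s_def mon_Cons simp flip: gen_def)
    with single show ?case
      by (simp add: sub.ev_mult sub.ev_const sub.ev_mon)
  qed (simp_all add: sub.ev_add)
  have fa: "sub s q \<in> free_alg X" if "q \<in> free_alg UNIV" for q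
    using that
  proof (induction rule: free_alg_induct)
    case (single xs k)
    have "prod_list (map s xs) \<in> free_alg X"
      using \<open>xs \<noteq> []\<close>
      by (induction xs rule: list_nonempty_induct) (auto simp: s_def intro: free_alg_intros)
    then show ?case
      by (simp add: sub.ev_mult sub.ev_const sub.ev_mon free_alg_const)
  qed (simp_all add: sub.ev_add free_alg_add)
  assume "p \<in> ideal_of R"
  then have "sub s p \<in> gen_ideal X R"
  proof induction
    case (rel p)
    then have "p \<in> free_alg X" using R by blast
    from id[OF this] rel show ?case by (simp add: gen_ideal.rel)
  qed (auto simp: sub.ev_add sub.ev_mult sub.ev_scale intro: gen_ideal.intros(1,3-) fa simp flip: scale_def)
  then show "p \<in> gen_ideal X R" using id[OF p] by simp
qed (use gen_ideal_subset_ideal_of in blast)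

section \<open>Cosets, presented algebras and their isomorphisms\<close>

lemma ideal_coset_eq_iff: "ideal_coset X R a = ideal_coset X R b \<longleftrightarrow> a - b \<in> gen_ideal X R"
proof
  assume "ideal_coset X R a = ideal_coset X R b"
  moreover have "a \<in> ideal_coset X R a"
    unfolding ideal_coset_def using gen_ideal.zero by force
  ultimately obtain p where "p \<in> gen_ideal X R" "a = b + p" unfolding ideal_coset_def by auto
  then show "a - b \<in> gen_ideal X R" by simp
next
  assume ab: "a - b \<in> gen_ideal X R"
  have "a + p \<in> ideal_coset X R b" if "p \<in> gen_ideal X R" for p
    unfolding ideal_coset_def
    using gen_ideal.add[OF ab that] by (intro image_eqI[of _ _ "a - b + p"]) auto
  moreover have "b + p \<in> ideal_coset X R a" if "p \<in> gen_ideal X R" for p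
    unfolding ideal_coset_def
    using gen_ideal_diff[OF that ab] by (intro image_eqI[of _ _ "p - (a - b)"]) auto
  ultimately show "ideal_coset X R a = ideal_coset X R b"
    by (auto simp: ideal_coset_def)
qed

lemma ideal_coset_self: "a \<in> ideal_coset X R a"
  unfolding ideal_coset_def using gen_ideal.zero by force

lemma ideal_coset_memD: "b \<in> ideal_coset X R a \<Longrightarrow> b - a \<in> gen_ideal X R"
  unfolding ideal_coset_def by auto

context
  fixes X :: "'x set" and R :: "('x word \<Rightarrow>\<^sub>0 'k::field) set"
  assumes R: "R \<subseteq> free_alg X"
begin

abbreviation (input) "cs \<equiv> ideal_coset X R"

lemma cs_eq_iff:
  "a \<in> free_alg X \<Longrightarrow> b \<in> free_alg X \<Longrightarrow> cs a = cs b \<longleftrightarrow> a - b \<in> ideal_of R"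
  by (simp add: ideal_coset_eq_iff ideal_of_iff[OF R] free_alg_diff)

lemma cs_mem_free: "a \<in> free_alg X \<Longrightarrow> b \<in> cs a \<Longrightarrow> b \<in> free_alg X"
  using gen_ideal_free_alg[OF R] by (auto simp: ideal_coset_def intro: free_alg_add)

lemma cs_mem: "b \<in> cs a \<Longrightarrow> b - a \<in> ideal_of R"
  using ideal_coset_memD gen_ideal_subset_ideal_of by blast

lemma presented_carrier: "alg_carrier (presented_alg X R) = cs ` free_alg X"
  by (simp add: presented_alg_def)

text \<open>The sum is a union over all representatives. Congruence modulo the ideal makes all its
  members equal and the index sets are nonempty, so the union is a single coset.\<close>

lemma presented_add:
  assumes "a \<in> free_alg X" "b \<in> free_alg X"
  shows "alg_add (presented_alg X R) (cs a) (cs b) = cs (a + b)"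
proof -
  have eq: "cs (a' + b') = cs (a + b)" if "a' \<in> cs a" "b' \<in> cs b" for a' b'
    using assms cs_mem_free[OF assms(1) that(1)] cs_mem_free[OF assms(2) that(2)]
      gen_ideal_diff_add[OF cs_mem[OF that(1)] cs_mem[OF that(2)]]
    by (subst cs_eq_iff) (auto intro: free_alg_intros)
  have "alg_add (presented_alg X R) (cs a) (cs b) = (\<Union>a'\<in>cs a. \<Union>b'\<in>cs b. cs (a' + b'))"
    by (simp add: presented_alg_def)
  also have "\<dots> = (\<Union>a'\<in>cs a. \<Union>b'\<in>cs b. cs (a + b))"
    by (intro SUP_cong refl eq)
  also have "\<dots> = cs (a + b)"
    using ideal_coset_self[of a X R] ideal_coset_self[of b X R] by blast
  finally show ?thesis .
qed

lemma presented_mult: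
  assumes "a \<in> free_alg X" "b \<in> free_alg X"
  shows "alg_mult (presented_alg X R) (cs a) (cs b) = cs (a * b)"
proof -
  have eq: "cs (a' * b') = cs (a * b)" if "a' \<in> cs a" "b' \<in> cs b" for a' b'
    using assms cs_mem_free[OF assms(1) that(1)] cs_mem_free[OF assms(2) that(2)]
      ideal_of_mult[OF cs_mem[OF that(1)] cs_mem[OF that(2)]]
    by (subst cs_eq_iff) (auto intro: free_alg_intros)
  have "alg_mult (presented_alg X R) (cs a) (cs b) = (\<Union>a'\<in>cs a. \<Union>b'\<in>cs b. cs (a' * b'))"
    by (simp add: presented_alg_def)
  also have "\<dots> = (\<Union>a'\<in>cs a. \<Union>b'\<in>cs b. cs (a * b))"
    by (intro SUP_cong refl eq)
  also have "\<dots> = cs (a * b)"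
    using ideal_coset_self[of a X R] ideal_coset_self[of b X R] by blast
  finally show ?thesis .
qed

lemma presented_scale:
  assumes "a \<in> free_alg X"
  shows "alg_scale (presented_alg X R) k (cs a) = cs (scale k a)"
proof -
  have eq: "cs (scale k a') = cs (scale k a)" if "a' \<in> cs a" for a'
    using assms cs_mem_free[OF assms that] ideal_of_left[OF cs_mem[OF that], of "const k"]
    by (subst cs_eq_iff) (auto simp: scale_def right_diff_distrib intro: free_alg_intros)
  have "alg_scale (presented_alg X R) k (cs a) = (\<Union>a'\<in>cs a. cs (scale k a'))"
    by (simp add: presented_alg_def)
  also have "\<dots> = (\<Union>a'\<in>cs a. cs (scale k a))"
    by (intro SUP_cong refl eq)
  also have "\<dots> = cs (scale k a)"
    using ideal_coset_self[of a X R] by blast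
  finally show ?thesis .
qed

end

text \<open>Congruence modulo the ideal is compatible with sums and products, so a composite of
  substitutions that fixes the generators up to the ideal fixes everything up to the ideal.\<close>

lemma sub_sub_inverse:
  assumes "p \<in> free_alg X" and ts: "\<And>x. x \<in> X \<Longrightarrow> sub t (s x) - gen x \<in> ideal_of R"
  shows "sub t (sub s p) - p \<in> ideal_of R"
  using assms(1)
proof (induction rule: free_alg_induct)
  case (single xs k)
  have "sub t (sub s (mon xs)) - mon xs \<in> ideal_of R" if "set xs \<subseteq> X"
    using that
  proof (induction xs)
    case (Cons x xs)
    then have "sub t (sub s (mon xs)) - mon xs \<in> ideal_of R" "sub t (s x) - gen x \<in> ideal_of R"
      using ts by auto
    from ideal_of_mult[OF this(2,1)] show ?case
      by (simp only: mon_Cons sub.ev_mult sub.ev_gen)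
  next
    case Nil
    have "sub t 1 = 1" "sub s 1 = 1"
      using sub.ev_const[of _ 1] by simp_all
    then show ?case by (simp add: gen_ideal.zero)
  qed
  from ideal_of_left[OF this, of "const k"] single show ?case
    by (simp add: sub.ev_mult sub.ev_const algebra_simps)
qed (simp_all add: gen_ideal.zero sub.ev_add gen_ideal_diff_add)

text \<open>Substitutions that send relations into the opposite ideal descend to the quotients, and
  there they are mutually inverse because they are so on generators. Only generators and relations
  have to be checked.\<close>

lemma presented_alg_isomorphic:
  fixes R :: "('x word \<Rightarrow>\<^sub>0 'k::field) set" and Q :: "('y word \<Rightarrow>\<^sub>0 'k) set"
  assumes R: "R \<subseteq> free_alg X" and Q: "Q \<subseteq> free_alg Y"
    and s: "\<And>x. x \<in> X \<Longrightarrow> s x \<in> free_alg Y" and t: "\<And>y. y \<in> Y \<Longrightarrow> t y \<in> free_alg X"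
    and sR: "\<And>r. r \<in> R \<Longrightarrow> sub s r \<in> ideal_of Q" and tQ: "\<And>q. q \<in> Q \<Longrightarrow> sub t q \<in> ideal_of R"
    and ts: "\<And>x. x \<in> X \<Longrightarrow> sub t (s x) - gen x \<in> ideal_of R"
    and st: "\<And>y. y \<in> Y \<Longrightarrow> sub s (t y) - gen y \<in> ideal_of Q"
  shows "alg_isomorphic (presented_alg X R) (presented_alg Y Q)"
proof -
  \<comment> \<open>\<open>\<phi>\<close> works on a representative chosen by \<open>SOME\<close>;
    the next claim makes the choice harmless, as \<open>s\<close> respects the relations.\<close>
  define \<phi> where "\<phi> A = ideal_coset Y Q (sub s (SOME a. a \<in> free_alg X \<and> A = ideal_coset X R a))" for A
  have \<phi>: "\<phi> (ideal_coset X R a) = ideal_coset Y Q (sub s a)" if a: "a \<in> free_alg X" for a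
  proof -
    let ?b = "SOME b. b \<in> free_alg X \<and> ideal_coset X R a = ideal_coset X R b"
    have b: "?b \<in> free_alg X \<and> ideal_coset X R a = ideal_coset X R ?b"
      by (rule someI[of _ a]) (use a in simp)
    then have "a - ?b \<in> ideal_of R" using cs_eq_iff[OF R a] by blast
    then have "sub s (a - ?b) \<in> ideal_of Q" by (rule sub_gen_ideal) (rule sR)
    then have "ideal_coset Y Q (sub s a) = ideal_coset Y Q (sub s ?b)"
      using a b s by (subst cs_eq_iff[OF Q]) (auto simp: sub.ev_diff intro: sub_free_alg)
    then show ?thesis by (simp add: \<phi>_def)
  qed
  have sf: "sub s a \<in> free_alg Y" if "a \<in> free_alg X" for a
    using that s by (rule sub_free_alg)
  have tf: "sub t a \<in> free_alg X" if "a \<in> free_alg Y" for a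
    using that t by (rule sub_free_alg)
  have "alg_hom (presented_alg X R) (presented_alg Y Q) \<phi>"
    unfolding alg_hom_def
    by (auto simp: presented_carrier[OF R] presented_carrier[OF Q] presented_add[OF R] presented_add[OF Q]
        presented_mult[OF R] presented_mult[OF Q] presented_scale[OF R] presented_scale[OF Q] \<phi> sf
        free_alg_intros sub.ev_add sub.ev_mult sub.ev_scale simp flip: scale_def)
  moreover have "inj_on \<phi> (alg_carrier (presented_alg X R))"
  proof (rule inj_onI, unfold presented_carrier[OF R], clarify)
    fix a b assume a: "a \<in> free_alg X" and b: "b \<in> free_alg X"
      and eq: "\<phi> (ideal_coset X R a) = \<phi> (ideal_coset X R b)"
    then have "sub s a - sub s b \<in> ideal_of Q" using cs_eq_iff[OF Q sf sf] by (simp add: \<phi>)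
    then have "sub t (sub s a - sub s b) \<in> ideal_of R" by (rule sub_gen_ideal) (rule tQ)
    moreover have "sub t (sub s (a - b)) - (a - b) \<in> ideal_of R"
      by (rule sub_sub_inverse[OF _ ts]) (use a b in \<open>auto intro: free_alg_diff\<close>)
    ultimately have "a - b \<in> ideal_of R"
      using gen_ideal_diff by (fastforce simp: sub.ev_diff)
    then show "ideal_coset X R a = ideal_coset X R b" using cs_eq_iff[OF R a b] by simp
  qed
  moreover have "alg_carrier (presented_alg Y Q) \<subseteq> \<phi> ` alg_carrier (presented_alg X R)"
  proof (unfold presented_carrier[OF R] presented_carrier[OF Q], clarify)
    fix b :: "'y word \<Rightarrow>\<^sub>0 'k" assume b: "b \<in> free_alg Y"
    have "sub s (sub t b) - b \<in> ideal_of Q" by (rule sub_sub_inverse[OF b st])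
    then have "ideal_coset Y Q b = \<phi> (ideal_coset X R (sub t b))"
      using b by (simp add: \<phi> tf sf cs_eq_iff[OF Q] gen_ideal_diff_sym)
    then show "ideal_coset Y Q b \<in> \<phi> ` ideal_coset X R ` free_alg X" using tf[OF b] by blast
  qed
  ultimately show ?thesis
    unfolding alg_isomorphic_def bij_betw_def by (metis alg_hom_def subset_antisym)
qed

section \<open>Rings of endomorphisms\<close>

text \<open>Additive rather than linear maps: scalar multiplications are then elements of the ring
  and can serve as the structure map of \<open>free_eval\<close>. The class \<open>ring_1\<close>
  makes the additive group of \<open>'a\<close> nontrivial, whence \<open>0 \<noteq> 1\<close> in
  the ring of endomorphisms.\<close>

typedef (overloaded) 'a endo = "{f :: 'a::ring_1 \<Rightarrow> 'a. \<forall>x y. f (x + y) = f x + f y}"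
  morphisms app Endo
  by (rule exI[of _ "\<lambda>x. x"]) simp

setup_lifting type_definition_endo

lemma app_add [simp]: "app f (x + y) = app f x + app f y"
  using app[of f] by simp

instantiation endo :: (ring_1) ring_1
begin

lift_definition zero_endo :: "'a endo" is "\<lambda>_. 0" by simp
lift_definition one_endo :: "'a endo" is "\<lambda>x. x" by simp
lift_definition plus_endo :: "'a endo \<Rightarrow> 'a endo \<Rightarrow> 'a endo" is "\<lambda>f g x. f x + g x"
  by (simp add: add_ac)
lift_definition uminus_endo :: "'a endo \<Rightarrow> 'a endo" is "\<lambda>f x. - f x" by simp
lift_definition minus_endo :: "'a endo \<Rightarrow> 'a endo \<Rightarrow> 'a endo" is "\<lambda>f g x. f x - g x"
  by (simp add: algebra_simps)
lift_definition times_endo :: "'a endo \<Rightarrow> 'a endo \<Rightarrow> 'a endo" is "\<lambda>f g x. f (g x)" by simp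

instance
proof
  show "(0 :: 'a endo) \<noteq> 1"
    by transfer (metis zero_neq_one)
qed (transfer; simp add: algebra_simps)+

end

lemma app_zero_endo [simp]: "app 0 x = 0"
  and app_one_endo [simp]: "app 1 x = x"
  and app_plus_endo [simp]: "app (f + g) x = app f x + app g x"
  and app_times_endo [simp]: "app (f * g) x = app f (app g x)"
  by (transfer; simp)+

lemma app_zero [simp]: "app f 0 = 0"
  using app_add[of f 0 0] by simp

lemma app_sum: "app (sum F S) x = (\<Sum>i\<in>S. app (F i) x)"
  by (induction S rule: infinite_finite_induct) simp_all

lemma endo_eqI: "(\<And>x. app f x = app g x) \<Longrightarrow> f = g"
  by (metis app_inject ext)

text \<open>
  A linear projection \<open>x \<mapsto> x - g x\<close> with kernel the ideal turns the quotient algebra into a ring of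
  operators on the free algebra, so that relations become equations in a type of class \<open>ring\<close>.
\<close>

lemma quotient_ring:
  fixes R :: "('x word \<Rightarrow>\<^sub>0 'k::field) set"
  obtains \<rho> :: "('x word \<Rightarrow>\<^sub>0 'k) \<Rightarrow> ('x word \<Rightarrow>\<^sub>0 'k) endo"
  where "\<And>a b. \<rho> (a + b) = \<rho> a + \<rho> b" "\<And>a b. \<rho> (a * b) = \<rho> a * \<rho> b"
    "\<And>a. \<rho> a = 0 \<longleftrightarrow> a \<in> ideal_of R"
proof -
  interpret vector_space "scale :: 'k \<Rightarrow> ('x word \<Rightarrow>\<^sub>0 'k) \<Rightarrow> _"
    by unfold_locales (simp_all add: scale_def distrib_left distrib_right single_add mult_single
        mult.assoc[symmetric])
  interpret vector_space_pair "scale :: 'k \<Rightarrow> ('x word \<Rightarrow>\<^sub>0 'k) \<Rightarrow> _" "scale :: 'k \<Rightarrow> ('x word \<Rightarrow>\<^sub>0 'k) \<Rightarrow> _"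
    by unfold_locales
  have "subspace (ideal_of R)"
    by (auto simp: subspace_def intro: gen_ideal.intros)
  then obtain g where g: "range g \<subseteq> ideal_of R" "Vector_Spaces.linear scale scale g" "\<And>x. x \<in> ideal_of R \<Longrightarrow> g x = x"
    using linear_exists_left_inverse_on[OF linear_id, of "ideal_of R"] by auto
  interpret g: Vector_Spaces.linear scale scale g by (rule g(2))
  define \<pi> where "\<pi> x = x - g x" for x
  have \<pi>_add: "\<pi> (x + y) = \<pi> x + \<pi> y" for x y
    by (simp add: \<pi>_def g.add)
  have \<pi>_0: "\<pi> x = 0 \<longleftrightarrow> x \<in> ideal_of R" for x
    using g(1,3) unfolding \<pi>_def by (metis eq_iff_diff_eq_0 rangeI subsetD)
  \<comment> \<open>\<open>\<pi>\<close> kills the ideal and hence \<open>a * g y\<close>. Thus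
    multiplication by \<open>a\<close> may be followed by \<open>\<pi>\<close> at every stage, which
    makes \<open>\<rho>\<close> multiplicative.\<close>
  have \<pi>_mult: "\<pi> (a * \<pi> y) = \<pi> (a * y)" for a y
  proof -
    have "a * g y \<in> ideal_of R" using g(1) by (auto intro: ideal_of_left)
    then have "\<pi> (a * \<pi> y) + \<pi> (a * g y) = \<pi> (a * \<pi> y)" using \<pi>_0 by simp
    then show ?thesis by (simp add: \<pi>_add[symmetric] distrib_left[symmetric]) (simp add: \<pi>_def)
  qed
  define \<rho> where "\<rho> a = Endo (\<lambda>x. \<pi> (a * x))" for a
  have app: "app (\<rho> a) x = \<pi> (a * x)" for a x
    unfolding \<rho>_def by (subst Endo_inverse) (simp_all add: distrib_left \<pi>_add)
  show ?thesis
  proof (rule that)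
    show "\<rho> (a + b) = \<rho> a + \<rho> b" for a b
      by (rule endo_eqI) (simp add: app distrib_right \<pi>_add)
    show "\<rho> (a * b) = \<rho> a * \<rho> b" for a b
      by (rule endo_eqI) (simp add: app \<pi>_mult mult.assoc)
    show "\<rho> a = 0 \<longleftrightarrow> a \<in> ideal_of R" for a
    proof
      assume "\<rho> a = 0"
      \<comment> \<open>Evaluation at the unit recovers \<open>\<pi> a\<close>. This is why the
        operators act on the unital free algebra.\<close>
      then have "\<pi> (a * 1) = 0" using app[of a 1] by simp
      then show "a \<in> ideal_of R" by (simp add: \<pi>_0)
    next
      assume "a \<in> ideal_of R"
      then show "\<rho> a = 0" by (intro endo_eqI) (simp add: app \<pi>_0 ideal_of_right)
    qed
  qed
qed

section \<open>A multiplicative property invariant under isomorphism\<close>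

text \<open>
  An algebra has the reduction property if every nonzero \<open>a\<close> has a nonzero multiple \<open>u = b a c\<close>
  that is idempotent or behaves like an element of a commutative corner without nilpotents. The second
  alternative is stated without reference to a corner, so that it only involves products.
\<close>

definition alg_is_zero :: "('k, 'a) alg \<Rightarrow> 'a \<Rightarrow> bool" where
  "alg_is_zero A z \<longleftrightarrow> alg_add A z z = z"

definition reduced_element :: "('k, 'a) alg \<Rightarrow> 'a \<Rightarrow> bool" where
  "reduced_element A u \<longleftrightarrow>
     (let C = alg_carrier A; m = alg_mult A in
       \<not> alg_is_zero A u \<and>
       (m u u = u \<or>
         (\<exists>s\<in>C. \<not> alg_is_zero A (m (m u s) u)) \<and>
         (\<forall>s\<in>C. \<forall>t\<in>C. m (m (m (m u s) u) t) u = m (m (m (m u t) u) s) u)))"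

definition reduction_property :: "('k, 'a) alg \<Rightarrow> bool" where
  "reduction_property A \<longleftrightarrow>
     (\<forall>a\<in>alg_carrier A. \<not> alg_is_zero A a \<longrightarrow>
        (\<exists>b\<in>alg_carrier A. \<exists>c\<in>alg_carrier A. reduced_element A (alg_mult A (alg_mult A b a) c)))"

lemma reduction_property_isomorphic:
  assumes "alg_isomorphic A B" and red: "reduction_property B"
    and closed: "\<And>x y. x \<in> alg_carrier A \<Longrightarrow> y \<in> alg_carrier A \<Longrightarrow> alg_mult A x y \<in> alg_carrier A"
    and closed_add: "\<And>x y. x \<in> alg_carrier A \<Longrightarrow> y \<in> alg_carrier A \<Longrightarrow> alg_add A x y \<in> alg_carrier A"
  shows "reduction_property A"
proof -
  obtain f where hom: "alg_hom A B f" and bij: "bij_betw f (alg_carrier A) (alg_carrier B)"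
    using assms(1) by (auto simp: alg_isomorphic_def)
  let ?C = "alg_carrier A" and ?m = "alg_mult A"
  have fC: "f x \<in> alg_carrier B" if "x \<in> ?C" for x using bij that bij_betwE by fast
  have inj: "x = y" if "f x = f y" "x \<in> ?C" "y \<in> ?C" for x y
    using bij that by (meson bij_betw_def inj_onD)
  have fm: "f (?m x y) = alg_mult B (f x) (f y)" if "x \<in> ?C" "y \<in> ?C" for x y
    using hom that by (simp add: alg_hom_def)
  have fz: "alg_is_zero B (f x) \<longleftrightarrow> alg_is_zero A x" if "x \<in> ?C" for x
  proof -
    have "f (alg_add A x x) = alg_add B (f x) (f x)" using hom that by (simp add: alg_hom_def)
    then show ?thesis
      using inj[OF _ closed_add[OF that that] that] unfolding alg_is_zero_def by metis
  qed
  have surj: "\<exists>x\<in>?C. y = f x" if "y \<in> alg_carrier B" for y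
    using bij that by (auto simp: bij_betw_def)
  have red_f: "reduced_element A u" if u: "u \<in> ?C" and ru: "reduced_element B (f u)" for u
    unfolding reduced_element_def Let_def
  proof (intro conjI)
    show "\<not> alg_is_zero A u" using ru u fz by (simp add: reduced_element_def Let_def)
    from ru have "alg_mult B (f u) (f u) = f u \<or>
             (\<exists>s\<in>alg_carrier B. \<not> alg_is_zero B (alg_mult B (alg_mult B (f u) s) (f u))) \<and>
             (\<forall>s\<in>alg_carrier B. \<forall>t\<in>alg_carrier B. alg_mult B (alg_mult B (alg_mult B (alg_mult B (f u) s) (f u)) t) (f u)
                = alg_mult B (alg_mult B (alg_mult B (alg_mult B (f u) t) (f u)) s) (f u))"
      by (simp add: reduced_element_def Let_def)
    then show "?m u u = u \<or> (\<exists>s\<in>?C. \<not> alg_is_zero A (?m (?m u s) u)) \<and>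
             (\<forall>s\<in>?C. \<forall>t\<in>?C. ?m (?m (?m (?m u s) u) t) u = ?m (?m (?m (?m u t) u) s) u)"
    proof (elim disj_forward conj_forward)
      assume "alg_mult B (f u) (f u) = f u"
      then show "?m u u = u" using u by (intro inj) (simp_all add: fm closed)
    next
      assume "\<exists>s\<in>alg_carrier B. \<not> alg_is_zero B (alg_mult B (alg_mult B (f u) s) (f u))"
      then obtain s where s: "s \<in> ?C" "\<not> alg_is_zero B (alg_mult B (alg_mult B (f u) (f s)) (f u))"
        using surj by blast
      then have "\<not> alg_is_zero B (f (?m (?m u s) u))"
        using u by (simp add: fm closed)
      then show "\<exists>s\<in>?C. \<not> alg_is_zero A (?m (?m u s) u)"
        using s(1) u by (auto simp: fz closed)
    next
      assume *: "\<forall>s\<in>alg_carrier B. \<forall>t\<in>alg_carrier B. alg_mult B (alg_mult B (alg_mult B (alg_mult B (f u) s) (f u)) t) (f u)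
                = alg_mult B (alg_mult B (alg_mult B (alg_mult B (f u) t) (f u)) s) (f u)"
      show "\<forall>s\<in>?C. \<forall>t\<in>?C. ?m (?m (?m (?m u s) u) t) u = ?m (?m (?m (?m u t) u) s) u"
        using u * by (intro ballI inj) (simp_all add: fm closed fC)
    qed
  qed
  show ?thesis
    unfolding reduction_property_def
  proof (intro ballI impI)
    fix a assume a: "a \<in> ?C" "\<not> alg_is_zero A a"
    then have "f a \<in> alg_carrier B" "\<not> alg_is_zero B (f a)" by (simp_all add: fC fz)
    with red obtain b' c' where bc': "b' \<in> alg_carrier B" "c' \<in> alg_carrier B"
        "reduced_element B (alg_mult B (alg_mult B b' (f a)) c')"
      unfolding reduction_property_def by blast
    then obtain b c where bc: "b \<in> ?C" "c \<in> ?C" "b' = f b" "c' = f c" using surj by blast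
    then have "reduced_element A (?m (?m b a) c)"
      using bc' a by (intro red_f) (simp_all add: closed fm)
    then show "\<exists>b\<in>?C. \<exists>c\<in>?C. reduced_element A (?m (?m b a) c)" using bc by blast
  qed
qed

lemma presented_alg_closed:
  assumes R: "R \<subseteq> free_alg X"
    and x: "x \<in> alg_carrier (presented_alg X R)" and y: "y \<in> alg_carrier (presented_alg X R)"
  shows "alg_mult (presented_alg X R) x y \<in> alg_carrier (presented_alg X R)"
    and "alg_add (presented_alg X R) x y \<in> alg_carrier (presented_alg X R)"
proof -
  obtain a b where "x = ideal_coset X R a" "y = ideal_coset X R b" "a \<in> free_alg X" "b \<in> free_alg X"
    using x y by (auto simp: presented_carrier[OF R])
  then show "alg_mult (presented_alg X R) x y \<in> alg_carrier (presented_alg X R)"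
    "alg_add (presented_alg X R) x y \<in> alg_carrier (presented_alg X R)"
    by (auto simp: presented_carrier[OF R] presented_mult[OF R] presented_add[OF R] free_alg_intros)
qed

lemma reduction_property_presented_alg:
  assumes R: "R \<subseteq> free_alg X"
  shows "reduction_property (presented_alg X R) \<longleftrightarrow>
    (\<forall>a\<in>free_alg X. a \<notin> ideal_of R \<longrightarrow>
      (\<exists>b\<in>free_alg X. \<exists>c\<in>free_alg X. let u = b * a * c in u \<notin> ideal_of R \<and>
        (u * u - u \<in> ideal_of R \<or>
          (\<exists>s\<in>free_alg X. u * s * u \<notin> ideal_of R) \<and>
          (\<forall>s\<in>free_alg X. \<forall>t\<in>free_alg X. u * s * u * t * u - u * t * u * s * u \<in> ideal_of R))))"
proof -
  have z: "alg_is_zero (presented_alg X R) (ideal_coset X R a) \<longleftrightarrow> a \<in> ideal_of R" if "a \<in> free_alg X" for a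
    using that by (simp add: alg_is_zero_def presented_add[OF R] cs_eq_iff[OF R] free_alg_intros)
  show ?thesis
    unfolding reduction_property_def reduced_element_def Let_def presented_carrier[OF R]
    by (simp add: z presented_mult[OF R] cs_eq_iff[OF R] free_alg_intros cong: conj_cong)
qed

section \<open>Families satisfying the relations of a Leavitt path algebra\<close>

lemma fun_sum_apply: "(sum f S) x = (\<Sum>i\<in>S. f i x)"
  by (induction S rule: infinite_finite_induct) auto

locale nonunital_ring_hom =
  fixes h :: "'a::ring \<Rightarrow> 'b::ring"
  assumes add: "h (x + y) = h x + h y"
    and mult: "h (x * y) = h x * h y"
begin

lemma zero [simp]: "h 0 = 0"
  using add[of 0 0] by simp

lemma uminus: "h (- x) = - h x"
  using add[of x "- x"] by (simp add: eq_neg_iff_add_eq_0 add.commute)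

lemma diff: "h (x - y) = h x - h y"
  using add[of x "- y"] by (simp add: uminus)

lemma sum: "h (sum f S) = (\<Sum>i\<in>S. h (f i))"
  by (induction S rule: infinite_finite_induct) (simp_all add: add)

end

text \<open>The elements \<open>ed e i\<close> and \<open>gh e i\<close> with \<open>i = 0\<close> are junk: no relation mentions them.\<close>

locale wlpa_family =
  fixes E :: "('v, 'e) pre_digraph" and w :: "'e \<Rightarrow> nat"
    and vx :: "'v \<Rightarrow> 'r::ring" and ed gh :: "'e \<Rightarrow> nat \<Rightarrow> 'r"
  assumes vx_vx: "u \<in> verts E \<Longrightarrow> v \<in> verts E \<Longrightarrow> vx u * vx v = (if u = v then vx u else 0)"
    and vx_ed: "e \<in> arcs E \<Longrightarrow> 1 \<le> i \<Longrightarrow> i \<le> w e \<Longrightarrow> vx (tail E e) * ed e i = ed e i"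
    and ed_vx: "e \<in> arcs E \<Longrightarrow> 1 \<le> i \<Longrightarrow> i \<le> w e \<Longrightarrow> ed e i * vx (head E e) = ed e i"
    and vx_gh: "e \<in> arcs E \<Longrightarrow> 1 \<le> i \<Longrightarrow> i \<le> w e \<Longrightarrow> vx (head E e) * gh e i = gh e i"
    and gh_vx: "e \<in> arcs E \<Longrightarrow> 1 \<le> i \<Longrightarrow> i \<le> w e \<Longrightarrow> gh e i * vx (tail E e) = gh e i"
    and gh_ed: "v \<in> verts E \<Longrightarrow> e \<in> out_arcs E v \<Longrightarrow> f \<in> out_arcs E v \<Longrightarrow>
      (\<Sum>i = 1..vertex_weight E w v. gh e i * ed f i) = (if e = f then vx (head E e) else 0)"
    and ed_gh: "v \<in> verts E \<Longrightarrow> i \<in> {1..vertex_weight E w v} \<Longrightarrow> j \<in> {1..vertex_weight E w v} \<Longrightarrow>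
      (\<Sum>e \<in> out_arcs E v. ed e i * gh e j) = (if i = j then vx v else 0)"
    and ed_zero: "w e < i \<Longrightarrow> ed e i = 0"
    and gh_zero: "w e < i \<Longrightarrow> gh e i = 0"

lemma ball_relations:
  "(\<forall>r\<in>A \<union> B. Q r) \<longleftrightarrow> (\<forall>r\<in>A. Q r) \<and> (\<forall>r\<in>B. Q r)"
  "(\<forall>r\<in>{f x | x. P1 x}. Q r) \<longleftrightarrow> (\<forall>x. P1 x \<longrightarrow> Q (f x))"
  "(\<forall>r\<in>{g x y | x y. P2 x y}. Q r) \<longleftrightarrow> (\<forall>x y. P2 x y \<longrightarrow> Q (g x y))"
  "(\<forall>r\<in>{k x y z | x y z. P3 x y z}. Q r) \<longleftrightarrow> (\<forall>x y z. P3 x y z \<longrightarrow> Q (k x y z))"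
  by blast+

text \<open>Forwards, this yields the relations in a quotient as equations; backwards, it shows that
  an evaluation kills the ideal. The map \<open>h\<close> may fail to preserve the unit:
  \<open>\<rho>\<close> from \<open>quotient_ring\<close> sends 1 to the projection
  \<open>\<pi>\<close>.\<close>

lemma wlpa_family_iff:
  fixes h :: "(('v, 'e) wlpa_gen word \<Rightarrow>\<^sub>0 'k::field) \<Rightarrow> 'r::ring"
  assumes "nonunital_ring_hom h"
  shows "(\<forall>r \<in> wlpa_rels E w. h r = 0) \<longleftrightarrow>
    wlpa_family E w (\<lambda>v. h (gen (WVertex v)))
      (\<lambda>e i. if i \<le> w e then h (gen (WEdge e i)) else 0)
      (\<lambda>e i. if i \<le> w e then h (gen (WGhost e i)) else 0)"
proof -
  interpret h: nonunital_ring_hom h by fact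
  have if_h: "h (if b then x else 0) = (if b then h x else 0)" for b x by simp
  show ?thesis
    unfolding wlpa_rels_def Let_def ball_relations h.diff h.mult h.sum if_h h.zero right_minus_eq
      wlpa_family_def
    by (safe; simp)
qed

locale lpa_family =
  fixes F :: "('c, 'd) pre_digraph"
    and vx :: "'c \<Rightarrow> 'r::ring" and ed gh :: "'d \<Rightarrow> 'r"
  assumes vx_vx: "u \<in> verts F \<Longrightarrow> v \<in> verts F \<Longrightarrow> vx u * vx v = (if u = v then vx u else 0)"
    and vx_ed: "e \<in> arcs F \<Longrightarrow> vx (tail F e) * ed e = ed e"
    and ed_vx: "e \<in> arcs F \<Longrightarrow> ed e * vx (head F e) = ed e"
    and vx_gh: "e \<in> arcs F \<Longrightarrow> vx (head F e) * gh e = gh e"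
    and gh_vx: "e \<in> arcs F \<Longrightarrow> gh e * vx (tail F e) = gh e"
    and gh_ed: "v \<in> verts F \<Longrightarrow> e \<in> out_arcs F v \<Longrightarrow> f \<in> out_arcs F v \<Longrightarrow>
      gh e * ed f = (if e = f then vx (head F e) else 0)"
    and ed_gh: "v \<in> verts F \<Longrightarrow> out_arcs F v \<noteq> {} \<Longrightarrow> (\<Sum>e \<in> out_arcs F v. ed e * gh e) = vx v"

lemma lpa_family_iff:
  fixes h :: "(('c, 'd) lpa_gen word \<Rightarrow>\<^sub>0 'k::field) \<Rightarrow> 'r::ring"
  assumes "nonunital_ring_hom h"
  shows "(\<forall>r \<in> lpa_rels F. h r = 0) \<longleftrightarrow>
    lpa_family F (\<lambda>v. h (gen (Vertex v))) (\<lambda>e. h (gen (Edge e))) (\<lambda>e. h (gen (Ghost e)))"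
proof -
  interpret h: nonunital_ring_hom h by fact
  have if_h: "h (if b then x else 0) = (if b then h x else 0)" for b x by simp
  show ?thesis
    unfolding lpa_rels_def Let_def ball_relations h.diff h.mult h.sum if_h h.zero right_minus_eq
      lpa_family_def
    by (rule iffI; elim conjE; intro conjI allI impI; (elim conjE)?; blast)
qed

lemma free_alg_if:
  "(b \<Longrightarrow> p \<in> free_alg X) \<Longrightarrow> (\<not> b \<Longrightarrow> q \<in> free_alg X) \<Longrightarrow> (if b then p else q) \<in> free_alg X"
  by simp

lemma wlpa_rels_free_alg:
  assumes "weighted_graph E w"
  shows "wlpa_rels E w \<subseteq> free_alg (wlpa_gens E w)"
proof -
  interpret wf_digraph E using assms by (simp add: weighted_graph_def)
  show ?thesis
    unfolding wlpa_rels_def Let_def subset_eq ball_relations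
    by (intro conjI allI impI; (elim conjE)?; (intro free_alg_if free_alg_intros)?; auto simp: wlpa_gens_def)
qed

lemma lpa_rels_free_alg:
  assumes "wf_digraph F"
  shows "lpa_rels F \<subseteq> free_alg (lpa_gens F)"
proof -
  interpret wf_digraph F by fact
  show ?thesis
    unfolding lpa_rels_def Let_def subset_eq ball_relations
    by (intro conjI allI impI; (elim conjE)?; (intro free_alg_if free_alg_intros)?; auto simp: lpa_gens_def)
qed

section \<open>Cancellation in the free algebra\<close>

text \<open>The convolution runs over all factorizations of \<open>u + v\<close> within the
  supports, and the assumption leaves a single one.\<close>

lemma lookup_mult_finite:
  fixes a b :: "'x word \<Rightarrow>\<^sub>0 'k::field"
  assumes "\<And>u' v'. u' \<in> keys a \<Longrightarrow> v' \<in> keys b \<Longrightarrow> u' + v' = u + v \<Longrightarrow> u' = u \<and> v' = v"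
  shows "lookup (a * b) (u + v) = lookup a u * lookup b v"
proof -
  have "lookup a l * (\<Sum>q. lookup b q when u + v = l + q) =
      (lookup a u * lookup b v when l = u)" for l
  proof (cases "l \<in> keys a")
    case True
    have "(lookup b q when u + v = l + q) = ((lookup b v when l = u) when q = v)" for q
    proof (cases "q \<in> keys b \<and> u + v = l + q")
      case True
      then have "l = u" "q = v" using assms[OF \<open>l \<in> _\<close>, of q] by simp_all
      then show ?thesis by simp
    next
      case False
      then have "lookup b q = 0 \<or> u + v \<noteq> l + q" by (simp add: in_keys_iff)
      then show ?thesis by (cases "l = u"; cases "q = v") (auto simp: when_def)
    qed
    then show ?thesis by (cases "l = u") simp_all
  qed (auto simp: when_def in_keys_iff)
  then show ?thesis by (simp add: lookup_mult)
qed

text \<open>Take words of maximal length in both supports. Their concatenation factors in only one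
  way, since the length of the first factor is forced, so its coefficient is a product of two
  nonzero scalars.\<close>

lemma free_algebra_no_zero_divisors:
  fixes a b :: "'x word \<Rightarrow>\<^sub>0 'k::field"
  assumes "a * b = 0"
  shows "a = 0 \<or> b = 0"
proof (rule ccontr)
  assume "\<not> (a = 0 \<or> b = 0)"
  then have ne: "keys a \<noteq> {}" "keys b \<noteq> {}" by simp_all
  let ?l = "\<lambda>u :: 'x word. length (letters u)"
  have max: "\<exists>u\<in>S. \<forall>u'\<in>S. ?l u' \<le> ?l u" if "finite S" "S \<noteq> {}" for S
  proof -
    have "Max (?l ` S) \<in> ?l ` S" using that by (intro Max_in) auto
    then obtain u where "u \<in> S" "?l u = Max (?l ` S)" by auto
    moreover have "?l u' \<le> Max (?l ` S)" if "u' \<in> S" for u'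
      using \<open>finite S\<close> that by (intro Max_ge) auto
    ultimately show ?thesis by metis
  qed
  obtain u where u: "u \<in> keys a" "\<And>u'. u' \<in> keys a \<Longrightarrow> ?l u' \<le> ?l u"
    using max[OF finite_keys ne(1)] by blast
  obtain v where v: "v \<in> keys b" "\<And>v'. v' \<in> keys b \<Longrightarrow> ?l v' \<le> ?l v"
    using max[OF finite_keys ne(2)] by blast
  have "lookup (a * b) (u + v) = lookup a u * lookup b v"
  proof (rule lookup_mult_finite)
    fix u' v' assume *: "u' \<in> keys a" "v' \<in> keys b" "u' + v' = u + v"
    then have eq: "letters u' @ letters v' = letters u @ letters v" by (simp add: plus_word_def)
    then have "?l u' + ?l v' = ?l u + ?l v" by (metis length_append)
    then have "?l u' = ?l u" using u(2)[OF *(1)] v(2)[OF *(2)] by linarith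
    then show "u' = u \<and> v' = v" using eq by (simp add: word.expand)
  qed
  then show False using assms u(1) v(1) by (simp add: in_keys_iff)
qed

lemma keys_mono_mult: "keys (mon xs * a) \<subseteq> {Word (xs @ ys) | ys. True}"
proof
  fix u assume "u \<in> keys (mon xs * a)"
  then obtain v where "u = Word xs + v"
    using keys_mult[of "mon xs" a] by (auto split: if_splits)
  then show "u \<in> {Word (xs @ ys) | ys. True}" by (cases v) auto
qed

text \<open>Two different words of equal length are never prefixes of the same word, so the supports
  of the two sides are disjoint.\<close>

lemma mon_mult_neq:
  fixes a b :: "'x word \<Rightarrow>\<^sub>0 'k::field"
  assumes "length xs = length ys" "xs \<noteq> ys" "mon xs * a = mon ys * b"
  shows "mon xs * a = 0"
proof -
  have "keys (mon xs * a) \<subseteq> {Word (xs @ zs) | zs. True} \<inter> {Word (ys @ zs) | zs. True}"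
    using keys_mono_mult[of xs a] keys_mono_mult[of ys b] assms(3) by auto
  also have "\<dots> = {}" using assms(1,2) by auto
  finally show ?thesis by simp
qed

lemma mon_neq_zero: "mon xs \<noteq> 0"
  by (simp add: poly_mapping_eq_iff fun_eq_iff lookup_single when_def)

section \<open>Normal words\<close>

primrec lsource :: "('v, 'e) pre_digraph \<Rightarrow> ('v, 'e) wlpa_gen \<Rightarrow> 'v" where
  "lsource E (WVertex v) = v"
| "lsource E (WEdge e i) = tail E e"
| "lsource E (WGhost e i) = head E e"

primrec lrange :: "('v, 'e) pre_digraph \<Rightarrow> ('v, 'e) wlpa_gen \<Rightarrow> 'v" where
  "lrange E (WVertex v) = v"
| "lrange E (WEdge e i) = head E e"
| "lrange E (WGhost e i) = tail E e"

locale special_edges =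
  fixes E :: "('v, 'e) pre_digraph" and w :: "'e \<Rightarrow> nat" and \<alpha> :: "'v \<Rightarrow> 'e"
  assumes weighted_graph: "weighted_graph E w"
    and row_finite: "row_finite E"
    and special: "\<And>v. v \<in> verts E \<Longrightarrow> out_arcs E v \<noteq> {} \<Longrightarrow> \<alpha> v \<in> out_arcs E v \<and> w (\<alpha> v) = vertex_weight E w v"

sublocale special_edges \<subseteq> wf_digraph E
  using weighted_graph by (simp add: weighted_graph_def)

context special_edges
begin

abbreviation "src \<equiv> lsource E"
abbreviation "rng \<equiv> lrange E"

definition letter :: "('v, 'e) wlpa_gen \<Rightarrow> bool" where
  "letter x \<longleftrightarrow> (case x of WVertex v \<Rightarrow> False
     | WEdge e i \<Rightarrow> e \<in> arcs E \<and> 1 \<le> i \<and> i \<le> w e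
     | WGhost e i \<Rightarrow> e \<in> arcs E \<and> 1 \<le> i \<and> i \<le> w e)"

lemma letter_simps [simp]:
  "\<not> letter (WVertex v)"
  "letter (WEdge e i) \<longleftrightarrow> e \<in> arcs E \<and> 1 \<le> i \<and> i \<le> w e"
  "letter (WGhost e i) \<longleftrightarrow> e \<in> arcs E \<and> 1 \<le> i \<and> i \<le> w e"
  by (simp_all add: letter_def)

lemma finite_out_arcs: "v \<in> verts E \<Longrightarrow> finite (out_arcs E v)"
  using row_finite by (simp add: row_finite_def)

lemma arc_weight_pos: "e \<in> arcs E \<Longrightarrow> 1 \<le> w e"
  using weighted_graph by (simp add: weighted_graph_def)

lemma weight_le_vertex_weight: "v \<in> verts E \<Longrightarrow> e \<in> out_arcs E v \<Longrightarrow> w e \<le> vertex_weight E w v"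
  using finite_out_arcs[of v] by (auto simp: vertex_weight_def)

lemma special_tail: "e \<in> arcs E \<Longrightarrow> \<alpha> (tail E e) \<in> arcs E \<and> tail E (\<alpha> (tail E e)) = tail E e
    \<and> w (\<alpha> (tail E e)) = vertex_weight E w (tail E e)"
  using special[of "tail E e"] by (auto simp: out_arcs_def)

lemma letter_src: "letter x \<Longrightarrow> src x \<in> verts E"
  and letter_ran: "letter x \<Longrightarrow> rng x \<in> verts E"
  by (cases x; simp)+

text \<open>The left-hand sides of the rewriting rules. Relation (iv) is solved for the summand of
  the special edge, which occurs for all indices because its weight is maximal; relation (iii) is
  solved for the summand with index 1, which occurs because weights are positive.\<close>

definition forbidden :: "('v, 'e) wlpa_gen \<Rightarrow> ('v, 'e) wlpa_gen \<Rightarrow> bool" where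
  "forbidden x y \<longleftrightarrow> (\<exists>e i j. x = WEdge e i \<and> y = WGhost e j \<and> e = \<alpha> (tail E e)) \<or>
     (\<exists>e f. x = WGhost e 1 \<and> y = WEdge f 1 \<and> tail E e = tail E f)"

definition linked :: "('v, 'e) wlpa_gen \<Rightarrow> ('v, 'e) wlpa_gen \<Rightarrow> bool" where
  "linked x y \<longleftrightarrow> rng x = src y \<and> \<not> forbidden x y"

definition normal :: "('v, 'e) wlpa_gen list \<Rightarrow> bool" where
  "normal xs \<longleftrightarrow> (\<forall>x\<in>set xs. letter x) \<and> successively linked xs"

lemma normal_Nil [simp]: "normal []"
  by (simp add: normal_def)

lemma normal_single [simp]: "normal [x] \<longleftrightarrow> letter x"
  by (simp add: normal_def)

lemma normal_append: "normal (xs @ ys) \<longleftrightarrow> normal xs \<and> normal ys \<and> (xs = [] \<or> ys = [] \<or> linked (last xs) (hd ys))"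
  by (auto simp: normal_def successively_append_iff)

lemma normal_Cons: "normal (x # xs) \<longleftrightarrow> letter x \<and> normal xs \<and> (xs = [] \<or> linked x (hd xs))"
  using normal_append[of "[x]" xs] by simp

subsection \<open>A representation in which normal words are independent\<close>

text \<open>
  The right regular representation on normal words, in transposed form: it acts on functions of
  the pairs of a vertex and a normal word starting there. Words are stored with the last letter
  first, since that is where an action from the right takes place.
\<close>

definition wend :: "'v \<Rightarrow> ('v, 'e) wlpa_gen list \<Rightarrow> 'v" where
  "wend v r = (case r of [] \<Rightarrow> v | y # _ \<Rightarrow> rng y)"

definition valid :: "'v \<Rightarrow> ('v, 'e) wlpa_gen list \<Rightarrow> bool" where
  "valid v r \<longleftrightarrow> v \<in> verts E \<and> normal (rev r) \<and> (r = [] \<or> src (last r) = v)"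

lemma wend_simps [simp]: "wend v [] = v" "wend v (y # r) = rng y"
  by (simp_all add: wend_def)

lemma valid_Nil [simp]: "valid v [] \<longleftrightarrow> v \<in> verts E"
  by (simp add: valid_def)

lemma valid_Cons: "valid v (y # r) \<longleftrightarrow> valid v r \<and> letter y \<and> wend v r = src y \<and> (r = [] \<or> \<not> forbidden (hd r) y)"
  by (cases r) (auto simp: valid_def normal_append normal_Cons linked_def last_rev hd_rev letter_src)

text \<open>The value of \<open>g\<close> at the normal form of the word with \<open>x\<close>
  appended: a forbidden pair at the end is replaced by the other side of its rule. The new pairs are
  not forbidden and fit the rest of the word like the old one, so one step suffices. Since functions
  are acted on, \<open>x y\<close> acts as \<open>act x\<close> after \<open>act y\<close>, and no
  supports have to be finite. Composability is tested in \<open>act\<close>.\<close>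

fun act0 :: "('v, 'e) wlpa_gen \<Rightarrow> ('v \<times> ('v, 'e) wlpa_gen list \<Rightarrow> 'k::field) \<Rightarrow> 'v \<Rightarrow> ('v, 'e) wlpa_gen list \<Rightarrow> 'k" where
  "act0 (WEdge f i) g v (WGhost e j # r) =
     (if i = 1 \<and> j = 1
      then (if e = f then g (v, r) else 0) - (\<Sum>k = 2..min (w e) (w f). g (v, WEdge f k # WGhost e k # r))
      else g (v, WEdge f i # WGhost e j # r))"
| "act0 (WGhost f j) g v (WEdge e i # r) =
     (if e = f \<and> e = \<alpha> (tail E e)
      then (if i = j then g (v, r) else 0) -
        (\<Sum>h \<in> {h \<in> out_arcs E (tail E e). h \<noteq> e \<and> i \<le> w h \<and> j \<le> w h}. g (v, WGhost h j # WEdge h i # r))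
      else g (v, WGhost f j # WEdge e i # r))"
| "act0 (WVertex u) g v r = g (v, r)"
| "act0 x g v r = g (v, x # r)"

definition act :: "('v, 'e) wlpa_gen \<Rightarrow> ('v \<times> ('v, 'e) wlpa_gen list \<Rightarrow> 'k::field) \<Rightarrow> 'v \<times> ('v, 'e) wlpa_gen list \<Rightarrow> 'k" where
  "act x g = (\<lambda>(v, r). if valid v r \<and> wend v r = src x then act0 x g v r else 0)"

lemma act_add: "act x (g + h) = act x g + act x h"
proof
  fix p
  show "act x (g + h) p = (act x g + act x h) p"
    by (cases "(x, g, fst p, snd p)" rule: act0.cases; cases p)
      (auto simp: act_def sum.distrib)
qed

lemma act_scale: "act x (\<lambda>p. k * g p) = (\<lambda>p. k * act x g p)"
proof
  fix p
  show "act x (\<lambda>p. k * g p) p = k * act x g p"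
    by (cases "(x, g, fst p, snd p)" rule: act0.cases; cases p)
      (auto simp: act_def sum_distrib_left right_diff_distrib)
qed

lemma act0_append: "letter x \<Longrightarrow> r = [] \<or> \<not> forbidden (hd r) x \<Longrightarrow> wend v r = src x \<Longrightarrow> act0 x g v r = g (v, x # r)"
  by (cases "(x, g, v, r)" rule: act0.cases) (auto simp: forbidden_def)

lemma act_append: "valid v (x # r) \<Longrightarrow> act x g (v, r) = g (v, x # r)"
  by (auto simp: act_def valid_Cons act0_append)

text \<open>The summand with index 1 is rewritten to the right-hand side minus all the other
  summands, which then cancel.\<close>

lemma act_gh_ed_free:
  assumes "valid v r" "h \<in> arcs E" "f \<in> arcs E" "tail E h = tail E f" "wend v r = head E h"
    and nf: "\<And>i. r = [] \<or> \<not> forbidden (hd r) (WGhost h i)"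
  shows "(\<Sum>i = 1..min (w h) (w f). act (WEdge f i) g (v, WGhost h i # r)) = (if h = f then g (v, r) else 0)"
proof -
  have val: "valid v (WGhost h i # r)" if "1 \<le> i" "i \<le> w h" for i
    using assms that by (auto simp: valid_Cons)
  have pos: "1 \<le> min (w h) (w f)" using assms(2,3) arc_weight_pos by simp
  then have "{1..min (w h) (w f)} = insert 1 {2..min (w h) (w f)}" by auto
  then have "(\<Sum>i = 1..min (w h) (w f). act (WEdge f i) g (v, WGhost h i # r)) =
      act (WEdge f 1) g (v, WGhost h 1 # r) + (\<Sum>i = 2..min (w h) (w f). act (WEdge f i) g (v, WGhost h i # r))"
    by simp
  also have "(\<Sum>i = 2..min (w h) (w f). act (WEdge f i) g (v, WGhost h i # r)) =
      (\<Sum>i = 2..min (w h) (w f). g (v, WEdge f i # WGhost h i # r))"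
    using assms val by (intro sum.cong refl) (auto simp: act_def)
  also have "act (WEdge f 1) g (v, WGhost h 1 # r) =
      (if h = f then g (v, r) else 0) - (\<Sum>i = 2..min (w h) (w f). g (v, WEdge f i # WGhost h i # r))"
    using assms val[of 1] pos by (auto simp: act_def)
  finally show ?thesis by simp
qed

text \<open>The same cancellation; here the rewritten summand is that of the special edge.\<close>

lemma act_ed_gh_free:
  assumes "valid v r" "u \<in> verts E" "wend v r = u" "1 \<le> i" "i \<le> vertex_weight E w u" "1 \<le> j" "j \<le> vertex_weight E w u"
    and nf: "\<And>e. tail E e = u \<Longrightarrow> r = [] \<or> \<not> forbidden (hd r) (WEdge e i)"
  shows "(\<Sum>e \<in> {e \<in> out_arcs E u. i \<le> w e \<and> j \<le> w e}. act (WGhost e j) g (v, WEdge e i # r)) = (if i = j then g (v, r) else 0)"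
proof -
  let ?S = "{e \<in> out_arcs E u. i \<le> w e \<and> j \<le> w e}"
  let ?a = "\<alpha> u"
  have "out_arcs E u \<noteq> {}" using assms(4,5) by (auto simp: vertex_weight_def)
  then have a: "?a \<in> out_arcs E u" "w ?a = vertex_weight E w u" using special assms(2) by auto
  have val: "valid v (WEdge e i # r)" if "e \<in> ?S" for e
    using assms that by (auto simp: valid_Cons)
  have S: "?S = insert ?a {e \<in> out_arcs E u. e \<noteq> ?a \<and> i \<le> w e \<and> j \<le> w e}" (is "_ = insert _ ?T")
    using a assms by auto
  have fin: "finite ?T" by (rule finite_subset[OF _ finite_out_arcs[OF assms(2)]]) auto
  have "(\<Sum>e \<in> ?S. act (WGhost e j) g (v, WEdge e i # r)) =
      act (WGhost ?a j) g (v, WEdge ?a i # r) + (\<Sum>e \<in> ?T. act (WGhost e j) g (v, WEdge e i # r))"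
    unfolding S by (subst sum.insert) (use fin in auto)
  also have "(\<Sum>e \<in> ?T. act (WGhost e j) g (v, WEdge e i # r)) = (\<Sum>e \<in> ?T. g (v, WGhost e j # WEdge e i # r))"
  proof (intro sum.cong refl)
    fix e assume e: "e \<in> ?T"
    then have "valid v (WEdge e i # r)" by (intro val) auto
    then show "act (WGhost e j) g (v, WEdge e i # r) = g (v, WGhost e j # WEdge e i # r)"
      using e by (auto simp: act_def)
  qed
  also have "act (WGhost ?a j) g (v, WEdge ?a i # r) =
      (if i = j then g (v, r) else 0) - (\<Sum>e \<in> ?T. g (v, WGhost e j # WEdge e i # r))"
    using val[of ?a] a assms by (auto simp: act_def)
  finally show ?thesis by simp
qed

lemma act_gh_ed:
  assumes u: "u \<in> verts E" "e \<in> out_arcs E u" "f \<in> out_arcs E u"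
  shows "(\<Sum>i \<in> {i \<in> {1..vertex_weight E w u}. i \<le> w e \<and> i \<le> w f}. act (WGhost e i) (act (WEdge f i) g) (v, r)) =
    (if e = f then act (WVertex (head E e)) g (v, r) else 0)"
proof (cases "valid v r \<and> wend v r = head E e")
  case False
  then show ?thesis by (auto simp: act_def)
next
  case True
  have ef: "e \<in> arcs E" "f \<in> arcs E" "tail E e = u" "tail E f = u" using u by auto
  have S: "{i \<in> {1..vertex_weight E w u}. i \<le> w e \<and> i \<le> w f} = {1..min (w e) (w f)}"
    using weight_le_vertex_weight[OF u(1,2)] by auto
  show ?thesis unfolding S
  proof (cases "\<exists>i. r \<noteq> [] \<and> forbidden (hd r) (WGhost e i)")
    case nf: False
    then have "act (WGhost e i) (act (WEdge f i) g) (v, r) = act (WEdge f i) g (v, WGhost e i # r)"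
      if "i \<in> {1..min (w e) (w f)}" for i
      using True ef that by (intro act_append) (auto simp: valid_Cons)
    moreover have "(\<Sum>i = 1..min (w e) (w f). act (WEdge f i) g (v, WGhost e i # r)) = (if e = f then g (v, r) else 0)"
      using nf True ef by (intro act_gh_ed_free) auto
    ultimately show "(\<Sum>i = 1..min (w e) (w f). act (WGhost e i) (act (WEdge f i) g) (v, r)) =
        (if e = f then act (WVertex (head E e)) g (v, r) else 0)"
      using True by (simp add: act_def)
  next
    \<comment> \<open>The ambiguous overlap \<open>\<alpha>_j \<alpha>_i^* f_i\<close>, in which the
      first pair is rewritten by relation (iv). Exchanging the sums leaves words ending in
      \<open>h_j\<close> with \<open>h\<close> different from \<open>\<alpha>\<close>, where
      \<open>act_gh_ed_free\<close> applies.\<close>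
    case fb: True
    then obtain j r' where r: "r = WEdge e j # r'" and e\<alpha>: "e = \<alpha> u"
      using ef by (cases r) (auto simp: forbidden_def)
    have val: "valid v (WEdge e j # r')" using True r by simp
    have we: "w e = vertex_weight E w u" using special_tail[of e] ef e\<alpha> by simp
    have min: "min (w e) (w f) = w f" using weight_le_vertex_weight[OF u(1,3)] we by simp
    let ?T = "\<lambda>i. {h \<in> out_arcs E u. h \<noteq> e \<and> j \<le> w h \<and> i \<le> w h}"
    let ?U = "{h \<in> out_arcs E u. h \<noteq> e \<and> j \<le> w h}"
    have finU: "finite ?U" by (rule finite_subset[OF _ finite_out_arcs[OF u(1)]]) auto
    have val': "valid v (WEdge h j # r')" if "h \<in> out_arcs E u" "j \<le> w h" for h
      using val that ef by (auto simp: valid_Cons forbidden_def)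
    have "(\<Sum>i = 1..w f. act (WGhost e i) (act (WEdge f i) g) (v, r)) =
        (\<Sum>i = 1..w f. (if j = i then act (WEdge f i) g (v, r') else 0) -
          (\<Sum>h \<in> ?T i. act (WEdge f i) g (v, WGhost h i # WEdge h j # r')))"
      using val e\<alpha> ef unfolding r by (intro sum.cong refl) (simp add: act_def)
    also have "\<dots> = (\<Sum>i = 1..w f. (if j = i then act (WEdge f i) g (v, r') else 0)) -
          (\<Sum>i = 1..w f. \<Sum>h \<in> ?T i. act (WEdge f i) g (v, WGhost h i # WEdge h j # r'))"
      by (rule sum_subtractf)
    also have "(\<Sum>i = 1..w f. (if j = i then act (WEdge f i) g (v, r') else 0)) = (if j \<le> w f then g (v, WEdge f j # r') else 0)"
    proof -
      have "1 \<le> j" using val by (simp add: valid_Cons)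
      then have "(\<Sum>i = 1..w f. (if j = i then act (WEdge f i) g (v, r') else 0)) = (if j \<le> w f then act (WEdge f j) g (v, r') else 0)"
        by (simp add: sum.delta)
      then show ?thesis using act_append[OF val'[OF u(3)]] by auto
    qed
    also have "(\<Sum>i = 1..w f. \<Sum>h \<in> ?T i. act (WEdge f i) g (v, WGhost h i # WEdge h j # r')) =
       (\<Sum>h \<in> ?U. \<Sum>i = 1..min (w h) (w f). act (WEdge f i) g (v, WGhost h i # WEdge h j # r'))"
    proof -
      have "(\<Sum>i = 1..w f. \<Sum>h \<in> ?T i. act (WEdge f i) g (v, WGhost h i # WEdge h j # r')) =
         (\<Sum>i = 1..w f. \<Sum>h \<in> {h \<in> ?U. i \<le> w h}. act (WEdge f i) g (v, WGhost h i # WEdge h j # r'))"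
        by (intro sum.cong refl) auto
      also have "\<dots> = (\<Sum>h \<in> ?U. \<Sum>i \<in> {i \<in> {1..w f}. i \<le> w h}. act (WEdge f i) g (v, WGhost h i # WEdge h j # r'))"
        using finU by (intro sum.swap_restrict) auto
      also have "\<dots> = (\<Sum>h \<in> ?U. \<Sum>i = 1..min (w h) (w f). act (WEdge f i) g (v, WGhost h i # WEdge h j # r'))"
        by (intro sum.cong refl) auto
      finally show ?thesis .
    qed
    also have "\<dots> = (\<Sum>h \<in> ?U. if h = f then g (v, WEdge h j # r') else 0)"
    proof (intro sum.cong refl)
      fix h assume h: "h \<in> ?U"
      then have "valid v (WEdge h j # r')" by (intro val') auto
      then show "(\<Sum>i = 1..min (w h) (w f). act (WEdge f i) g (v, WGhost h i # WEdge h j # r')) =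
          (if h = f then g (v, WEdge h j # r') else 0)"
        using h ef e\<alpha> by (intro act_gh_ed_free) (auto simp: forbidden_def)
    qed
    also have "\<dots> = (if f \<noteq> e \<and> j \<le> w f then g (v, WEdge f j # r') else 0)"
      using finU u(3) by (simp add: sum.delta)
    finally have "(\<Sum>i = 1..w f. act (WGhost e i) (act (WEdge f i) g) (v, r)) = (if e = f then g (v, r) else 0)"
      using val r by (auto simp: valid_Cons)
    then show "(\<Sum>i = 1..min (w e) (w f). act (WGhost e i) (act (WEdge f i) g) (v, r)) =
        (if e = f then act (WVertex (head E e)) g (v, r) else 0)"
      using True by (simp add: act_def min)
  qed
qed

lemma act_ed_gh:
  assumes u: "u \<in> verts E" "i \<in> {1..vertex_weight E w u}" "j \<in> {1..vertex_weight E w u}"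
  shows "(\<Sum>e \<in> {e \<in> out_arcs E u. i \<le> w e \<and> j \<le> w e}. act (WEdge e i) (act (WGhost e j) g) (v, r)) =
    (if i = j then act (WVertex u) g (v, r) else 0)"
proof (cases "valid v r \<and> wend v r = u")
  case False
  then have "act (WEdge e i) (act (WGhost e j) g) (v, r) = 0" if "e \<in> out_arcs E u" for e
    using that by (auto simp: act_def)
  then show ?thesis using False by (auto simp: act_def)
next
  case True
  let ?S = "{e \<in> out_arcs E u. i \<le> w e \<and> j \<le> w e}"
  show ?thesis
  proof (cases "\<exists>e. tail E e = u \<and> r \<noteq> [] \<and> forbidden (hd r) (WEdge e i)")
    case nf: False
    then have "act (WEdge e i) (act (WGhost e j) g) (v, r) = act (WGhost e j) g (v, WEdge e i # r)"
      if "e \<in> ?S" for e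
      using True u that by (intro act_append) (auto simp: valid_Cons)
    moreover have "(\<Sum>e \<in> ?S. act (WGhost e j) g (v, WEdge e i # r)) = (if i = j then g (v, r) else 0)"
      using nf True u by (intro act_ed_gh_free) auto
    ultimately show ?thesis using True by (simp add: act_def)
  next
    \<comment> \<open>The opposite overlap \<open>h_1^* e_1 e_j^*\<close>, in which the first pair
      is rewritten by relation (iii). After the exchange of sums, \<open>act_ed_gh_free\<close>
      applies to the words ending in \<open>h_k^*\<close> with \<open>k \<ge> 2\<close>.\<close>
    case fb: True
    then obtain h r' where r: "r = WGhost h 1 # r'" and i: "i = 1" and th: "tail E h = u"
      by (cases r) (auto simp: forbidden_def)
    have val: "valid v (WGhost h 1 # r')" using True r by simp
    then have h: "h \<in> out_arcs E u" using th by (auto simp: valid_Cons)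
    have val': "valid v (WGhost h k # r')" if "1 \<le> k" "k \<le> w h" for k
      using val that h by (auto simp: valid_Cons forbidden_def)
    let ?U = "\<lambda>e k. act (WGhost e j) g (v, WEdge e k # WGhost h k # r')"
    have fin: "finite ?S" by (rule finite_subset[OF _ finite_out_arcs[OF u(1)]]) auto
    have "(\<Sum>e \<in> ?S. act (WEdge e i) (act (WGhost e j) g) (v, r)) =
      (\<Sum>e \<in> ?S. (if h = e then act (WGhost e j) g (v, r') else 0) - (\<Sum>k = 2..min (w h) (w e). ?U e k))"
      using True th h unfolding r i by (intro sum.cong refl) (simp add: act_def)
    also have "\<dots> = (\<Sum>e \<in> ?S. if h = e then act (WGhost e j) g (v, r') else 0) - (\<Sum>e \<in> ?S. \<Sum>k = 2..min (w h) (w e). ?U e k)"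
      by (rule sum_subtractf)
    also have "(\<Sum>e \<in> ?S. if h = e then act (WGhost e j) g (v, r') else 0) = (if j \<le> w h then g (v, WGhost h j # r') else 0)"
    proof -
      have "1 \<le> w h" using h arc_weight_pos by auto
      then have "(\<Sum>e \<in> ?S. if h = e then act (WGhost e j) g (v, r') else 0) = (if j \<le> w h then act (WGhost h j) g (v, r') else 0)"
        using fin h i by (simp add: sum.delta)
      then show ?thesis using act_append[OF val'[of j]] u(3) by auto
    qed
    also have "(\<Sum>e \<in> ?S. \<Sum>k = 2..min (w h) (w e). ?U e k) = (\<Sum>k = 2..w h. \<Sum>e \<in> {e \<in> out_arcs E u. k \<le> w e \<and> j \<le> w e}. ?U e k)"
    proof -
      have "(\<Sum>e \<in> ?S. \<Sum>k = 2..min (w h) (w e). ?U e k) = (\<Sum>e \<in> ?S. \<Sum>k \<in> {k \<in> {2..w h}. k \<le> w e}. ?U e k)"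
        by (intro sum.cong refl) auto
      also have "\<dots> = (\<Sum>k \<in> {2..w h}. \<Sum>e \<in> {e \<in> ?S. k \<le> w e}. ?U e k)"
        using fin by (intro sum.swap_restrict) auto
      also have "\<dots> = (\<Sum>k = 2..w h. \<Sum>e \<in> {e \<in> out_arcs E u. k \<le> w e \<and> j \<le> w e}. ?U e k)"
        using arc_weight_pos i by (intro sum.cong refl) auto
      finally show ?thesis .
    qed
    also have "\<dots> = (\<Sum>k = 2..w h. if k = j then g (v, WGhost h k # r') else 0)"
    proof (intro sum.cong refl)
      fix k assume k: "k \<in> {2..w h}"
      then show "(\<Sum>e \<in> {e \<in> out_arcs E u. k \<le> w e \<and> j \<le> w e}. ?U e k) = (if k = j then g (v, WGhost h k # r') else 0)"
        using u val'[of k] th h weight_le_vertex_weight[OF u(1) h]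
        by (intro act_ed_gh_free) (auto simp: forbidden_def)
    qed
    also have "\<dots> = (if 2 \<le> j \<and> j \<le> w h then g (v, WGhost h j # r') else 0)"
      by (simp add: sum.delta)
    finally have "(\<Sum>e \<in> ?S. act (WEdge e i) (act (WGhost e j) g) (v, r)) = (if i = j then g (v, r) else 0)"
      using u h arc_weight_pos[of h] by (auto simp: r i)
    then show ?thesis using True by (simp add: act_def)
  qed
qed

lemma forbidden_simps:
  "forbidden y (WGhost e i) \<longleftrightarrow> (\<exists>k. y = WEdge e k) \<and> e = \<alpha> (tail E e)"
  "forbidden y (WEdge f i) \<longleftrightarrow> i = 1 \<and> (\<exists>e. y = WGhost e 1 \<and> tail E e = tail E f)"
  by (auto simp: forbidden_def)

text \<open>All words at which \<open>act0 x\<close> reads \<open>g\<close> are valid and end at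
  \<open>rng x\<close>. Cutting \<open>g\<close> down to these words, as the vertex
  \<open>rng x\<close> does, therefore changes nothing.\<close>

lemma act0_cong:
  assumes "letter x" "valid v r" "wend v r = src x"
    and g: "\<And>r'. valid v r' \<Longrightarrow> wend v r' = rng x \<Longrightarrow> g (v, r') = g' (v, r')"
  shows "act0 x g v r = act0 x g' v r"
  using assms
proof (cases "(x, g, v, r)" rule: act0.cases)
  case (1 f i g v e j r)
  then show ?thesis using assms
    by (auto simp: valid_Cons forbidden_simps intro!: arg_cong2[where f = minus] sum.cong)
next
  case (2 f j g v e i r)
  then show ?thesis using assms
    by (auto simp: valid_Cons forbidden_simps intro!: arg_cong2[where f = minus] sum.cong)
qed (auto simp: valid_Cons forbidden_def)

definition act_op :: "('v, 'e) wlpa_gen \<Rightarrow> ('v \<times> ('v, 'e) wlpa_gen list \<Rightarrow> 'k::field) endo" where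
  "act_op x = Endo (act x)"

lemma app_act_op [simp]: "app (act_op x) = act x"
  unfolding act_op_def by (rule Endo_inverse) (simp add: act_add)

lemma act_zero [simp]: "act x 0 = 0"
  using app_zero[of "act_op x"] by simp

lemma act_family:
  "wlpa_family E w (\<lambda>v. act_op (WVertex v) :: ('v \<times> ('v, 'e) wlpa_gen list \<Rightarrow> 'k::field) endo)
     (\<lambda>e i. if i \<le> w e then act_op (WEdge e i) else 0)
     (\<lambda>e i. if i \<le> w e then act_op (WGhost e i) else 0)"
proof
  fix e i assume e: "e \<in> arcs E" "1 \<le> i" "i \<le> w e"
  show "act_op (WVertex (tail E e)) * (if i \<le> w e then act_op (WEdge e i) else 0) =
      (if i \<le> w e then act_op (WEdge e i) else 0 :: ('v \<times> ('v, 'e) wlpa_gen list \<Rightarrow> 'k) endo)"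
    using e by (auto intro!: endo_eqI ext simp: act_def)
  show "act_op (WVertex (head E e)) * (if i \<le> w e then act_op (WGhost e i) else 0) =
      (if i \<le> w e then act_op (WGhost e i) else 0 :: ('v \<times> ('v, 'e) wlpa_gen list \<Rightarrow> 'k) endo)"
    using e by (auto intro!: endo_eqI ext simp: act_def)
  show "(if i \<le> w e then act_op (WEdge e i) else 0) * act_op (WVertex (head E e)) =
      (if i \<le> w e then act_op (WEdge e i) else 0 :: ('v \<times> ('v, 'e) wlpa_gen list \<Rightarrow> 'k) endo)"
    using e by (auto intro!: endo_eqI ext act0_cong simp: act_def[of "WEdge e i"]) (simp add: act_def)
  show "(if i \<le> w e then act_op (WGhost e i) else 0) * act_op (WVertex (tail E e)) =
      (if i \<le> w e then act_op (WGhost e i) else 0 :: ('v \<times> ('v, 'e) wlpa_gen list \<Rightarrow> 'k) endo)"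
    using e by (auto intro!: endo_eqI ext act0_cong simp: act_def[of "WGhost e i"]) (simp add: act_def)
next
  fix u v assume "u \<in> verts E" "v \<in> verts E"
  show "act_op (WVertex u) * act_op (WVertex v) = (if u = v then act_op (WVertex u) else 0 :: ('v \<times> ('v, 'e) wlpa_gen list \<Rightarrow> 'k) endo)"
    by (auto intro!: endo_eqI ext simp: act_def)
next
  fix v e f assume v: "v \<in> verts E" "e \<in> out_arcs E v" "f \<in> out_arcs E v"
  show "(\<Sum>i = 1..vertex_weight E w v. (if i \<le> w e then act_op (WGhost e i) else 0) * (if i \<le> w f then act_op (WEdge f i) else 0)) =
      (if e = f then act_op (WVertex (head E e)) else 0 :: ('v \<times> ('v, 'e) wlpa_gen list \<Rightarrow> 'k) endo)"
  proof (rule endo_eqI, rule ext)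
    fix g :: "'v \<times> ('v, 'e) wlpa_gen list \<Rightarrow> 'k" and p :: "'v \<times> ('v, 'e) wlpa_gen list"
    obtain x r where p: "p = (x, r)" by (cases p)
    have "app (\<Sum>i = 1..vertex_weight E w v. (if i \<le> w e then act_op (WGhost e i) else 0) * (if i \<le> w f then act_op (WEdge f i) else 0)) g p
        = (\<Sum>i = 1..vertex_weight E w v. if i \<le> w e \<and> i \<le> w f then act (WGhost e i) (act (WEdge f i) g) p else 0)"
      by (simp only: app_sum fun_sum_apply) (intro sum.cong refl, auto)
    also have "\<dots> = (\<Sum>i \<in> {i \<in> {1..vertex_weight E w v}. i \<le> w e \<and> i \<le> w f}. act (WGhost e i) (act (WEdge f i) g) p)"
      by (rule sum.inter_filter[symmetric]) simp
    also have "\<dots> = (if e = f then act (WVertex (head E e)) g p else 0)"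
      unfolding p by (rule act_gh_ed[OF v])
    finally show "app (\<Sum>i = 1..vertex_weight E w v. (if i \<le> w e then act_op (WGhost e i) else 0) * (if i \<le> w f then act_op (WEdge f i) else 0)) g p
        = app (if e = f then act_op (WVertex (head E e)) else 0) g p" by simp
  qed
next
  fix v i j assume v: "v \<in> verts E" "i \<in> {1..vertex_weight E w v}" "j \<in> {1..vertex_weight E w v}"
  show "(\<Sum>e\<in>out_arcs E v. (if i \<le> w e then act_op (WEdge e i) else 0) * (if j \<le> w e then act_op (WGhost e j) else 0)) =
      (if i = j then act_op (WVertex v) else 0 :: ('v \<times> ('v, 'e) wlpa_gen list \<Rightarrow> 'k) endo)"
  proof (rule endo_eqI, rule ext)
    fix g :: "'v \<times> ('v, 'e) wlpa_gen list \<Rightarrow> 'k" and p :: "'v \<times> ('v, 'e) wlpa_gen list"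
    obtain x r where p: "p = (x, r)" by (cases p)
    have "app (\<Sum>e\<in>out_arcs E v. (if i \<le> w e then act_op (WEdge e i) else 0) * (if j \<le> w e then act_op (WGhost e j) else 0)) g p
        = (\<Sum>e\<in>out_arcs E v. if i \<le> w e \<and> j \<le> w e then act (WEdge e i) (act (WGhost e j) g) p else 0)"
      by (simp only: app_sum fun_sum_apply) (intro sum.cong refl, auto)
    also have "\<dots> = (\<Sum>e \<in> {e \<in> out_arcs E v. i \<le> w e \<and> j \<le> w e}. act (WEdge e i) (act (WGhost e j) g) p)"
      by (rule sum.inter_filter[symmetric]) (rule finite_out_arcs[OF v(1)])
    also have "\<dots> = (if i = j then act (WVertex v) g p else 0)"
      unfolding p by (rule act_ed_gh[OF v])
    finally show "app (\<Sum>e\<in>out_arcs E v. (if i \<le> w e then act_op (WEdge e i) else 0) * (if j \<le> w e then act_op (WGhost e j) else 0)) g p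
        = app (if i = j then act_op (WVertex v) else 0) g p" by simp
  qed
qed auto

lemma valid_suffix: "valid v (ys @ r) \<Longrightarrow> valid v r"
  by (induction ys) (auto simp: valid_Cons)

lemma app_act_prod:
  "valid v (rev xs @ r) \<Longrightarrow> app (prod_list (map act_op xs)) g (v, r) = g (v, rev xs @ r)"
proof (induction xs arbitrary: r)
  case (Cons x xs)
  then have "valid v (x # r)" using valid_suffix[of v "rev xs" "x # r"] by simp
  with Cons show ?case by (simp add: act_append)
qed simp

abbreviation normal_words :: "('v, 'e) wlpa_gen word set" where
  "normal_words \<equiv> {Word xs | xs. xs \<noteq> [] \<and> normal xs}"

text \<open>Let \<open>n\<close> act on the indicator function of one normal word and evaluate at
  the empty word. Appending a normal word letter by letter involves no rewriting, so the value is
  the coefficient of the chosen word.\<close>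

lemma normal_words_independent:
  assumes "n \<in> ideal_of (wlpa_rels E w)" and keys: "keys n \<subseteq> normal_words"
  shows "n = (0 :: ('v, 'e) wlpa_gen word \<Rightarrow>\<^sub>0 'k::field)"
proof (rule ccontr)
  define c where "c k = Endo (\<lambda>(g :: 'v \<times> ('v, 'e) wlpa_gen list \<Rightarrow> 'k) p. k * g p)" for k
  have app_c: "app (c k) (g :: 'v \<times> ('v, 'e) wlpa_gen list \<Rightarrow> 'k) = (\<lambda>p. k * g p)" for k g
    unfolding c_def by (subst Endo_inverse) (auto simp: distrib_left)
  interpret free_eval c "act_op :: _ \<Rightarrow> ('v \<times> ('v, 'e) wlpa_gen list \<Rightarrow> 'k) endo"
    by unfold_locales (auto intro!: endo_eqI simp: app_c act_scale distrib_right mult.assoc)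
  have hom: "nonunital_ring_hom ev"
    by unfold_locales (simp_all add: ev_add ev_mult)
  have "wlpa_family E w (\<lambda>v. ev (gen (WVertex v)))
      (\<lambda>e i. if i \<le> w e then ev (gen (WEdge e i)) else 0)
      (\<lambda>e i. if i \<le> w e then ev (gen (WGhost e i)) else 0)"
    unfolding ev_gen by (rule act_family)
  then have "\<forall>r \<in> wlpa_rels E w. ev r = 0" using wlpa_family_iff[OF hom] by blast
  then have ev0: "ev n = 0" using ev_ideal[OF assms(1)] by blast
  assume "n \<noteq> 0"
  then obtain u where u: "u \<in> keys n" by (metis all_not_in_conv keys_eq_empty)
  then obtain xs where xs: "u = Word xs" "xs \<noteq> []" "normal xs" using keys by blast
  define v where "v = src (hd xs)"
  define g where "g p = (if p = (v, rev xs) then 1 else 0 :: 'k)" for p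
  have *: "app (prod_list (map act_op (letters u'))) g (v, []) = (if u' = u then 1 else 0)"
    if "u' \<in> keys n" for u'
  proof -
    obtain ys where ys: "u' = Word ys" "ys \<noteq> []" "normal ys" using keys \<open>u' \<in> _\<close> by blast
    then have l: "letter (hd ys)" by (cases ys) (simp_all add: normal_def)
    show ?thesis
    proof (cases "src (hd ys) = v")
      case True
      then have "valid v (rev ys @ [])"
        using ys l letter_src[of "hd ys"] by (auto simp: valid_def last_rev)
      from app_act_prod[OF this, of g] have "app (prod_list (map act_op ys)) g (v, []) = g (v, rev ys)" by simp
      then show ?thesis by (simp add: g_def ys(1) xs(1))
    next
      case False
      then have "app (prod_list (map act_op ys)) g (v, []) = 0"
        using ys(2) by (cases ys) (auto simp: act_def)
      then show ?thesis using False ys xs by (auto simp: v_def)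
    qed
  qed
  have "app (ev n) g (v, []) = (\<Sum>u' \<in> keys n. lookup n u' * (if u' = u then 1 else 0))"
    unfolding ev_def by (simp add: app_sum fun_sum_apply app_c *)
  also have "\<dots> = lookup n u"
    using u by (simp add: if_distrib[where f = "(*) _"] sum.delta cong: if_cong)
  finally show False using ev0 u by (simp add: in_keys_iff)
qed

end

locale special_edges_quotient = special_edges E w \<alpha> + nonunital_ring_hom \<rho>
  for E :: "('v, 'e) pre_digraph" and w \<alpha>
    and \<rho> :: "(('v, 'e) wlpa_gen word \<Rightarrow>\<^sub>0 'k::field) \<Rightarrow> 'r::ring" +
  assumes kernel: "\<rho> a = 0 \<longleftrightarrow> a \<in> ideal_of (wlpa_rels E w)"
begin

sublocale fam: wlpa_family E w "\<lambda>v. \<rho> (gen (WVertex v))"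
  "\<lambda>e i. if i \<le> w e then \<rho> (gen (WEdge e i)) else 0"
  "\<lambda>e i. if i \<le> w e then \<rho> (gen (WGhost e i)) else 0"
  using wlpa_family_iff[OF nonunital_ring_hom_axioms, of E w] by (simp add: kernel gen_ideal.rel)

abbreviation "X \<equiv> wlpa_gens E w"

lemma X_iff: "x \<in> X \<longleftrightarrow> letter x \<or> (\<exists>v\<in>verts E. x = WVertex v)"
  by (cases x) (auto simp: wlpa_gens_def)

lemma normal_subset_X: "normal xs \<Longrightarrow> set xs \<subseteq> X"
  by (auto simp: normal_def X_iff)

lemma src_gen: "x \<in> X \<Longrightarrow> \<rho> (gen (WVertex (src x))) * \<rho> (gen x) = \<rho> (gen x)"
  using fam.vx_ed fam.vx_gh fam.vx_vx by (cases x) (fastforce simp: X_iff)+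

lemma gen_rng: "x \<in> X \<Longrightarrow> \<rho> (gen x) * \<rho> (gen (WVertex (rng x))) = \<rho> (gen x)"
  using fam.ed_vx fam.gh_vx fam.vx_vx by (cases x) (fastforce simp: X_iff)+

lemma src_verts: "x \<in> X \<Longrightarrow> src x \<in> verts E" and rng_verts: "x \<in> X \<Longrightarrow> rng x \<in> verts E"
  by (auto simp: X_iff letter_src letter_ran)

lemma gen_gen_zero:
  assumes "x \<in> X" "y \<in> X" "rng x \<noteq> src y"
  shows "\<rho> (gen x) * \<rho> (gen y) = 0"
proof -
  have "\<rho> (gen x) * \<rho> (gen y) = \<rho> (gen x) * (\<rho> (gen (WVertex (rng x))) * \<rho> (gen (WVertex (src y)))) * \<rho> (gen y)"
    using gen_rng[OF assms(1)] src_gen[OF assms(2)] by (metis mult.assoc)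
  also have "\<dots> = 0" using assms by (simp add: fam.vx_vx src_verts rng_verts)
  finally show ?thesis .
qed

lemma ghost_edge_1:
  assumes "e \<in> arcs E" "f \<in> arcs E" "tail E e = tail E f"
  shows "\<rho> (gen (WGhost e 1)) * \<rho> (gen (WEdge f 1)) =
    \<rho> ((if e = f then gen (WVertex (head E e)) else 0) - (\<Sum>k = 2..min (w e) (w f). gen (WGhost e k) * gen (WEdge f k)))"
proof -
  let ?u = "tail E e"
  have "(\<Sum>i = 1..vertex_weight E w ?u. (if i \<le> w e then \<rho> (gen (WGhost e i)) else 0) * (if i \<le> w f then \<rho> (gen (WEdge f i)) else 0)) =
     (\<Sum>i = 1..vertex_weight E w ?u. if i \<le> w e \<and> i \<le> w f then \<rho> (gen (WGhost e i)) * \<rho> (gen (WEdge f i)) else 0)"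
    by (intro sum.cong) auto
  also have "\<dots> = (\<Sum>i \<in> {i \<in> {1..vertex_weight E w ?u}. i \<le> w e \<and> i \<le> w f}. \<rho> (gen (WGhost e i)) * \<rho> (gen (WEdge f i)))"
    by (rule sum.inter_filter[symmetric]) simp
  also have "{i \<in> {1..vertex_weight E w ?u}. i \<le> w e \<and> i \<le> w f} = insert 1 {2..min (w e) (w f)}"
    using assms arc_weight_pos[of e] arc_weight_pos[of f] weight_le_vertex_weight[of ?u e] by auto
  also have "(\<Sum>i \<in> insert 1 {2..min (w e) (w f)}. \<rho> (gen (WGhost e i)) * \<rho> (gen (WEdge f i))) =
      \<rho> (gen (WGhost e 1)) * \<rho> (gen (WEdge f 1)) + (\<Sum>i = 2..min (w e) (w f). \<rho> (gen (WGhost e i)) * \<rho> (gen (WEdge f i)))"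
    by (subst sum.insert) auto
  finally show ?thesis
    using fam.gh_ed[of ?u e f] assms by (auto simp: diff sum mult eq_diff_eq)
qed

lemma special_edge_ghost:
  assumes "e \<in> arcs E" "e = \<alpha> (tail E e)" "1 \<le> i" "i \<le> w e" "1 \<le> j" "j \<le> w e"
  shows "\<rho> (gen (WEdge e i)) * \<rho> (gen (WGhost e j)) =
    \<rho> ((if i = j then gen (WVertex (tail E e)) else 0) -
      (\<Sum>h \<in> {h \<in> out_arcs E (tail E e). h \<noteq> e \<and> i \<le> w h \<and> j \<le> w h}. gen (WEdge h i) * gen (WGhost h j)))"
proof -
  let ?u = "tail E e"
  let ?S = "{h \<in> out_arcs E ?u. h \<noteq> e \<and> i \<le> w h \<and> j \<le> w h}"
  have W: "w e = vertex_weight E w ?u" using special_tail[OF assms(1)] assms(2) by simp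
  have fin: "finite (out_arcs E ?u)" using assms(1) by (intro finite_out_arcs) simp
  have "(\<Sum>h\<in>out_arcs E ?u. (if i \<le> w h then \<rho> (gen (WEdge h i)) else 0) * (if j \<le> w h then \<rho> (gen (WGhost h j)) else 0)) =
    (\<Sum>h\<in>out_arcs E ?u. if i \<le> w h \<and> j \<le> w h then \<rho> (gen (WEdge h i)) * \<rho> (gen (WGhost h j)) else 0)"
    by (intro sum.cong) auto
  also have "\<dots> = (\<Sum>h \<in> {h \<in> out_arcs E ?u. i \<le> w h \<and> j \<le> w h}. \<rho> (gen (WEdge h i)) * \<rho> (gen (WGhost h j)))"
    by (rule sum.inter_filter[symmetric]) (rule fin)
  also have "{h \<in> out_arcs E ?u. i \<le> w h \<and> j \<le> w h} = insert e ?S"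
    using assms by auto
  also have "(\<Sum>h \<in> insert e ?S. \<rho> (gen (WEdge h i)) * \<rho> (gen (WGhost h j))) =
     \<rho> (gen (WEdge e i)) * \<rho> (gen (WGhost e j)) + (\<Sum>h \<in> ?S. \<rho> (gen (WEdge h i)) * \<rho> (gen (WGhost h j)))"
    by (subst sum.insert) (use rev_finite_subset[OF fin, of ?S] in \<open>auto simp del: in_out_arcs_conv\<close>)
  finally show ?thesis
    using fam.ed_gh[of ?u i j] assms W by (auto simp: diff sum mult eq_diff_eq)
qed

subsection \<open>Normal words span\<close>

abbreviation basis_words :: "('v, 'e) wlpa_gen word set" where
  "basis_words \<equiv> {Word [WVertex v] | v. v \<in> verts E} \<union> normal_words"

definition spanned :: "(('v, 'e) wlpa_gen word \<Rightarrow>\<^sub>0 'k) \<Rightarrow> bool" where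
  "spanned a \<longleftrightarrow> (\<exists>n. keys n \<subseteq> basis_words \<and> \<rho> a = \<rho> n)"

lemma spanned_cong: "\<rho> a = \<rho> b \<Longrightarrow> spanned b \<Longrightarrow> spanned a"
  by (simp add: spanned_def)

lemma spanned_zero [simp]: "spanned 0"
  unfolding spanned_def by (rule exI[of _ 0]) simp

lemma spanned_add: "spanned a \<Longrightarrow> spanned b \<Longrightarrow> spanned (a + b)"
  unfolding spanned_def by (metis (no_types, lifting) Poly_Mapping.keys_add add le_sup_iff subset_trans)

lemma spanned_const: "spanned a \<Longrightarrow> spanned (const k * a)"
  unfolding spanned_def by (metis (no_types, lifting) keys_const_mult mult subset_trans)

lemma spanned_diff: "spanned a \<Longrightarrow> spanned b \<Longrightarrow> spanned (a - b)"
  using spanned_add[of a "const (-1) * b"] spanned_const[of b "-1"] by (simp add: single_uminus)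

lemma spanned_sum: "(\<And>i. i \<in> S \<Longrightarrow> spanned (f i)) \<Longrightarrow> spanned (sum f S)"
  by (induction S rule: infinite_finite_induct) (auto intro: spanned_add)

lemma spanned_if: "(b \<Longrightarrow> spanned p) \<Longrightarrow> (\<not> b \<Longrightarrow> spanned q) \<Longrightarrow> spanned (if b then p else q)"
  by simp

lemma spanned_mon: "Word xs \<in> basis_words \<Longrightarrow> spanned (mon xs)"
  unfolding spanned_def by (rule exI[of _ "mon xs"]) simp

lemma mon_snoc: "mon (xs @ [x]) = mon xs * gen x"
  by (simp add: gen_def mult_single)

lemma mon_vertex:
  assumes "set xs \<subseteq> X" "xs \<noteq> []"
  shows "\<rho> (mon xs * gen (WVertex (rng (last xs)))) = \<rho> (mon xs)"
    and "\<rho> (gen (WVertex (src (hd xs))) * mon xs) = \<rho> (mon xs)"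
proof -
  have last: "mon xs = mon (butlast xs) * gen (last xs)" "last xs \<in> X"
    using assms mon_snoc[of "butlast xs" "last xs"] last_in_set[of xs] by auto
  have "\<rho> (mon xs * gen (WVertex (rng (last xs)))) =
      \<rho> (mon (butlast xs)) * (\<rho> (gen (last xs)) * \<rho> (gen (WVertex (rng (last xs)))))"
    by (subst last(1)) (simp only: mult mult.assoc)
  also have "\<dots> = \<rho> (mon xs)"
    by (subst last(1)) (simp only: mult gen_rng[OF last(2)])
  finally show "\<rho> (mon xs * gen (WVertex (rng (last xs)))) = \<rho> (mon xs)" .
  have hd: "mon xs = gen (hd xs) * mon (tl xs)" "hd xs \<in> X"
    using assms by (cases xs; simp add: mon_Cons)+
  have "\<rho> (gen (WVertex (src (hd xs))) * mon xs) =
      \<rho> (gen (WVertex (src (hd xs)))) * \<rho> (gen (hd xs)) * \<rho> (mon (tl xs))"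
    by (subst hd(1)) (simp only: mult mult.assoc)
  also have "\<dots> = \<rho> (mon xs)"
    by (subst hd(1)) (simp only: mult src_gen[OF hd(2)])
  finally show "\<rho> (gen (WVertex (src (hd xs))) * mon xs) = \<rho> (mon xs)" .
qed

lemma mon_mult_zero:
  assumes "set xs \<subseteq> X" "xs \<noteq> []" "set ys \<subseteq> X" "ys \<noteq> []" "rng (last xs) \<noteq> src (hd ys)"
  shows "\<rho> (mon xs) * \<rho> (mon ys) = 0"
proof -
  have last: "mon xs = mon (butlast xs) * gen (last xs)" "last xs \<in> X"
    using assms mon_snoc[of "butlast xs" "last xs"] last_in_set[of xs] by auto
  have hd: "mon ys = gen (hd ys) * mon (tl ys)" "hd ys \<in> X"
    using assms by (cases ys; simp add: mon_Cons)+
  have "\<rho> (mon xs) * \<rho> (mon ys) =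
      \<rho> (mon (butlast xs)) * (\<rho> (gen (last xs)) * \<rho> (gen (hd ys))) * \<rho> (mon (tl ys))"
    by (subst last(1), subst hd(1)) (simp only: mult mult.assoc)
  then show ?thesis
    using gen_gen_zero[OF last(2) hd(2) assms(5)] by simp
qed

lemma spanned_mon_vertex:
  assumes "normal ys" "u \<in> verts E" "ys \<noteq> [] \<Longrightarrow> rng (last ys) = u"
  shows "spanned (mon ys * gen (WVertex u))"
proof (cases "ys = []")
  case True
  then show ?thesis using assms spanned_mon[of "[WVertex u]"] by (simp add: gen_def)
next
  case False
  have "spanned (mon ys)" using False assms(1) by (intro spanned_mon) auto
  then show ?thesis
    using mon_vertex(1)[OF normal_subset_X[OF assms(1)] False] False assms(3) spanned_cong by metis
qed

text \<open>Only the seam between \<open>q\<close> and \<open>x\<close> can be forbidden. The pairs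
  that replace it may follow the rest of \<open>q\<close>: whether an edge letter may follow depends
  on its index and its tail, for a ghost letter on its edge and possibly nothing else, and the rules
  keep these data.\<close>

lemma spanned_basis_gen:
  assumes q: "Word q \<in> basis_words" and x: "x \<in> X"
  shows "spanned (mon q * gen x)"
proof -
  consider v where "q = [WVertex v]" "v \<in> verts E" | "q \<noteq> []" "normal q" using q by auto
  then show ?thesis
  proof cases
    case 1
    show ?thesis
    proof (cases "src x = v")
      case True
      then have "\<rho> (mon q * gen x) = \<rho> (mon [x])"
        using src_gen[OF x] 1 by (simp add: mult gen_def)
      moreover have "spanned (mon [x])" using x by (intro spanned_mon) (auto simp: X_iff)
      ultimately show ?thesis by (rule spanned_cong)
    next
      case False
      then have "\<rho> (mon q * gen x) = \<rho> 0"
        using gen_gen_zero[of "WVertex v" x] x 1 by (simp add: mult gen_def X_iff)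
      then show ?thesis by (rule spanned_cong) simp
    qed
  next
    case 2
    let ?y = "last q" and ?ys = "butlast q"
    have q: "q = ?ys @ [?y]" using 2 by simp
    have y: "letter ?y" "?y \<in> X" using 2 last_in_set[of q] by (auto simp: normal_def X_iff)
    have nys: "normal ?ys" "?ys = [] \<or> linked (last ?ys) ?y"
      using 2 normal_append[of ?ys "[?y]"] by auto
    have eq: "\<rho> (mon q * gen x) = \<rho> (mon ?ys) * (\<rho> (gen ?y) * \<rho> (gen x))"
      by (subst q, subst mon_snoc) (simp add: mult mult.assoc)
    show ?thesis
    proof (cases "rng ?y = src x")
      case False
      then have "\<rho> (mon q * gen x) = \<rho> 0"
        unfolding eq by (simp add: gen_gen_zero y x)
      then show ?thesis by (rule spanned_cong) simp
    next
      case comp: True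
      show ?thesis
      proof (cases "letter x")
        case False
        then have "x = WVertex (rng ?y)" using x comp by (auto simp: X_iff)
        then have "\<rho> (mon q * gen x) = \<rho> (mon q)"
          using mon_vertex(1)[of q] 2 normal_subset_X by simp
        then show ?thesis by (rule spanned_cong) (use 2 in \<open>intro spanned_mon, auto\<close>)
      next
        case lx: True
        show ?thesis
        proof (cases "forbidden ?y x")
          case False
          then have "normal (q @ [x])" using 2 lx comp by (simp add: normal_append linked_def)
          then have "spanned (mon (q @ [x]))" by (intro spanned_mon) auto
          then show ?thesis by (simp only: mon_snoc)
        next
          case True
          then consider e i j where "?y = WEdge e i" "x = WGhost e j" "e = \<alpha> (tail E e)"
            | e f where "?y = WGhost e 1" "x = WEdge f 1" "tail E e = tail E f"
            unfolding forbidden_def by blast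
          then show ?thesis
          proof cases
            case c: 1
            let ?u = "tail E e"
            let ?S = "{h \<in> out_arcs E ?u. h \<noteq> e \<and> i \<le> w h \<and> j \<le> w h}"
            have ei: "e \<in> arcs E" "1 \<le> i" "i \<le> w e" "1 \<le> j" "j \<le> w e" using y lx c by auto
            have "\<rho> (mon q * gen x) = \<rho> (mon ?ys * ((if i = j then gen (WVertex ?u) else 0) -
                (\<Sum>h \<in> ?S. gen (WEdge h i) * gen (WGhost h j))))"
              unfolding eq using special_edge_ghost[of e i j] ei c by (simp add: mult)
            also have "\<dots> = \<rho> ((if i = j then mon ?ys * gen (WVertex ?u) else 0) -
                (\<Sum>h \<in> ?S. mon (?ys @ [WEdge h i, WGhost h j])))"
              by (simp add: right_diff_distrib sum_distrib_left gen_def mult_single)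
            finally show ?thesis
            proof (rule spanned_cong)
              show "spanned ((if i = j then mon ?ys * gen (WVertex ?u) else 0) -
                (\<Sum>h \<in> ?S. mon (?ys @ [WEdge h i, WGhost h j])))"
              proof (intro spanned_diff spanned_if spanned_sum spanned_zero)
                show "spanned (mon ?ys * gen (WVertex ?u))"
                  using nys c ei by (intro spanned_mon_vertex) (auto simp: linked_def)
                show "spanned (mon (?ys @ [WEdge h i, WGhost h j]))" if "h \<in> ?S" for h
                  using that nys c ei
                  by (intro spanned_mon) (auto simp: normal_append normal_Cons linked_def forbidden_def)
              qed
            qed
          next
            case c: 2
            have ef: "e \<in> arcs E" "f \<in> arcs E" using y lx c by auto
            have "\<rho> (mon q * gen x) = \<rho> (mon ?ys * ((if e = f then gen (WVertex (head E e)) else 0) -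
                (\<Sum>k = 2..min (w e) (w f). gen (WGhost e k) * gen (WEdge f k))))"
              unfolding eq using ghost_edge_1[of e f] ef c by (simp add: mult)
            also have "\<dots> = \<rho> ((if e = f then mon ?ys * gen (WVertex (head E e)) else 0) -
                (\<Sum>k = 2..min (w e) (w f). mon (?ys @ [WGhost e k, WEdge f k])))"
              by (simp add: right_diff_distrib sum_distrib_left gen_def mult_single)
            finally show ?thesis
            proof (rule spanned_cong)
              show "spanned ((if e = f then mon ?ys * gen (WVertex (head E e)) else 0) -
                (\<Sum>k = 2..min (w e) (w f). mon (?ys @ [WGhost e k, WEdge f k])))"
              proof (intro spanned_diff spanned_if spanned_sum spanned_zero)
                show "spanned (mon ?ys * gen (WVertex (head E e)))"
                  using nys c ef by (intro spanned_mon_vertex) (auto simp: linked_def)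
                show "spanned (mon (?ys @ [WGhost e k, WEdge f k]))" if "k \<in> {2..min (w e) (w f)}" for k
                  using that nys c ef
                  by (intro spanned_mon) (auto simp: normal_append normal_Cons linked_def forbidden_def)
              qed
            qed
          qed
        qed
      qed
    qed
  qed
qed

lemma spanned_mult_gen: "spanned a \<Longrightarrow> x \<in> X \<Longrightarrow> spanned (a * gen x)"
proof -
  assume "spanned a" and x: "x \<in> X"
  then obtain n where n: "keys n \<subseteq> basis_words" "\<rho> a = \<rho> n" by (auto simp: spanned_def)
  have "spanned (n * gen x)"
  proof (rule poly_mapping_keys_induct[OF n(1)])
    fix u k assume "u \<in> basis_words"
    then have "Word (letters u) \<in> basis_words" by auto
    from spanned_const[OF spanned_basis_gen[OF this x], of k] show "spanned (Poly_Mapping.single u k * gen x)"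
      by (simp only: single_conv_mon[of u k] mult.assoc)
  qed (auto simp: distrib_right intro: spanned_add)
  then show ?thesis by (rule spanned_cong[rotated]) (simp add: mult n)
qed

lemma free_alg_spanned: "a \<in> free_alg X \<Longrightarrow> spanned a"
proof (induction rule: free_alg_induct)
  case (single xs k)
  have "spanned (mon xs)" if "set xs \<subseteq> X" "xs \<noteq> []" for xs
    using that(2,1)
  proof (induction xs rule: rev_nonempty_induct)
    case (single x)
    then show ?case by (intro spanned_mon) (auto simp: X_iff)
  next
    case (snoc x xs)
    then show ?case using spanned_mult_gen by (auto simp: mon_snoc)
  qed
  with single show ?case by (simp add: spanned_const)
qed (auto intro: spanned_add)

end

section \<open>Words that are never reduced\<close>

lemma keys_mult_subset:
  assumes "keys a \<subseteq> A" "keys b \<subseteq> B"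
    and "\<And>xs ys. Word xs \<in> A \<Longrightarrow> Word ys \<in> B \<Longrightarrow> Word (xs @ ys) \<in> C"
  shows "keys (a * b) \<subseteq> C"
proof
  fix u assume "u \<in> keys (a * b)"
  then obtain x y where "x \<in> keys a" "y \<in> keys b" "u = x + y"
    using keys_mult[of a b] by blast
  moreover obtain xs ys where "x = Word xs" "y = Word ys" by (metis word.exhaust)
  ultimately show "u \<in> C" using assms by auto
qed

lemma keys_diff_subset:
  "keys (a - b :: 'x \<Rightarrow>\<^sub>0 'k::ab_group_add) \<subseteq> keys a \<union> keys b"
  by (auto simp: in_keys_iff lookup_minus)

context special_edges_quotient
begin

text \<open>Since basis words span, linearity reduces the replacement of the middle factor to the
  case of one basis word.\<close>

lemma free_alg_strip:
  assumes a: "a \<in> free_alg X"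
    and words: "\<And>xs. Word xs \<in> basis_words \<Longrightarrow> \<exists>n. keys n \<subseteq> K \<and> \<rho> (l * mon xs * r) = \<rho> (l * n * r)"
  shows "\<exists>n. keys n \<subseteq> K \<and> \<rho> (l * a * r) = \<rho> (l * n * r)"
proof -
  obtain m where m: "keys m \<subseteq> basis_words" "\<rho> a = \<rho> m"
    using free_alg_spanned[OF a] by (auto simp: spanned_def)
  have "\<exists>n. keys n \<subseteq> K \<and> \<rho> (l * m * r) = \<rho> (l * n * r)"
  proof (rule poly_mapping_keys_induct[OF m(1)])
    show "\<exists>n. keys n \<subseteq> K \<and> \<rho> (l * 0 * r) = \<rho> (l * n * r)"
      by (rule exI[of _ 0]) simp
  next
    fix u k assume "u \<in> basis_words"
    then have "Word (letters u) \<in> basis_words" by auto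
    then obtain n where n: "keys n \<subseteq> K" "\<rho> (l * mon (letters u) * r) = \<rho> (l * n * r)"
      using words by blast
    have "\<rho> (l * Poly_Mapping.single u k * r) = \<rho> (const k) * \<rho> (l * mon (letters u) * r)"
      by (simp only: single_conv_mon[of u k] const_left_commute mult.assoc flip: mult)
    also have "\<dots> = \<rho> (const k) * \<rho> (l * n * r)" by (simp only: n(2))
    also have "\<dots> = \<rho> (l * (const k * n) * r)"
      by (simp only: const_left_commute mult.assoc flip: mult)
    finally show "\<exists>n. keys n \<subseteq> K \<and> \<rho> (l * Poly_Mapping.single u k * r) = \<rho> (l * n * r)"
      using keys_const_mult[of k n] n(1) by blast
  next
    fix p q
    assume "\<exists>n. keys n \<subseteq> K \<and> \<rho> (l * p * r) = \<rho> (l * n * r)"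
      and "\<exists>n. keys n \<subseteq> K \<and> \<rho> (l * q * r) = \<rho> (l * n * r)"
    then obtain n n' where "keys n \<subseteq> K" "keys n' \<subseteq> K"
      "\<rho> (l * p * r) = \<rho> (l * n * r)" "\<rho> (l * q * r) = \<rho> (l * n' * r)" by blast
    then show "\<exists>n. keys n \<subseteq> K \<and> \<rho> (l * (p + q) * r) = \<rho> (l * n * r)"
      using Poly_Mapping.keys_add[of n n']
      by (intro exI[of _ "n + n'"]) (auto simp: distrib_left distrib_right add)
  qed
  then show ?thesis by (simp add: mult m(2))
qed

lemma keys_zero_or_one: "keys (0 :: ('v, 'e) wlpa_gen word \<Rightarrow>\<^sub>0 'k) = {}"
  "keys (1 :: ('v, 'e) wlpa_gen word \<Rightarrow>\<^sub>0 'k) = {Word []}"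
  by (simp_all add: zero_word_def)

text \<open>
  The assumptions on \<open>p\<close> say that \<open>x p y\<close> is normal whenever \<open>x\<close> and \<open>y\<close> are normal and can be composed with
  \<open>p\<close>. Hence products with a factor \<open>p\<close> between any two others may be computed in the free algebra, where
  one can cancel and compare lengths and prefixes: \<open>b p c\<close> is never idempotent since \<open>b p (c b) p c\<close> is longer,
  and \<open>z\<close>, \<open>z'\<close> contradict commutativity.
\<close>

lemma not_reduction_property:
  assumes p: "normal p" "p \<noteq> []"
    and left: "\<And>x. letter x \<Longrightarrow> \<not> forbidden x (hd p)"
    and right: "\<And>x. letter x \<Longrightarrow> \<not> forbidden (last p) x"
    and z: "normal z" "z \<noteq> []" "src (hd z) = rng (last p)" "rng (last z) = src (hd p)"
    and z': "normal z'" "z' \<noteq> []" "src (hd z') = rng (last p)" "rng (last z') = src (hd p)"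
    and zz': "length z = length z'" "z \<noteq> z'"
  shows "\<not> reduction_property (presented_alg X (wlpa_rels E w) :: ('k, _) alg)"
proof
  assume red: "reduction_property (presented_alg X (wlpa_rels E w) :: ('k, _) alg)"
  define s r where "s = src (hd p)" and "r = rng (last p)"
  define P :: "('v, 'e) wlpa_gen word \<Rightarrow>\<^sub>0 'k" where "P = mon p"
  have pX: "set p \<subseteq> X" using normal_subset_X[OF p(1)] .
  have P_fa: "P \<in> free_alg X" using p pX by (simp add: P_def)
  have sP: "\<rho> (gen (WVertex s)) * \<rho> P = \<rho> P" and Pr: "\<rho> P * \<rho> (gen (WVertex r)) = \<rho> P"
    using mon_vertex[OF pX p(2)] by (simp_all add: P_def s_def r_def mult)
  have hd_letter: "letter (hd xs)" "letter (last xs)" if "normal xs" "xs \<noteq> []" for xs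
    using that hd_in_set last_in_set by (auto simp: normal_def)
  have s_verts: "s \<in> verts E" and r_verts: "r \<in> verts E"
    using hd_letter[OF p] by (auto simp: s_def r_def letter_src letter_ran)
  have vP: "\<rho> (gen (WVertex v)) * \<rho> P = 0" if "v \<in> verts E" "v \<noteq> s" for v
    using fam.vx_vx[OF that(1) s_verts] that(2) sP by (metis mult.assoc mult_zero_left)
  have Pv: "\<rho> P * \<rho> (gen (WVertex v)) = 0" if "v \<in> verts E" "v \<noteq> r" for v
    using fam.vx_vx[OF r_verts that(1)] that(2) Pr by (metis mult.assoc mult_zero_right)

  \<comment> \<open>\<open>KL\<close>, \<open>KR\<close> and \<open>KM\<close> are the normal words
    that compose with \<open>p\<close> on their right, on their left, and on both sides. The empty
    word replaces the end vertices of \<open>p\<close>, in \<open>KM\<close> only if these coincide.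
    \<open>EP\<close> and \<open>DP\<close> describe the words of products that end in the factor
    \<open>P\<close>.\<close>
  define KL where "KL = {Word xs | xs. normal xs \<and> (xs \<noteq> [] \<longrightarrow> rng (last xs) = s)}"
  define KR where "KR = {Word xs | xs. normal xs \<and> (xs \<noteq> [] \<longrightarrow> src (hd xs) = r)}"
  define KM where "KM = {Word xs | xs. normal xs \<and> (xs = [] \<longrightarrow> r = s) \<and> (xs \<noteq> [] \<longrightarrow> src (hd xs) = r \<and> rng (last xs) = s)}"
  define EP where "EP = {Word xs | xs. normal xs \<and> xs \<noteq> [] \<and> last xs = last p}"
  define DP where "DP = {Word xs | xs. normal xs \<and> xs \<noteq> [] \<and> last xs = last p \<and> src (hd xs) = r}"
  have keys_P: "keys P = {Word p}" by (simp add: P_def)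
  have keys_KL: "keys (n * P) \<subseteq> EP" if "keys n \<subseteq> KL" for n
    using that equalityD1[OF keys_P]
    by (rule keys_mult_subset) (use p hd_letter left in \<open>auto simp: KL_def EP_def normal_append linked_def s_def\<close>)
  have keys_DP: "keys (d * P) \<subseteq> DP" if "keys d \<subseteq> KM" for d
    using that equalityD1[OF keys_P]
  proof (rule keys_mult_subset)
    fix xs ys assume "Word xs \<in> KM" "Word ys \<in> {Word p}"
    then show "Word (xs @ ys) \<in> DP"
      using p hd_letter left by (cases "xs = []") (auto simp: KM_def DP_def normal_append linked_def s_def)
  qed
  have keys_EP: "keys (a * (d * P)) \<subseteq> EP"
    if "keys a \<subseteq> EP" "keys d \<subseteq> KM" for a d
    using that(1) keys_DP[OF that(2)]
    by (rule keys_mult_subset) (use right hd_letter in \<open>auto simp: EP_def DP_def normal_append linked_def r_def\<close>)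
  have keys_KR: "keys (a * n) \<subseteq> normal_words"
    if "keys a \<subseteq> EP" "keys n \<subseteq> KR" for a n
    using that
    by (rule keys_mult_subset) (use right hd_letter in \<open>auto simp: EP_def KR_def normal_append linked_def r_def\<close>)
  \<comment> \<open>By independence, equality modulo the relations of combinations of normal words
    is equality in the free algebra.\<close>
  have eq_literal: "a = b" if "\<rho> a = \<rho> b" "keys a \<subseteq> normal_words" "keys b \<subseteq> normal_words" for a b
  proof -
    have "a - b \<in> ideal_of (wlpa_rels E w)" using that(1) by (simp add: diff flip: kernel)
    moreover have "keys (a - b) \<subseteq> normal_words"
      using that(2,3) keys_diff_subset[of a b] by blast
    ultimately show ?thesis using normal_words_independent by fastforce
  qed

  have strip_left: "\<exists>n. keys n \<subseteq> KL \<and> \<rho> (b * P) = \<rho> (n * P)" if b: "b \<in> free_alg X" for b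
  proof -
    have "\<exists>n. keys n \<subseteq> KL \<and> \<rho> (1 * b * P) = \<rho> (1 * n * P)"
      using b
    proof (rule free_alg_strip)
      fix xs assume "Word xs \<in> basis_words"
      then consider v where "xs = [WVertex v]" "v \<in> verts E" | "xs \<noteq> []" "normal xs" by auto
      then show "\<exists>n. keys n \<subseteq> KL \<and> \<rho> (1 * mon xs * P) = \<rho> (1 * n * P)"
      proof cases
        case 1
        show ?thesis
        proof (cases "v = s")
          case True
          then show ?thesis using 1 sP
            by (intro exI[of _ 1]) (simp add: mult KL_def keys_zero_or_one(2) del: keys_one flip: gen_def)
        next
          case False
          then show ?thesis using 1 vP by (intro exI[of _ 0]) (simp add: mult flip: gen_def)
        qed
      next
        case 2
        show ?thesis
        proof (cases "rng (last xs) = s")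
          case True
          then show ?thesis using 2 by (intro exI[of _ "mon xs"]) (auto simp: KL_def)
        next
          case False
          then have "\<rho> (mon xs * P) = 0"
            using mon_mult_zero[of xs p] 2 p pX normal_subset_X by (simp add: mult P_def s_def)
          then show ?thesis by (intro exI[of _ 0]) simp
        qed
      qed
    qed
    then show ?thesis by simp
  qed
  have strip_right: "\<exists>n. keys n \<subseteq> KR \<and> \<rho> (P * c) = \<rho> (P * n)" if c: "c \<in> free_alg X" for c
  proof -
    have "\<exists>n. keys n \<subseteq> KR \<and> \<rho> (P * c * 1) = \<rho> (P * n * 1)"
      using c
    proof (rule free_alg_strip)
      fix xs assume "Word xs \<in> basis_words"
      then consider v where "xs = [WVertex v]" "v \<in> verts E" | "xs \<noteq> []" "normal xs" by auto
      then show "\<exists>n. keys n \<subseteq> KR \<and> \<rho> (P * mon xs * 1) = \<rho> (P * n * 1)"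
      proof cases
        case 1
        show ?thesis
        proof (cases "v = r")
          case True
          then show ?thesis using 1 Pr
            by (intro exI[of _ 1]) (simp add: mult KR_def keys_zero_or_one(2) del: keys_one flip: gen_def)
        next
          case False
          then show ?thesis using 1 Pv by (intro exI[of _ 0]) (simp add: mult flip: gen_def)
        qed
      next
        case 2
        show ?thesis
        proof (cases "src (hd xs) = r")
          case True
          then show ?thesis using 2 by (intro exI[of _ "mon xs"]) (auto simp: KR_def)
        next
          case False
          then have "\<rho> (P * mon xs) = 0"
            using mon_mult_zero[of p xs] 2 p pX normal_subset_X by (simp add: mult P_def r_def)
          then show ?thesis by (intro exI[of _ 0]) simp
        qed
      qed
    qed
    then show ?thesis by simp
  qed
  have strip_mid: "\<exists>n. keys n \<subseteq> KM \<and> \<rho> (P * a * P) = \<rho> (P * n * P)" if a: "a \<in> free_alg X" for a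
    using a
  proof (rule free_alg_strip)
    fix xs assume "Word xs \<in> basis_words"
    then consider v where "xs = [WVertex v]" "v \<in> verts E" | "xs \<noteq> []" "normal xs" by auto
    then show "\<exists>n. keys n \<subseteq> KM \<and> \<rho> (P * mon xs * P) = \<rho> (P * n * P)"
    proof cases
      case 1
      show ?thesis
      proof (cases "v = r \<and> v = s")
        case True
        then show ?thesis using 1 Pr
          by (intro exI[of _ 1]) (auto simp: mult KM_def keys_zero_or_one(2) simp del: keys_one simp flip: gen_def)
      next
        case False
        have "\<rho> (P * mon xs * P) = \<rho> P * \<rho> (mon xs) * \<rho> P" "\<rho> (P * mon xs * P) = \<rho> P * (\<rho> (mon xs) * \<rho> P)"
          by (simp_all add: mult mult.assoc)
        then have "\<rho> (P * mon xs * P) = 0"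
          using 1 Pv[OF 1(2)] vP[OF 1(2)] False by (cases "v = r"; cases "v = s") (auto simp flip: gen_def)
        then show ?thesis by (intro exI[of _ 0]) simp
      qed
    next
      case 2
      show ?thesis
      proof (cases "src (hd xs) = r \<and> rng (last xs) = s")
        case True
        then show ?thesis using 2 by (intro exI[of _ "mon xs"]) (auto simp: KM_def)
      next
        case False
        have "\<rho> (P * mon xs * P) = \<rho> P * \<rho> (mon xs) * \<rho> P" "\<rho> (P * mon xs * P) = \<rho> P * (\<rho> (mon xs) * \<rho> P)"
          by (simp_all add: mult mult.assoc)
        then have "\<rho> (P * mon xs * P) = 0"
          using mon_mult_zero[of p xs] mon_mult_zero[of xs p] 2 p pX normal_subset_X False
          by (auto simp: P_def r_def s_def)
        then show ?thesis by (intro exI[of _ 0]) simp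
      qed
    qed
  qed

  have P_notin: "P \<notin> ideal_of (wlpa_rels E w)"
    using normal_words_independent[of P] p by (auto simp: P_def mon_neq_zero)
  note red' = red[unfolded reduction_property_presented_alg[OF wlpa_rels_free_alg[OF weighted_graph]]]
  obtain b c where bc: "b \<in> free_alg X" "c \<in> free_alg X"
    and bPc: "let u = b * P * c in u \<notin> ideal_of (wlpa_rels E w) \<and>
      (u * u - u \<in> ideal_of (wlpa_rels E w) \<or>
      (\<exists>t\<in>free_alg X. u * t * u \<notin> ideal_of (wlpa_rels E w)) \<and>
      (\<forall>t\<in>free_alg X. \<forall>t'\<in>free_alg X. u * t * u * t' * u - u * t' * u * t * u \<in> ideal_of (wlpa_rels E w)))"
    using bspec[OF red' P_fa, THEN mp, OF P_notin] by (elim bexE) (rule that)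
  from bPc have u: "b * P * c \<notin> ideal_of (wlpa_rels E w)"
    and disj: "(b * P * c) * (b * P * c) - b * P * c \<in> ideal_of (wlpa_rels E w) \<or>
      (\<exists>t\<in>free_alg X. (b * P * c) * t * (b * P * c) \<notin> ideal_of (wlpa_rels E w)) \<and>
      (\<forall>t\<in>free_alg X. \<forall>t'\<in>free_alg X. (b * P * c) * t * (b * P * c) * t' * (b * P * c) - (b * P * c) * t' * (b * P * c) * t * (b * P * c)
         \<in> ideal_of (wlpa_rels E w))"
    unfolding Let_def by (rule conjunct1, rule conjunct2)
  obtain b' where b': "keys b' \<subseteq> KL" "\<rho> b * \<rho> P = \<rho> b' * \<rho> P"
    using strip_left[OF bc(1)] by (auto simp: mult)
  obtain c' where c': "keys c' \<subseteq> KR" "\<rho> P * \<rho> c = \<rho> P * \<rho> c'"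
    using strip_right[OF bc(2)] by (auto simp: mult)
  have \<rho>u: "\<rho> (b * P * c) = \<rho> (b' * P * c')"
  proof -
    have "\<rho> (b * P * c) = \<rho> b * \<rho> P * \<rho> c" by (simp only: mult)
    also have "\<dots> = \<rho> b' * (\<rho> P * \<rho> c)" by (simp only: b'(2) mult.assoc)
    also have "\<dots> = \<rho> (b' * P * c')" by (simp only: c'(2) mult mult.assoc)
    finally show ?thesis .
  qed
  then have u_ne: "b' * P * c' \<noteq> 0" using u kernel zero by metis
  then have ne: "b' * P \<noteq> 0" "c' \<noteq> 0" by auto
  note no_zd = free_algebra_no_zero_divisors
  from disj show False
  proof
    assume "(b * P * c) * (b * P * c) - b * P * c \<in> ideal_of (wlpa_rels E w)"
    then have idem: "\<rho> (b * P * c) * \<rho> (b * P * c) = \<rho> (b * P * c)" by (simp add: diff mult flip: kernel)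
    obtain d where d: "keys d \<subseteq> KM" "\<rho> (P * (c * b) * P) = \<rho> (P * d * P)"
      using strip_mid[of "c * b"] bc free_alg_mult by blast
    have "\<rho> (b * P * c) * \<rho> (b * P * c) = \<rho> b * \<rho> (P * (c * b) * P) * \<rho> c"
      by (simp add: mult mult.assoc)
    also have "\<dots> = (\<rho> b * \<rho> P) * \<rho> d * (\<rho> P * \<rho> c)" unfolding d(2) by (simp only: mult mult.assoc)
    also have "\<dots> = \<rho> (b' * P * (d * P) * c')" unfolding b'(2) c'(2) by (simp only: mult mult.assoc)
    finally have "\<rho> (b' * P * (d * P) * c') = \<rho> (b' * P * c')" using idem \<rho>u by simp
    then have "b' * P * (d * P) * c' = b' * P * c'"
      using keys_KR[OF keys_EP[OF keys_KL[OF b'(1)] d(1)] c'(1)] keys_KR[OF keys_KL[OF b'(1)] c'(1)]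
      by (rule eq_literal)
    \<comment> \<open>Cancelling \<open>b' * P\<close> and \<open>c'\<close> leaves
      \<open>d * P = 1\<close>, although no word of \<open>d * P\<close> is empty.\<close>
    then have "(b' * P) * ((d * P - 1) * c') = 0" by (simp add: algebra_simps)
    then have "d * P = 1" using no_zd ne by (metis eq_iff_diff_eq_0)
    moreover have "Word [] \<notin> DP" by (simp add: DP_def)
    ultimately show False using keys_DP[OF d(1)] by (simp add: keys_zero_or_one(2) del: keys_one)
  next
    assume *: "(\<exists>t\<in>free_alg X. (b * P * c) * t * (b * P * c) \<notin> ideal_of (wlpa_rels E w)) \<and>
      (\<forall>t\<in>free_alg X. \<forall>t'\<in>free_alg X. (b * P * c) * t * (b * P * c) * t' * (b * P * c) - (b * P * c) * t' * (b * P * c) * t * (b * P * c)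
         \<in> ideal_of (wlpa_rels E w))"
    then obtain t where t: "t \<in> free_alg X" "\<rho> ((b * P * c) * t * (b * P * c)) \<noteq> 0" by (auto simp: kernel)
    obtain d where d: "keys d \<subseteq> KM" "\<rho> (P * (c * t * b) * P) = \<rho> (P * d * P)"
      using strip_mid[of "c * t * b"] bc t(1) free_alg_mult by blast
    have d0: "d \<noteq> 0"
    proof
      assume "d = 0"
      then have "\<rho> (P * (c * t * b) * P) = 0" using d(2) by simp
      moreover have "\<rho> ((b * P * c) * t * (b * P * c)) = \<rho> b * \<rho> (P * (c * t * b) * P) * \<rho> c"
        by (simp add: mult mult.assoc)
      ultimately show False using t(2) by simp
    qed
    have P0: "P \<noteq> 0" by (simp add: P_def mon_neq_zero)
    \<comment> \<open>Test elements shaped such that, between two copies of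
      \<open>u = b * P * c\<close>, each gap around \<open>y\<close> becomes
      \<open>P * (c * t * b) * P\<close>, which equals \<open>P * d * P\<close> modulo the
      relations. The choice of \<open>t\<close> keeps \<open>d\<close> nonzero.\<close>
    define T where "T y = t * b * P * mon y * P * c * t" for y
    define D where "D = P * d * P * d * P"
    have D0: "D \<noteq> 0" unfolding D_def using no_zd d0 P0 by metis
    have T_fa: "T y \<in> free_alg X" if "normal y" "y \<noteq> []" for y
      using that normal_subset_X[OF that(1)] t(1) bc P_fa by (auto simp: T_def intro!: free_alg_mult)
    have comm: "\<rho> (b * P * c) * \<rho> (T y) * \<rho> (b * P * c) * \<rho> (T y') * \<rho> (b * P * c) =
        \<rho> (b' * P * (d * P) * (mon y * P) * (d * P) * (d * P) * (mon y' * P) * (d * P) * c')" for y y'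
    proof -
      have "\<rho> (b * P * c) * \<rho> (T y) * \<rho> (b * P * c) * \<rho> (T y') * \<rho> (b * P * c) =
        \<rho> b * \<rho> (P * (c * t * b) * P) * \<rho> (mon y) * \<rho> (P * (c * t * b) * P) * \<rho> (c * t * b) * \<rho> P * \<rho> (mon y') * \<rho> (P * (c * t * b) * P) * \<rho> c"
        by (simp add: T_def mult mult.assoc)
      also have "\<dots> = \<rho> b * \<rho> (P * d * P) * \<rho> (mon y) * \<rho> (P * d * P) * \<rho> (c * t * b) * \<rho> P * \<rho> (mon y') * \<rho> (P * d * P) * \<rho> c"
        by (simp only: d(2))
      also have "\<dots> = \<rho> b * \<rho> (P * d * P) * \<rho> (mon y) * \<rho> (P * d) * \<rho> (P * (c * t * b) * P) * \<rho> (mon y') * \<rho> (P * d * P) * \<rho> c"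
        by (simp only: mult mult.assoc)
      also have "\<dots> = (\<rho> b * \<rho> P) * \<rho> (d * P) * \<rho> (mon y * P) * \<rho> (d * P) * \<rho> (d * P) * \<rho> (mon y' * P) * \<rho> d * (\<rho> P * \<rho> c)"
        unfolding d(2) by (simp only: mult mult.assoc)
      also have "\<dots> = \<rho> (b' * P * (d * P) * (mon y * P) * (d * P) * (d * P) * (mon y' * P) * (d * P) * c')"
        unfolding b'(2) c'(2) by (simp only: mult mult.assoc)
      finally show ?thesis .
    qed
    have keys: "keys (b' * P * (d * P) * (mon y * P) * (d * P) * (d * P) * (mon y' * P) * (d * P) * c') \<subseteq> normal_words"
      if "Word y \<in> KM" "Word y' \<in> KM" for y y'
      using that d(1) b'(1) c'(1) by (intro keys_KR keys_EP keys_KL) auto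
    have zKM: "Word z \<in> KM" "Word z' \<in> KM" using z z' by (auto simp: KM_def r_def s_def)
    have "\<rho> (b * P * c) * \<rho> (T z) * \<rho> (b * P * c) * \<rho> (T z') * \<rho> (b * P * c) =
        \<rho> (b * P * c) * \<rho> (T z') * \<rho> (b * P * c) * \<rho> (T z) * \<rho> (b * P * c)"
      using conjunct2[OF *, rule_format, OF T_fa[OF z(1,2)] T_fa[OF z'(1,2)]]
      by (simp add: diff mult flip: kernel)
    then have "b' * P * (d * P) * (mon z * P) * (d * P) * (d * P) * (mon z' * P) * (d * P) * c' =
        b' * P * (d * P) * (mon z' * P) * (d * P) * (d * P) * (mon z * P) * (d * P) * c'"
      unfolding comm using keys zKM by (intro eq_literal) auto
    then have "(b' * P) * ((d * P) * ((mon z * (D * mon z') - mon z' * (D * mon z)) * (P * d * P * c'))) = 0"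
      by (simp add: D_def algebra_simps)
    then have "mon z * (D * mon z') = mon z' * (D * mon z)"
      using no_zd ne d0 P0 by (metis eq_iff_diff_eq_0)
    \<comment> \<open>The two sides begin with different words of the same length, so both vanish,
      which is impossible without zero divisors.\<close>
    from mon_mult_neq[OF zz' this] have "mon z * (D * mon z') = 0" .
    then show False using no_zd D0 mon_neq_zero by metis
  qed
qed

end

subsection \<open>Graphs violating Condition (LPA)\<close>

primrec star :: "('v, 'e) wlpa_gen \<Rightarrow> ('v, 'e) wlpa_gen" where
  "star (WVertex v) = WVertex v"
| "star (WEdge e i) = WGhost e i"
| "star (WGhost e i) = WEdge e i"

context special_edges
begin

lemma star_letter [simp]: "letter (star x) = letter x" "src (star x) = rng x" "rng (star x) = src x"
  by (cases x; simp)+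

text \<open>The involution reverses words and permutes each kind of forbidden pair:
  \<open>\<alpha>_i \<alpha>_j^*\<close> becomes \<open>\<alpha>_j \<alpha>_i^*\<close>, and
  \<open>e_1^* f_1\<close> becomes \<open>f_1^* e_1\<close>.\<close>

lemma star_linked: "linked (star y) (star x) \<longleftrightarrow> linked x y"
  by (cases x; cases y) (auto simp: linked_def forbidden_def)

lemma normal_star: "normal (rev (map star xs)) \<longleftrightarrow> normal xs"
proof (induction xs)
  case (Cons x xs)
  have "linked (last (rev (map star xs))) (star x) \<longleftrightarrow> linked x (hd xs)" if "xs \<noteq> []"
    using that by (cases xs) (auto simp: star_linked)
  then show ?case using Cons by (cases "xs = []") (auto simp: normal_append normal_Cons)
qed simp

abbreviation edges :: "'e list \<Rightarrow> ('v, 'e) wlpa_gen list" where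
  "edges xs \<equiv> map (\<lambda>e. WEdge e 1) xs"

abbreviation ghosts :: "'e list \<Rightarrow> ('v, 'e) wlpa_gen list" where
  "ghosts xs \<equiv> rev (map (\<lambda>e. WGhost e 1) xs)"

lemma awalk_ends_arcs:
  assumes "awalk u xs v" "xs \<noteq> []"
  shows "tail E (hd xs) = u" "head E (last xs) = v"
proof -
  obtain a ys where "xs = a # ys" using assms by (cases xs) auto
  then show "tail E (hd xs) = u" using assms by (auto simp: awalk_Cons_iff)
  show "head E (last xs) = v" using assms awalk_verts_conv[of u xs] by (metis awlast_if_cas awalk_def last_snoc)
qed

text \<open>A forbidden pair consists of an edge and a ghost letter, so none occurs among edge
  letters.\<close>

lemma normal_edges: "awalk u xs v \<Longrightarrow> normal (edges xs)"
proof (induction xs arbitrary: u)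
  case (Cons e xs)
  then have e: "e \<in> arcs E" "awalk (head E e) xs v" by (auto simp: awalk_Cons_iff)
  then have "normal (edges xs)" using Cons.IH by blast
  moreover have "linked (WEdge e 1) (hd (edges xs))" if "xs \<noteq> []"
    using awalk_ends_arcs(1)[OF e(2) that] that by (simp add: linked_def forbidden_def hd_map)
  ultimately show ?case using e arc_weight_pos by (auto simp: normal_Cons)
qed simp

lemma normal_weighted_edges:
  assumes "awalk (head E e) xs v" "e \<in> arcs E" "1 \<le> i" "i \<le> w e"
  shows "normal (WEdge e i # edges xs)"
  using normal_edges[OF assms(1)] assms awalk_ends_arcs(1)[OF assms(1)]
  by (auto simp: normal_Cons linked_def forbidden_def hd_map)

lemma last_weighted_edges: "\<exists>j. last (WEdge e i # edges xs) = WEdge (last (e # xs)) j"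
  by (cases xs rule: rev_cases) auto

lemma linked_edge_ghost: "linked (WEdge e i) (WGhost f j) \<longleftrightarrow> head E e = head E f \<and> \<not> (e = f \<and> e = \<alpha> (tail E e))"
  by (auto simp: linked_def forbidden_def)

lemma normal_ghosts_weighted:
  assumes "awalk (head E e) xs v" "e \<in> arcs E" "1 \<le> i" "i \<le> w e"
  shows "normal (ghosts xs @ [WGhost e i])" "\<exists>j. hd (ghosts xs @ [WGhost e i]) = WGhost (last (e # xs)) j"
proof -
  show "normal (ghosts xs @ [WGhost e i])"
    using normal_star[of "WEdge e i # edges xs"] normal_weighted_edges[OF assms] by (simp add: comp_def)
  show "\<exists>j. hd (ghosts xs @ [WGhost e i]) = WGhost (last (e # xs)) j"
    by (cases xs rule: rev_cases) auto
qed

lemma last_head: "awalk (head E e) xs v \<Longrightarrow> head E (last (e # xs)) = v"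
  using awalk_ends_arcs(2)[of "head E e" xs v] by (cases "xs = []") (auto simp: awalk_Nil_iff)

end

context special_edges_quotient
begin

text \<open>The letter \<open>e_2\<close> is never second in a forbidden pair. As two words leading
  back from the end of the word to its start, take its star and the star of the same word with
  \<open>e_1\<close> in place of \<open>e_2\<close>: they have equal length and differ in the last
  letter.\<close>

lemma not_reduction_property_weighted:
  assumes e: "e \<in> arcs E" "2 \<le> w e" and p: "normal (WEdge e 2 # q)"
    and right: "\<And>x. \<not> forbidden (last (WEdge e 2 # q)) x"
  shows "\<not> reduction_property (presented_alg X (wlpa_rels E w) :: ('k, _) alg)"
proof (rule not_reduction_property[where p = "WEdge e 2 # q" and z = "rev (map star (WEdge e 2 # q))"
      and z' = "rev (map star (WEdge e 1 # q))"])
  let ?z = "\<lambda>i. rev (map star (WEdge e i # q))"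
  have q1: "normal (WEdge e 1 # q)"
    using p e by (auto simp: normal_Cons linked_def forbidden_def)
  show "normal (?z 2)" "normal (?z 1)"
    using p q1 normal_star by blast+
  have hd: "hd (?z i) = star (last (WEdge e i # q))" for i by (cases q rule: rev_cases) auto
  have "rng (last (WEdge e i # q)) = rng (last (WEdge e 2 # q))" for i by simp
  then show "src (hd (?z 2)) = rng (last (WEdge e 2 # q))" "src (hd (?z 1)) = rng (last (WEdge e 2 # q))"
    using hd by (metis star_letter(2))+
qed (use p right in \<open>auto simp: forbidden_def\<close>)

end

context special_edges
begin

text \<open>The last letter must not begin a forbidden pair, so it has to be an edge letter for an
  edge other than the special one, or a ghost letter with index at least 2. The cases below produce
  one or the other.\<close>

lemma LPA_witness:
  assumes "\<not> condition_LPA E w"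
  shows "\<exists>e q. e \<in> arcs E \<and> 2 \<le> w e \<and> normal (WEdge e 2 # q) \<and> (\<forall>x. \<not> forbidden (last (WEdge e 2 # q)) x)"
proof -
  consider "\<not> LPA1 E w" | "\<not> LPA2 E w" | "\<not> LPA3 E w" | "\<not> LPA4 E w"
    using assms by (auto simp: condition_LPA_def)
  then show ?thesis
  proof cases
    case 1
    then obtain e f where "e \<in> weighted_edges E w" "f \<in> weighted_edges E w" "tail E e = tail E f" "e \<noteq> f"
      unfolding LPA1_def by metis
    \<comment> \<open>Two weighted edges at the same vertex cannot both be special.\<close>
    then obtain g where "g \<in> weighted_edges E w" "g \<noteq> \<alpha> (tail E g)" by metis
    then show ?thesis
      by (intro exI[of _ g] exI[of _ "[]"]) (auto simp: weighted_edges_def forbidden_def)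
  next
    case 2
    then obtain e v f g where e: "e \<in> weighted_edges E w" and v: "path_to E (head E e) v"
      and fg: "f \<in> out_arcs E v" "g \<in> out_arcs E v" "f \<noteq> g"
      unfolding LPA2_def tree_def by auto
    \<comment> \<open>At least one of two edges leaving \<open>v\<close> is not special; the word
      runs from \<open>e_2\<close> to that edge.\<close>
    then obtain h where h: "h \<in> arcs E" "tail E h = v" "h \<noteq> \<alpha> v" by auto
    obtain xs where xs: "awalk (head E e) xs v" using v by (auto simp: path_to_def)
    let ?q = "edges (xs @ [h])"
    have "awalk (head E e) (xs @ [h]) (head E h)"
      using xs h by (auto simp: awalk_append_iff awalk_simps)
    then have "normal (WEdge e 2 # ?q)"
      using e by (intro normal_weighted_edges) (auto simp: weighted_edges_def)
    then show ?thesis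
      using e h by (intro exI[of _ e] exI[of _ ?q]) (auto simp: weighted_edges_def forbidden_def)
  next
    case 3
    then obtain e f where ef: "e \<in> weighted_edges E w" "f \<in> weighted_edges E w" "\<not> in_line E e f"
      and T: "tree E {head E e} \<inter> tree E {head E f} \<noteq> {}"
      unfolding LPA3_def by blast
    \<comment> \<open>Walks from both heads to a common vertex, of least total length, do not end in
      the same edge: dropping it would shorten both, and if it is \<open>e\<close> or
      \<open>f\<close> itself, these are in line. So nothing is forbidden where the word
      \<open>e_2 xs ys^* f_2^*\<close> turns back.\<close>
    define Q where "Q n \<longleftrightarrow> (\<exists>xs ys v. awalk (head E e) xs v \<and> awalk (head E f) ys v \<and> n = length xs + length ys)" for n
    have "\<exists>n. Q n" using T by (auto simp: tree_def path_to_def Q_def)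
    then obtain n where n: "Q n" "\<And>m. m < n \<Longrightarrow> \<not> Q m" using exists_least_iff[of Q] by auto
    then obtain xs ys v where xs: "awalk (head E e) xs v" and ys: "awalk (head E f) ys v" and len: "n = length xs + length ys"
      by (auto simp: Q_def)
    have "last (e # xs) \<noteq> last (f # ys)"
    proof
      assume eq: "last (e # xs) = last (f # ys)"
      show False
      proof (cases xs rule: rev_cases)
        case Nil
        show False
        proof (cases ys rule: rev_cases)
          case Nil
          then show False using eq \<open>xs = []\<close> ef(3) by (simp add: in_line_def)
        next
          case (snoc ys' a)
          then have "a = e" using eq \<open>xs = []\<close> by simp
          then have "awalk (head E f) ys' (tail E e)" using ys snoc by (auto simp: awalk_simps)
          then show False using ef(3) by (auto simp: in_line_def path_to_def)
        qed
      next
        case (snoc xs' a)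
        note xs' = this
        show False
        proof (cases ys rule: rev_cases)
          case Nil
          then have "a = f" using eq snoc by simp
          then have "awalk (head E e) xs' (tail E f)" using xs snoc by (auto simp: awalk_simps)
          then show False using ef(3) by (auto simp: in_line_def path_to_def)
        next
          case (snoc ys' b)
          then have "b = a" using eq xs' by simp
          then have "awalk (head E f) ys' (tail E a)" "awalk (head E e) xs' (tail E a)"
            using xs ys snoc xs' by (auto simp: awalk_simps)
          then have "Q (length xs' + length ys')" by (auto simp: Q_def)
          then show False using n(2) len xs' snoc by simp
        qed
      qed
    qed
    moreover have "head E (last (e # xs)) = head E (last (f # ys))"
      using last_head[OF xs] last_head[OF ys] by simp
    ultimately have link: "linked (WEdge (last (e # xs)) i) (WGhost (last (f # ys)) j)" for i j
      unfolding linked_edge_ghost by blast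
    have w2: "e \<in> arcs E" "f \<in> arcs E" "2 \<le> w e" "2 \<le> w f" using ef by (auto simp: weighted_edges_def)
    have "normal ((WEdge e 2 # edges xs) @ (ghosts ys @ [WGhost f 2]))"
      unfolding normal_append[of "WEdge e 2 # edges xs"]
      using normal_weighted_edges[OF xs w2(1), of 2] normal_ghosts_weighted[OF ys w2(2), of 2] w2
        last_weighted_edges[of e 2 xs] link by force
    then show ?thesis
      using w2 by (intro exI[of _ e] exI[of _ "edges xs @ ghosts ys @ [WGhost f 2]"]) (auto simp: forbidden_def)
  next
    case 4
    then obtain e v c where e: "e \<in> weighted_edges E w" and v: "v \<in> tree E {head E e}"
      and c: "cycle_based_at E v c" "e \<notin> set c"
      unfolding LPA4_def by blast
    \<comment> \<open>Choose a shortest walk \<open>xs\<close> from the head of \<open>e\<close> to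
      a closed walk \<open>d\<close> avoiding \<open>e\<close>. Then \<open>d\<close> and
      \<open>e # xs\<close> end in different edges: otherwise \<open>e\<close> lies on
      \<open>d\<close>, or rotating \<open>d\<close> permits a shorter \<open>xs\<close>. The word
      is \<open>e_2 xs d xs^* e_2^*\<close>, which turns back after \<open>d\<close>.\<close>
    define Q where "Q n \<longleftrightarrow> (\<exists>xs c v. awalk (head E e) xs v \<and> awalk v c v \<and> c \<noteq> [] \<and> e \<notin> set c \<and> n = length xs)" for n
    have "\<exists>n. Q n" using v c by (auto simp: tree_def path_to_def cycle_based_at_def Q_def)
    then obtain n where n: "Q n" "\<And>m. m < n \<Longrightarrow> \<not> Q m" using exists_least_iff[of Q] by auto
    then obtain xs d v where xs: "awalk (head E e) xs v" and d: "awalk v d v" "d \<noteq> []" "e \<notin> set d" and len: "n = length xs"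
      by (auto simp: Q_def)
    have "last d \<noteq> last (e # xs)"
    proof
      assume eq: "last d = last (e # xs)"
      show False
      proof (cases xs rule: rev_cases)
        case Nil
        then show False using eq d last_in_set[of d] by simp
      next
        case (snoc xs' a)
        obtain d' where d': "d = d' @ [a]" using eq d(2) snoc by (metis append_butlast_last_id last.simps last_snoc snoc_eq_iff_butlast)
        have "awalk (head E e) xs' (tail E a)" "awalk (tail E a) (a # d') (tail E a)" "e \<notin> set (a # d')"
          using xs d snoc d' by (auto simp: awalk_simps)
        then have "Q (length xs')"
          unfolding Q_def by (intro exI[of _ xs'] exI[of _ "a # d'"] exI[of _ "tail E a"]) simp
        then show False using n(2) len snoc by simp
      qed
    qed
    moreover have "head E (last d) = head E (last (e # xs))"
      using last_head[OF xs] awalk_ends_arcs(2)[OF d(1,2)] by metis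
    ultimately have link: "linked (WEdge (last d) i) (WGhost (last (e # xs)) j)" for i j
      unfolding linked_edge_ghost by blast
    have w2: "e \<in> arcs E" "2 \<le> w e" using e by (auto simp: weighted_edges_def)
    have "awalk (head E e) (xs @ d) v" using xs d(1) by (simp add: awalk_appendI)
    then have "normal (WEdge e 2 # edges (xs @ d))" using w2 by (intro normal_weighted_edges) auto
    moreover have "last (WEdge e 2 # edges (xs @ d)) = WEdge (last d) 1" using d(2) by (simp add: last_map)
    ultimately have "normal ((WEdge e 2 # edges (xs @ d)) @ (ghosts xs @ [WGhost e 2]))"
      unfolding normal_append[of "WEdge e 2 # edges (xs @ d)"]
      using normal_ghosts_weighted[OF xs w2(1), of 2] w2 link by force
    then show ?thesis
      using w2 by (intro exI[of _ e] exI[of _ "edges (xs @ d) @ ghosts xs @ [WGhost e 2]"]) (auto simp: forbidden_def)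
  qed
qed

end

theorem reduction_property_condition_LPA:
  fixes E :: "('v, 'e) pre_digraph"
  assumes E: "weighted_graph E w" "row_finite E"
    and red: "reduction_property (weighted_leavitt_path_alg E w :: ('k::field, _) alg)"
  shows "condition_LPA E w"
proof (rule ccontr)
  assume not: "\<not> condition_LPA E w"
  define \<alpha> where "\<alpha> v = (SOME e. e \<in> out_arcs E v \<and> w e = vertex_weight E w v)" for v
  have \<alpha>: "\<alpha> v \<in> out_arcs E v \<and> w (\<alpha> v) = vertex_weight E w v" if v: "v \<in> verts E" "out_arcs E v \<noteq> {}" for v
  proof -
    have "Max (w ` out_arcs E v) \<in> w ` out_arcs E v"
      using v E(2) by (intro Max_in) (auto simp: row_finite_def)
    then have "\<exists>e. e \<in> out_arcs E v \<and> w e = vertex_weight E w v"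
      using v(2) by (force simp: vertex_weight_def)
    then show ?thesis unfolding \<alpha>_def by (rule someI_ex)
  qed
  obtain \<rho> :: "(('v, 'e) wlpa_gen word \<Rightarrow>\<^sub>0 'k) \<Rightarrow> (('v, 'e) wlpa_gen word \<Rightarrow>\<^sub>0 'k) endo" where \<rho>:
    "\<And>a b. \<rho> (a + b) = \<rho> a + \<rho> b" "\<And>a b. \<rho> (a * b) = \<rho> a * \<rho> b" "\<And>a. \<rho> a = 0 \<longleftrightarrow> a \<in> ideal_of (wlpa_rels E w)"
    by (rule quotient_ring[of "wlpa_rels E w"]) blast
  interpret special_edges_quotient E w \<alpha> \<rho>
    by unfold_locales (use E \<alpha> \<rho> in auto)
  obtain e q where "e \<in> arcs E" "2 \<le> w e" "normal (WEdge e 2 # q)" "\<And>x. \<not> forbidden (last (WEdge e 2 # q)) x"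
    using LPA_witness[OF not] by blast
  then show False
    using not_reduction_property_weighted red by (auto simp: weighted_leavitt_path_alg_def)
qed

section \<open>Closed walks and cycles\<close>

lemma (in wf_digraph) awalk_take_drop:
  assumes "awalk u xs v" "i < length xs"
  shows "awalk u (take i xs) (tail G (xs ! i))" "awalk (tail G (xs ! i)) (drop i xs) v"
proof -
  let ?l = "awlast u (take i xs)"
  have "awalk u (take i xs @ drop i xs) v" using assms by simp
  then have *: "awalk u (take i xs) ?l" "awalk ?l (drop i xs) v" unfolding awalk_append_iff by auto
  moreover have "drop i xs = xs ! i # drop (Suc i) xs" using assms by (simp add: Cons_nth_drop_Suc)
  ultimately have "?l = tail G (xs ! i)" by (metis awalk_Cons_iff)
  then show "awalk u (take i xs) (tail G (xs ! i))" "awalk (tail G (xs ! i)) (drop i xs) v"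
    using * by simp_all
qed

text \<open>Cutting out the stretch between two visits to a vertex shortens the walk and keeps its
  base point.\<close>

lemma closed_walk_cycle:
  assumes "wf_digraph G" and walk: "pre_digraph.awalk G y c y" "c \<noteq> []"
  shows "\<exists>c'. cycle_based_at G y c'"
  using walk
proof (induction "length c" arbitrary: c rule: less_induct)
  case less
  interpret wf_digraph G by fact
  show ?case
  proof (cases "\<forall>i < length c. \<forall>j < length c. i \<noteq> j \<longrightarrow> tail G (c ! i) \<noteq> tail G (c ! j)")
    case True
    then show ?thesis using less.prems by (auto simp: cycle_based_at_def)
  next
    case False
    then obtain i j where ij: "i < j" "j < length c" "tail G (c ! i) = tail G (c ! j)"
      by (metis linorder_neq_iff)
    have "awalk y (take i c) (tail G (c ! i))" "awalk (tail G (c ! j)) (drop j c) y"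
      using awalk_take_drop[OF less.prems(1)] ij(1,2) by simp_all
    then have "awalk y (take i c @ drop j c) y"
      unfolding ij(3) by (rule awalk_appendI)
    then show ?thesis using less.hyps[of "take i c @ drop j c"] ij by auto
  qed
qed

section \<open>The boundary path representation\<close>

text \<open>
  A boundary path is an infinite path or a path ending in a sink; it is encoded as the sequence of
  its vertices and outgoing edges, a final sink being repeated with \<open>None\<close> instead of an edge. The
  integer coordinate records the degree.
\<close>

type_synonym ('c, 'd) boundary = "nat \<Rightarrow> 'c \<times> 'd option"

context wf_digraph
begin

definition boundary_path :: "('a, 'b) boundary \<Rightarrow> bool" where
  "boundary_path x \<longleftrightarrow> (\<forall>n. case snd (x n) of
      None \<Rightarrow> fst (x n) \<in> verts G \<and> out_arcs G (fst (x n)) = {} \<and> x (Suc n) = x n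
    | Some e \<Rightarrow> e \<in> arcs G \<and> tail G e = fst (x n) \<and> fst (x (Suc n)) = head G e)"

lemma boundary_path_shift: "boundary_path x \<Longrightarrow> boundary_path (\<lambda>n. x (Suc n))"
  by (simp add: boundary_path_def)

lemma boundary_path_cons:
  assumes "boundary_path x" "e \<in> arcs G" "fst (x 0) = head G e"
  shows "boundary_path (case_nat (tail G e, Some e) x)"
  using assms unfolding boundary_path_def by (auto split: nat.split option.split)

lemma boundary_path_edge:
  assumes "boundary_path x" "snd (x 0) = Some e"
  shows "e \<in> arcs G" "tail G e = fst (x 0)" "fst (x (Suc 0)) = head G e"
  using assms unfolding boundary_path_def by (auto dest!: spec[of _ 0])

lemma boundary_path_edge':
  "boundary_path x \<Longrightarrow> snd (x 0) = Some e \<Longrightarrow> tail G e = fst (x 0) \<and> fst (x (Suc 0)) = head G e"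
  using boundary_path_edge by blast

lemma boundary_path_sink:
  assumes "boundary_path x" "snd (x 0) = None"
  shows "out_arcs G (fst (x 0)) = {}"
  using assms unfolding boundary_path_def by (auto dest!: spec[of _ 0])

text \<open>Follow chosen edges until a sink is reached, if one ever is.\<close>

lemma boundary_path_exists:
  assumes "v \<in> verts G"
  shows "\<exists>x. boundary_path x \<and> fst (x 0) = v"
proof -
  define next_step where "next_step v = (v, if out_arcs G v = {} then None else Some (SOME e. e \<in> out_arcs G v))" for v
  define x where "x = rec_nat (next_step v) (\<lambda>_ p. case snd p of None \<Rightarrow> p | Some e \<Rightarrow> next_step (head G e))"
  have x0: "x 0 = next_step v" and xS: "x (Suc n) = (case snd (x n) of None \<Rightarrow> x n | Some e \<Rightarrow> next_step (head G e))" for n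
    unfolding x_def by simp_all
  have some: "(SOME e. e \<in> out_arcs G v) \<in> out_arcs G v" if "out_arcs G v \<noteq> {}" for v
    by (rule someI_ex[of "\<lambda>e. e \<in> out_arcs G v"]) (use that in blast)
  have inv: "fst (x n) \<in> verts G \<and> x n = next_step (fst (x n))" for n
  proof (induction n)
    case 0
    then show ?case using assms by (simp add: x0 next_step_def)
  next
    case (Suc n)
    show ?case
    proof (cases "snd (x n)")
      case None
      then have "x (Suc n) = x n" by (simp add: xS)
      then show ?thesis using Suc by (simp only:)
    next
      case (Some e)
      have "snd (x n) = snd (next_step (fst (x n)))" using Suc by metis
      then have "e \<in> out_arcs G (fst (x n))"
        using Some some[of "fst (x n)"] by (simp add: next_step_def split: if_splits)
      moreover have "x (Suc n) = next_step (head G e)" using Some by (simp add: xS)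
      ultimately show ?thesis by (simp add: next_step_def)
    qed
  qed
  have "boundary_path x"
    unfolding boundary_path_def
  proof
    fix n
    let ?u = "fst (x n)"
    have u: "?u \<in> verts G" and snd: "snd (x n) = snd (next_step ?u)" using inv[of n] by auto
    show "case snd (x n) of
        None \<Rightarrow> ?u \<in> verts G \<and> out_arcs G ?u = {} \<and> x (Suc n) = x n
      | Some e \<Rightarrow> e \<in> arcs G \<and> tail G e = ?u \<and> fst (x (Suc n)) = head G e"
    proof (cases "out_arcs G ?u = {}")
      case True
      then have "snd (x n) = None" using snd by (simp add: next_step_def)
      then show ?thesis using u True xS[of n] by simp
    next
      case False
      define e where "e = (SOME e. e \<in> out_arcs G ?u)"
      have e: "snd (x n) = Some e" using snd False by (simp add: next_step_def e_def)
      have "e \<in> out_arcs G ?u" unfolding e_def by (rule some[OF False])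
      moreover have "fst (x (Suc n)) = head G e" using xS[of n] e by (simp add: next_step_def)
      ultimately show ?thesis using e by simp
    qed
  qed
  then show ?thesis using x0 by (auto simp: next_step_def)
qed

text \<open>On indicator functions, an edge puts itself in front of a path and raises the degree by
  one; its ghost undoes this. Without the degree, a cycle without exits would act as the identity on
  its infinite repetition and could not be told from its base vertex.\<close>

definition bact :: "('a, 'b) lpa_gen \<Rightarrow> (('a, 'b) boundary \<times> int \<Rightarrow> 'k::field) \<Rightarrow> ('a, 'b) boundary \<times> int \<Rightarrow> 'k" where
  "bact y g = (\<lambda>(x, n). if boundary_path x then
     (case y of
        Vertex v \<Rightarrow> if fst (x 0) = v then g (x, n) else 0
      | Edge e \<Rightarrow> if snd (x 0) = Some e then g (\<lambda>n. x (Suc n), n - 1) else 0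
      | Ghost e \<Rightarrow> if fst (x 0) = head G e \<and> e \<in> arcs G then g (case_nat (tail G e, Some e) x, n + 1) else 0)
     else 0)"

definition bact_op :: "('a, 'b) lpa_gen \<Rightarrow> (('a, 'b) boundary \<times> int \<Rightarrow> 'k::field) endo" where
  "bact_op y = Endo (bact y)"

lemma app_bact_op [simp]: "app (bact_op y) = bact y"
  unfolding bact_op_def
  by (rule Endo_inverse) (auto simp: bact_def fun_eq_iff split: lpa_gen.split)

lemma bact_family:
  assumes "row_finite G"
  shows "lpa_family G (\<lambda>v. bact_op (Vertex v) :: (('a, 'b) boundary \<times> int \<Rightarrow> 'k::field) endo)
    (\<lambda>e. bact_op (Edge e)) (\<lambda>e. bact_op (Ghost e))"
proof
  fix e assume e: "e \<in> arcs G"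
  show "bact_op (Vertex (tail G e)) * bact_op (Edge e) = (bact_op (Edge e) :: (('a, 'b) boundary \<times> int \<Rightarrow> 'k) endo)"
    by (auto intro!: endo_eqI simp: bact_def fun_eq_iff) (metis boundary_path_edge')
  show "bact_op (Edge e) * bact_op (Vertex (head G e)) = (bact_op (Edge e) :: (('a, 'b) boundary \<times> int \<Rightarrow> 'k) endo)"
    by (auto intro!: endo_eqI simp: bact_def fun_eq_iff dest: boundary_path_edge' boundary_path_shift)
  show "bact_op (Vertex (head G e)) * bact_op (Ghost e) = (bact_op (Ghost e) :: (('a, 'b) boundary \<times> int \<Rightarrow> 'k) endo)"
    by (auto intro!: endo_eqI simp: bact_def fun_eq_iff)
  show "bact_op (Ghost e) * bact_op (Vertex (tail G e)) = (bact_op (Ghost e) :: (('a, 'b) boundary \<times> int \<Rightarrow> 'k) endo)"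
    by (auto intro!: endo_eqI simp: bact_def fun_eq_iff dest: boundary_path_cons)
next
  fix u v
  show "bact_op (Vertex u) * bact_op (Vertex v) = (if u = v then bact_op (Vertex u) else 0 :: (('a, 'b) boundary \<times> int \<Rightarrow> 'k) endo)"
    by (auto intro!: endo_eqI simp: bact_def fun_eq_iff)
next
  fix v e f assume "e \<in> out_arcs G v" "f \<in> out_arcs G v"
  then show "bact_op (Ghost e) * bact_op (Edge f) = (if e = f then bact_op (Vertex (head G e)) else 0 :: (('a, 'b) boundary \<times> int \<Rightarrow> 'k) endo)"
    by (auto intro!: endo_eqI simp: bact_def fun_eq_iff dest: boundary_path_cons)
next
  fix v assume v: "v \<in> verts G" "out_arcs G v \<noteq> {}"
  have fin: "finite (out_arcs G v)" using assms v by (simp add: row_finite_def)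
  show "(\<Sum>e\<in>out_arcs G v. bact_op (Edge e) * bact_op (Ghost e)) = (bact_op (Vertex v) :: (('a, 'b) boundary \<times> int \<Rightarrow> 'k) endo)"
  proof (rule endo_eqI, rule ext)
    fix g :: "('a, 'b) boundary \<times> int \<Rightarrow> 'k" and p :: "('a, 'b) boundary \<times> int"
    obtain x n where p: "p = (x, n)" by (cases p)
    have "app (\<Sum>e\<in>out_arcs G v. bact_op (Edge e) * bact_op (Ghost e)) g p =
      (\<Sum>e\<in>out_arcs G v. bact (Edge e) (bact (Ghost e) g) (x, n))"
      by (simp add: app_sum fun_sum_apply p)
    also have "\<dots> = bact (Vertex v) g (x, n)"
    proof (cases "boundary_path x")
      case True
      show ?thesis
      proof (cases "snd (x 0)")
        case None
        then show ?thesis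
          using boundary_path_sink[OF True] v by (auto simp: bact_def)
      next
        case (Some e0)
        have x0: "case_nat (tail G e0, Some e0) (\<lambda>n. x (Suc n)) = x"
          using boundary_path_edge[OF True Some] Some by (auto simp: fun_eq_iff prod_eq_iff split: nat.split)
        have "bact (Edge e) (bact (Ghost e) g) (x, n) = (if e = e0 then g (x, n) else 0)" for e
          using Some True boundary_path_edge[OF True Some] boundary_path_shift[OF True] x0 by (auto simp: bact_def)
        then show ?thesis
          using fin boundary_path_edge[OF True Some] True by (auto simp: bact_def sum.delta)
      qed
    qed (simp add: bact_def)
    finally show "app (\<Sum>e\<in>out_arcs G v. bact_op (Edge e) * bact_op (Ghost e)) g p = app (bact_op (Vertex v)) g p"
      by (simp add: p)
  qed
qed

text \<open>The polynomial below acts on functions vanishing in negative degrees by a unitriangular operator.\<close>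

lemma unipotent_square_notin_ideal:
  fixes \<kappa> :: "'b list \<Rightarrow> 'k::field"
  assumes G: "row_finite G" and v: "v \<in> verts G" and D: "[] \<notin> D"
    and U: "U = gen (Vertex v) + (\<Sum>\<delta>\<in>D. const (\<kappa> \<delta>) * (mon (map Edge \<delta>) * gen (Vertex v)))"
  shows "U * U \<notin> ideal_of (lpa_rels G)"
proof
  assume ideal: "U * U \<in> ideal_of (lpa_rels G)"
  define c where "c k = Endo (\<lambda>(g :: ('a, 'b) boundary \<times> int \<Rightarrow> 'k) p. k * g p)" for k
  have app_c: "app (c k) g = (\<lambda>p. k * g p)" for k g
    unfolding c_def by (subst Endo_inverse) (auto simp: distrib_left)
  have bact_scale: "bact y (\<lambda>p. k * g p) = (\<lambda>p. k * bact y g p)" for y k and g :: "('a, 'b) boundary \<times> int \<Rightarrow> 'k"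
    by (auto simp: bact_def fun_eq_iff split: lpa_gen.split)
  interpret free_eval c "bact_op :: _ \<Rightarrow> (('a, 'b) boundary \<times> int \<Rightarrow> 'k) endo"
    by unfold_locales (auto intro!: endo_eqI simp: app_c bact_scale distrib_right mult.assoc)
  have hom: "nonunital_ring_hom ev"
    by unfold_locales (simp_all add: ev_add ev_mult)
  have "lpa_family G (\<lambda>v. ev (gen (Vertex v))) (\<lambda>e. ev (gen (Edge e))) (\<lambda>e. ev (gen (Ghost e)))"
    unfolding ev_gen by (rule bact_family[OF G])
  then have "ev (U * U) = 0" using lpa_family_iff[OF hom] ev_ideal[OF ideal] by blast
  then have zero: "app (ev U) (app (ev U) g) p = 0" for g p
    by (simp add: ev_mult flip: app_times_endo)
  obtain x where x: "boundary_path x" "fst (x 0) = v" using boundary_path_exists[OF v] by blast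
  define neg where "neg g \<longleftrightarrow> (\<forall>y m. m < 0 \<longrightarrow> g (y, m) = (0::'k))" for g :: "('a, 'b) boundary \<times> int \<Rightarrow> 'k"
  have path: "app (prod_list (map bact_op (map Edge \<delta>))) g (y, m) = 0"
    if "\<And>y. g (y, m - int (length \<delta>)) = 0" for g :: "('a, 'b) boundary \<times> int \<Rightarrow> 'k" and \<delta> y m
    using that
  proof (induction \<delta> arbitrary: y m)
    case (Cons e \<delta>)
    have "g (y, (m - 1) - int (length \<delta>)) = 0" for y
      using Cons.prems[of y] by (simp add: algebra_simps)
    from Cons.IH[OF this] show ?case by (simp add: bact_def)
  qed simp
  \<comment> \<open>In degrees \<open>m \<le> 0\<close> a nonempty path reads the function in
    negative degrees, where it vanishes; only the vertex summand of \<open>U\<close>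
    survives.\<close>
  have eval: "app (ev U) g (y, m) = bact (Vertex v) g (y, m)" if g: "neg g" and m: "m \<le> 0" for g y m
  proof -
    have "app (prod_list (map bact_op (map Edge \<delta>))) (bact (Vertex v) g) (y, m) = 0" if "\<delta> \<in> D" for \<delta>
    proof (rule path)
      have "m - int (length \<delta>) < 0" using that D m by (cases \<delta>) auto
      then show "bact (Vertex v) g (y, m - int (length \<delta>)) = 0" for y
        using g by (auto simp: bact_def neg_def)
    qed
    then show ?thesis
      unfolding U by (simp add: ev_add ev_sum ev_mult ev_const ev_mon app_sum app_c fun_sum_apply)
  qed
  define g where "g p = (if snd p = 0 then 1 else 0 :: 'k)" for p :: "('a, 'b) boundary \<times> int"
  have "neg g" by (simp add: neg_def g_def)
  moreover have "neg (app (ev U) g)"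
    using eval[OF \<open>neg g\<close>] \<open>neg g\<close> by (auto simp: neg_def bact_def)
  ultimately have "app (ev U) (app (ev U) g) (x, 0) = 1"
    using x by (simp add: eval bact_def g_def)
  then show False using zero by simp
qed

end

section \<open>The reduction theorem for Leavitt path algebras\<close>

locale lpa_quotient = wf_digraph F + nonunital_ring_hom \<rho>
  for F :: "('c, 'd) pre_digraph"
    and \<rho> :: "(('c, 'd) lpa_gen word \<Rightarrow>\<^sub>0 'k::field) \<Rightarrow> 'r::ring" +
  assumes row_finite: "row_finite F"
    and kernel: "\<rho> a = 0 \<longleftrightarrow> a \<in> ideal_of (lpa_rels F)"
begin

abbreviation "V v \<equiv> \<rho> (gen (Vertex v))"
abbreviation "Ed e \<equiv> \<rho> (gen (Edge e))"
abbreviation "Gh e \<equiv> \<rho> (gen (Ghost e))"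
abbreviation "sc k \<equiv> \<rho> (const k)"
abbreviation "X \<equiv> lpa_gens F"

sublocale fam: lpa_family F V Ed Gh
  using lpa_family_iff[OF nonunital_ring_hom_axioms, of F] by (simp add: kernel gen_ideal.rel)

lemmas \<rho>_add = add

lemma finite_out_arcs: "v \<in> verts F \<Longrightarrow> finite (out_arcs F v)"
  using row_finite by (simp add: row_finite_def)

lemma sc_central: "sc k * \<rho> a = \<rho> a * sc k"
  by (simp only: const_central flip: mult)

lemma sc_left_commute: "\<rho> a * (sc k * x) = sc k * (\<rho> a * x)"
  by (metis sc_central mult.assoc)

lemma sc_add: "sc (k + l) = sc k + sc l"
  by (simp add: single_add add)

lemma sc_sc: "sc k * sc l = sc (k * l)"
  by (simp only: const_mult flip: mult)

lemma sc_one: "sc 1 * \<rho> a = \<rho> a"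
  by (simp flip: mult)

text \<open>The final vertex makes the empty path stand for \<open>w\<close> instead of the unit,
  which does not belong to \<open>free_alg X\<close>.\<close>

definition pathp :: "'d list \<Rightarrow> 'c \<Rightarrow> ('c, 'd) lpa_gen word \<Rightarrow>\<^sub>0 'k" where
  "pathp xs w = mon (map Edge xs) * gen (Vertex w)"

definition ghostp :: "'d list \<Rightarrow> 'c \<Rightarrow> ('c, 'd) lpa_gen word \<Rightarrow>\<^sub>0 'k" where
  "ghostp xs w = gen (Vertex w) * mon (rev (map Ghost xs))"

abbreviation "P xs w \<equiv> \<rho> (pathp xs w)"
abbreviation "Q xs w \<equiv> \<rho> (ghostp xs w)"

lemma P_Nil [simp]: "P [] w = V w" and Q_Nil [simp]: "Q [] w = V w"
  by (simp_all add: pathp_def ghostp_def)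

lemma P_Cons: "P (e # xs) w = Ed e * P xs w"
  by (simp add: pathp_def mon_Cons mult.assoc mult)

lemma Q_Cons: "Q (e # xs) w = Q xs w * Gh e"
proof -
  have "ghostp (e # xs) w = ghostp xs w * gen (Ghost e)"
    by (simp add: ghostp_def gen_def mult_single mult.assoc flip: mult.assoc)
  then show ?thesis by (simp only: mult)
qed

lemma pathp_free_alg: "awalk u xs w \<Longrightarrow> pathp xs w \<in> free_alg X"
  and ghostp_free_alg: "awalk u xs w \<Longrightarrow> ghostp xs w \<in> free_alg X"
proof -
  assume walk: "awalk u xs w"
  then have "w \<in> verts F" "set xs \<subseteq> arcs F" by auto
  then show "pathp xs w \<in> free_alg X" "ghostp xs w \<in> free_alg X"
    by (auto simp: pathp_def ghostp_def gen_def mult_single free_alg_mon lpa_gens_def)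
qed

lemma V_V: "u \<in> verts F \<Longrightarrow> v \<in> verts F \<Longrightarrow> V u * V v = (if u = v then V u else 0)"
  by (rule fam.vx_vx)

lemma V_idem [simp]: "u \<in> verts F \<Longrightarrow> V u * V u = V u"
  by (simp add: fam.vx_vx)

lemma V_P: "awalk u xs w \<Longrightarrow> V u * P xs w = P xs w"
proof (cases xs)
  case Nil
  assume "awalk u xs w"
  then show ?thesis using Nil by (auto simp: awalk_Nil_iff)
next
  case (Cons e ys)
  assume "awalk u xs w"
  then show ?thesis using Cons fam.vx_ed by (simp add: awalk_Cons_iff P_Cons flip: mult.assoc)
qed

lemma V_P_zero: "awalk u xs w \<Longrightarrow> v \<in> verts F \<Longrightarrow> v \<noteq> u \<Longrightarrow> V v * P xs w = 0"
proof -
  assume *: "awalk u xs w" "v \<in> verts F" "v \<noteq> u"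
  then have "u \<in> verts F" by auto
  then have "V v * V u = 0" using * by (simp add: V_V)
  then have "V v * (V u * P xs w) = 0" by (simp flip: mult.assoc)
  then show ?thesis by (simp add: V_P[OF *(1)])
qed

lemma P_V: "w \<in> verts F \<Longrightarrow> P xs w * V w = P xs w"
  by (induction xs) (simp_all add: P_Cons mult.assoc)

lemma P_append: "awalk w ys w' \<Longrightarrow> P xs w * P ys w' = P (xs @ ys) w'"
  by (induction xs) (simp_all add: P_Cons mult.assoc V_P)

lemma Gh_Ed: "e \<in> arcs F \<Longrightarrow> f \<in> arcs F \<Longrightarrow> Gh e * Ed f = (if e = f then V (head F e) else 0)"
proof (cases "tail F e = tail F f")
  case True
  assume "e \<in> arcs F" "f \<in> arcs F"
  then show ?thesis using fam.gh_ed[of "tail F e" e f] True by simp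
next
  case False
  assume ef: "e \<in> arcs F" "f \<in> arcs F"
  have "Gh e * Ed f = Gh e * (V (tail F e) * V (tail F f)) * Ed f"
    using fam.gh_vx[OF ef(1)] fam.vx_ed[OF ef(2)] by (metis mult.assoc)
  then show ?thesis using False ef by (auto simp: V_V)
qed

text \<open>Equal first edges cancel by relation (iii) and different ones give zero, so
  \<open>xs\<close> has to be a prefix of \<open>ys\<close>.\<close>

lemma Q_P:
  assumes "awalk u xs w" "awalk u' ys w'" "length xs \<le> length ys"
  shows "Q xs w * P ys w' = (if take (length xs) ys = xs \<and> awalk w (drop (length xs) ys) w' then P (drop (length xs) ys) w' else 0)"
  using assms
proof (induction xs arbitrary: u u' ys)
  case Nil
  then have w: "w \<in> verts F" by auto
  show ?case
  proof (cases "u' = w")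
    case True
    then show ?thesis using Nil V_P by auto
  next
    case False
    then have "\<not> awalk w ys w'"
      using Nil.prems(2) by (cases ys) (auto simp: awalk_simps)
    then show ?thesis using V_P_zero[OF Nil.prems(2) w] False by simp
  qed
next
  case (Cons e xs)
  then obtain f zs where ys: "ys = f # zs" by (cases ys) auto
  have e: "e \<in> arcs F" "awalk (head F e) xs w" and f: "f \<in> arcs F" "awalk (head F f) zs w'"
    using Cons.prems ys by (auto simp: awalk_Cons_iff)
  have *: "Q (e # xs) w * P ys w' = Q xs w * ((Gh e * Ed f) * P zs w')"
    by (simp add: Q_Cons P_Cons ys mult.assoc)
  show ?case
  proof (cases "e = f")
    case True
    then have "Q (e # xs) w * P ys w' = Q xs w * P zs w'"
      using * V_P[OF f(2)] e f by (simp add: Gh_Ed)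
    then show ?thesis
      using Cons.IH[OF e(2) f(2)] Cons.prems(3) ys True by simp
  next
    case False
    then show ?thesis using * e f ys by (simp add: Gh_Ed)
  qed
qed

lemma Q_P_same: "awalk u xs w \<Longrightarrow> Q xs w * P xs w = V w"
  using Q_P[of u xs w u xs w] by (auto simp: awalk_Nil_iff)

subsection \<open>Multiplying into the span of real paths\<close>

text \<open>The number \<open>m\<close> counts the letters that can be multiplied from the left
  without leaving the combinations of real paths: each ghost letter takes away at most one edge. At
  a sink there is no bound, as every ghost letter kills the empty path there.\<close>

inductive_set real_span :: "nat \<Rightarrow> 'c \<Rightarrow> 'r set" for m w where
  zero: "0 \<in> real_span m w"
| add: "awalk u xs w \<Longrightarrow> m \<le> length xs \<or> out_arcs F w = {} \<Longrightarrow> r \<in> real_span m w \<Longrightarrow> sc k * P xs w + r \<in> real_span m w"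

lemma real_span_add: "r \<in> real_span m w \<Longrightarrow> s \<in> real_span m w \<Longrightarrow> r + s \<in> real_span m w"
  by (induction rule: real_span.induct) (auto simp: add.assoc intro: real_span.intros)

lemma real_span_sc: "r \<in> real_span m w \<Longrightarrow> sc k * r \<in> real_span m w"
  by (induction rule: real_span.induct)
    (auto simp: distrib_left sc_sc intro: real_span.intros simp flip: mult.assoc)

lemma real_span_P: "awalk u xs w \<Longrightarrow> m \<le> length xs \<or> out_arcs F w = {} \<Longrightarrow> P xs w \<in> real_span m w"
  using real_span.add[of u xs w m 0 1] by (simp add: sc_one real_span.zero del: single_one)

lemma real_span_mono: "r \<in> real_span n w \<Longrightarrow> m \<le> n \<Longrightarrow> r \<in> real_span m w"
  by (induction rule: real_span.induct) (auto intro: real_span.intros)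

lemma gen_real_span:
  assumes x: "x \<in> X" and r: "r \<in> real_span (Suc m) w"
  shows "\<rho> (gen x) * r \<in> real_span m w"
  using r
proof induction
  case zero
  then show ?case by (simp add: real_span.zero)
next
  case (add u xs r k)
  have "\<rho> (gen x) * P xs w \<in> real_span m w"
  proof (cases x)
    case (Vertex v)
    then have v: "v \<in> verts F" using x by (auto simp: lpa_gens_def)
    have "P xs w \<in> real_span m w" by (rule real_span_P[OF add.hyps(1)]) (use add.hyps(2) in auto)
    then show ?thesis
      using V_P[OF add.hyps(1)] V_P_zero[OF add.hyps(1) v] Vertex by (cases "v = u") (auto intro: real_span.zero)
  next
    case (Edge e)
    then have e: "e \<in> arcs F" using x by (auto simp: lpa_gens_def)
    show ?thesis
    proof (cases "head F e = u")
      case True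
      then have "awalk (tail F e) (e # xs) w" using add.hyps(1) e by (simp add: awalk_Cons_iff)
      from real_span_P[OF this, of m] show ?thesis using add.hyps(2) Edge by (auto simp: P_Cons)
    next
      case False
      have "Ed e * P xs w = Ed e * (V (head F e) * P xs w)"
        using fam.ed_vx[OF e] by (simp flip: mult.assoc)
      then show ?thesis using V_P_zero[OF add.hyps(1), of "head F e"] False e Edge by (simp add: real_span.zero)
    qed
  next
    case (Ghost e)
    then have e: "e \<in> arcs F" using x by (auto simp: lpa_gens_def)
    show ?thesis
    proof (cases xs)
      case Nil
      then have w: "w = u" "w \<in> verts F" "out_arcs F w = {}" using add.hyps by (auto simp: awalk_Nil_iff)
      then have "tail F e \<noteq> w" using e by auto
      have "Gh e * V w = Gh e * (V (tail F e) * V w)"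
        using fam.gh_vx[OF e] by (simp flip: mult.assoc)
      then show ?thesis using \<open>tail F e \<noteq> w\<close> w e Ghost Nil by (simp add: V_V real_span.zero)
    next
      case (Cons f ys)
      then have f: "f \<in> arcs F" "awalk (head F f) ys w" using add.hyps(1) by (auto simp: awalk_Cons_iff)
      have "Gh e * P xs w = (Gh e * Ed f) * P ys w" by (simp add: Cons P_Cons mult.assoc)
      also have "\<dots> = (if e = f then P ys w else 0)" using V_P[OF f(2)] e f by (simp add: Gh_Ed)
      finally show ?thesis
        using real_span_P[OF f(2), of m] add.hyps(2) Cons Ghost by (auto intro: real_span.zero)
    qed
  qed
  then show ?case
    using add.IH by (auto simp: distrib_left sc_left_commute intro: real_span_add real_span_sc)
qed

lemma mon_real_span: "set xs \<subseteq> X \<Longrightarrow> xs \<noteq> [] \<Longrightarrow> r \<in> real_span (length xs + m) w \<Longrightarrow> \<rho> (mon xs) * r \<in> real_span m w"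
proof (induction xs arbitrary: m)
  case (Cons x xs)
  show ?case
  proof (cases "xs = []")
    case True
    then show ?thesis using Cons gen_real_span[of x r m w] by (simp add: mon_Cons)
  next
    case False
    then have "\<rho> (mon xs) * r \<in> real_span (Suc m) w" using Cons by simp
    then show ?thesis using gen_real_span[of x _ m w] Cons.prems by (simp add: mon_Cons mult mult.assoc)
  qed
qed simp

lemma free_alg_real_span:
  assumes "a \<in> free_alg X"
  shows "\<exists>N. \<forall>m r w. r \<in> real_span (N + m) w \<longrightarrow> \<rho> a * r \<in> real_span m w"
  using assms
proof (induction rule: free_alg_induct)
  case (single xs k)
  have "\<rho> (const k * mon xs) * r \<in> real_span m w" if "r \<in> real_span (length xs + m) w" for m r w
    using mon_real_span[OF single(2,1) that] by (simp add: mult mult.assoc real_span_sc)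
  then show ?case by blast
next
  case (add p q)
  then obtain N M where NM: "\<And>m r w. r \<in> real_span (N + m) w \<Longrightarrow> \<rho> p * r \<in> real_span m w"
    "\<And>m r w. r \<in> real_span (M + m) w \<Longrightarrow> \<rho> q * r \<in> real_span m w" by blast
  have "\<rho> (p + q) * r \<in> real_span m w" if "r \<in> real_span (N + M + m) w" for m r w
  proof -
    have "r \<in> real_span (N + m) w" "r \<in> real_span (M + m) w" using real_span_mono[OF that] by simp_all
    then have "\<rho> p * r \<in> real_span m w" "\<rho> q * r \<in> real_span m w" using NM by blast+
    then show ?thesis by (simp add: \<rho>_add distrib_right real_span_add)
  qed
  then show ?case by blast
qed (simp add: real_span.zero)

text \<open>There need be no unit, but finitely many vertices sum to a right unit for
  \<open>a\<close>. Admitting all larger finite sets \<open>W'\<close> is what makes the claim pass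
  to sums of elements.\<close>

lemma right_unit:
  assumes "a \<in> free_alg X"
  shows "\<exists>W. finite W \<and> W \<subseteq> verts F \<and> (\<forall>W'. finite W' \<longrightarrow> W' \<subseteq> verts F \<longrightarrow> W \<subseteq> W' \<longrightarrow> \<rho> a * (\<Sum>v\<in>W'. V v) = \<rho> a)"
  using assms
proof (induction rule: free_alg_induct)
  case zero
  then show ?case by (intro exI[of _ "{}"]) simp
next
  case (single xs k)
  let ?x = "last xs"
  have x: "?x \<in> X" using single by (meson last_in_set subsetD)
  have "\<exists>v\<in>verts F. \<rho> (gen y) * V v = \<rho> (gen y)" if y: "y \<in> X" for y
  proof (cases y)
    case (Vertex v)
    then show ?thesis using y by (intro bexI[of _ v]) (auto simp: lpa_gens_def)
  next
    case (Edge e)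
    then show ?thesis using y by (intro bexI[of _ "head F e"]) (auto simp: lpa_gens_def fam.ed_vx)
  next
    case (Ghost e)
    then show ?thesis using y by (intro bexI[of _ "tail F e"]) (auto simp: lpa_gens_def fam.gh_vx)
  qed
  from this[OF x] obtain v where v: "v \<in> verts F" "\<rho> (gen ?x) * V v = \<rho> (gen ?x)" by blast
  have xs: "mon xs = mon (butlast xs) * gen ?x"
    using single by (simp add: gen_def mult_single)
  show ?case
  proof (intro exI[of _ "{v}"] conjI allI impI)
    fix W' assume W': "finite W'" "W' \<subseteq> verts F" "{v} \<subseteq> W'"
    have "\<rho> (gen ?x) * (\<Sum>u\<in>W'. V u) = (\<Sum>u\<in>W'. \<rho> (gen ?x) * (V v * V u))"
      using v(2) by (simp add: sum_distrib_left flip: mult.assoc)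
    also have "\<dots> = (\<Sum>u\<in>W'. if v = u then \<rho> (gen ?x) else 0)"
      using W' v by (intro sum.cong refl) (auto simp: V_V)
    also have "\<dots> = \<rho> (gen ?x)" using W' by (simp add: sum.delta)
    finally have *: "\<rho> (gen ?x) * (\<Sum>u\<in>W'. V u) = \<rho> (gen ?x)" .
    show "\<rho> (const k * mon xs) * (\<Sum>u\<in>W'. V u) = \<rho> (const k * mon xs)"
      unfolding xs by (simp only: mult mult.assoc *)
  qed (use v in auto)
next
  case (add p q)
  then obtain W1 where W1: "finite W1" "W1 \<subseteq> verts F"
    "\<And>W'. finite W' \<Longrightarrow> W' \<subseteq> verts F \<Longrightarrow> W1 \<subseteq> W' \<Longrightarrow> \<rho> p * (\<Sum>v\<in>W'. V v) = \<rho> p" by blast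
  from add obtain W2 where W2: "finite W2" "W2 \<subseteq> verts F"
    "\<And>W'. finite W' \<Longrightarrow> W' \<subseteq> verts F \<Longrightarrow> W2 \<subseteq> W' \<Longrightarrow> \<rho> q * (\<Sum>v\<in>W'. V v) = \<rho> q" by blast
  show ?case
  proof (intro exI[of _ "W1 \<union> W2"] conjI allI impI)
    fix W' assume "finite W'" "W' \<subseteq> verts F" "W1 \<union> W2 \<subseteq> W'"
    then show "\<rho> (p + q) * (\<Sum>v\<in>W'. V v) = \<rho> (p + q)"
      using W1(3)[of W'] W2(3)[of W'] by (simp add: \<rho>_add distrib_right)
  qed (use W1 W2 in auto)
qed

text \<open>Unless \<open>w\<close> is a sink, relation (iv) at \<open>w\<close> expands
  \<open>P xs w\<close> into terms \<open>P xs w * Ed e * Gh e\<close>, and left multiplication by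
  \<open>a\<close> cannot kill all of them.\<close>

lemma extend_path:
  assumes "a \<in> free_alg X" "\<rho> a \<noteq> 0"
  shows "\<exists>u xs w. awalk u xs w \<and> (N \<le> length xs \<or> out_arcs F w = {}) \<and> \<rho> a * P xs w \<noteq> 0"
proof (induction N)
  case 0
  obtain W where "W \<subseteq> verts F" "\<rho> a * (\<Sum>v\<in>W. V v) = \<rho> a" using right_unit[OF assms(1)] by blast
  then have "(\<Sum>v\<in>W. \<rho> a * V v) \<noteq> 0" using assms(2) by (simp add: sum_distrib_left)
  then obtain v where "v \<in> W" "\<rho> a * V v \<noteq> 0" by (rule sum.not_neutral_contains_not_neutral)
  then show ?case
    using \<open>W \<subseteq> verts F\<close> by (intro exI[of _ v] exI[of _ "[]"]) (auto simp: awalk_Nil_iff)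
next
  case (Suc N)
  then obtain u xs w where xs: "awalk u xs w" "N \<le> length xs \<or> out_arcs F w = {}" "\<rho> a * P xs w \<noteq> 0" by blast
  show ?case
  proof (cases "out_arcs F w = {}")
    case True
    then show ?thesis using xs by blast
  next
    case False
    have w: "w \<in> verts F" using xs(1) by auto
    have "\<rho> a * P xs w = \<rho> a * (P xs w * V w)" by (simp add: P_V w)
    also have "\<dots> = (\<Sum>e\<in>out_arcs F w. \<rho> a * (P xs w * (Ed e * Gh e)))"
      using fam.ed_gh[OF w False] by (simp flip: sum_distrib_left)
    finally have "(\<Sum>e\<in>out_arcs F w. \<rho> a * (P xs w * (Ed e * Gh e))) \<noteq> 0" using xs(3) by simp
    then obtain e where e: "e \<in> out_arcs F w" "\<rho> a * (P xs w * (Ed e * Gh e)) \<noteq> 0"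
      by (rule sum.not_neutral_contains_not_neutral)
    then have arc: "e \<in> arcs F" "tail F e = w" by auto
    then have "awalk w [e] (head F e)" by (auto simp: awalk_simps)
    then have walk: "awalk u (xs @ [e]) (head F e)" and P: "P (xs @ [e]) (head F e) = P xs w * P [e] (head F e)"
      using xs(1) P_append by (auto simp: awalk_appendI)
    have Pe: "P [e] (head F e) * Gh e = Ed e * Gh e"
      using fam.vx_gh[OF arc(1)] by (simp add: P_Cons mult.assoc)
    have "\<rho> a * P (xs @ [e]) (head F e) * Gh e = \<rho> a * (P xs w * (Ed e * Gh e))"
      by (simp only: P Pe mult.assoc)
    then have "\<rho> a * P (xs @ [e]) (head F e) \<noteq> 0"
      using e(2) by auto
    then show ?thesis using walk xs(2) False by (metis Suc_le_mono length_append_singleton)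
  qed
qed

lemma real_span_expand:
  assumes "r \<in> real_span m w"
  shows "\<exists>B \<kappa>. finite B \<and> (\<forall>\<beta>\<in>B. (\<exists>u. awalk u \<beta> w) \<and> \<kappa> \<beta> \<noteq> 0) \<and> r = (\<Sum>\<beta>\<in>B. sc (\<kappa> \<beta>) * P \<beta> w)"
proof -
  have "\<exists>B \<kappa>. finite B \<and> (\<forall>\<beta>\<in>B. \<exists>u. awalk u \<beta> w) \<and> r = (\<Sum>\<beta>\<in>B. sc (\<kappa> \<beta>) * P \<beta> w)"
    using assms
  proof induction
    case zero
    show ?case by (intro exI[of _ "{}"]) simp
  next
    case (add u xs r k)
    then obtain B \<kappa> where B: "finite B" "\<forall>\<beta>\<in>B. \<exists>u. awalk u \<beta> w" "r = (\<Sum>\<beta>\<in>B. sc (\<kappa> \<beta>) * P \<beta> w)" by blast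
    let ?\<kappa> = "\<kappa>(xs := k + (if xs \<in> B then \<kappa> xs else 0))"
    have eq: "(\<Sum>\<beta>\<in>B - {xs}. sc (?\<kappa> \<beta>) * P \<beta> w) = (\<Sum>\<beta>\<in>B - {xs}. sc (\<kappa> \<beta>) * P \<beta> w)"
      by (intro sum.cong) auto
    have "(\<Sum>\<beta>\<in>insert xs B. sc (?\<kappa> \<beta>) * P \<beta> w) = sc (?\<kappa> xs) * P xs w + (\<Sum>\<beta>\<in>B - {xs}. sc (\<kappa> \<beta>) * P \<beta> w)"
      unfolding eq[symmetric] using B(1) by (rule sum.insert_remove)
    also have "\<dots> = sc k * P xs w + r"
      using B by (cases "xs \<in> B") (auto simp: sc_add distrib_right sum.remove[of B xs] add.assoc)
    finally show ?case
      using B add.hyps(1) by (intro exI[of _ "insert xs B"] exI[of _ ?\<kappa>]) auto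
  qed
  then obtain B \<kappa> where B: "finite B" "\<forall>\<beta>\<in>B. \<exists>u. awalk u \<beta> w" "r = (\<Sum>\<beta>\<in>B. sc (\<kappa> \<beta>) * P \<beta> w)" by blast
  have "r = (\<Sum>\<beta>\<in>{\<beta>\<in>B. \<kappa> \<beta> \<noteq> 0}. sc (\<kappa> \<beta>) * P \<beta> w)"
    unfolding B(3) using B(1) by (intro sum.mono_neutral_right) auto
  then show ?thesis using B by (intro exI[of _ "{\<beta>\<in>B. \<kappa> \<beta> \<noteq> 0}"] exI[of _ \<kappa>]) auto
qed

definition unipotent :: "'c \<Rightarrow> 'd list set \<Rightarrow> ('d list \<Rightarrow> 'k) \<Rightarrow> ('c, 'd) lpa_gen word \<Rightarrow>\<^sub>0 'k" where
  "unipotent w D \<kappa> = gen (Vertex w) + (\<Sum>\<delta>\<in>D. const (\<kappa> \<delta>) * pathp \<delta> w)"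

text \<open>A long path on the right absorbs the ghost letters of \<open>a\<close> and leaves a
  nonzero combination of paths to \<open>w\<close>. The ghost of a shortest path
  \<open>\<beta>\<close> in it, multiplied from the left, turns \<open>\<beta>\<close> into
  \<open>w\<close> and each other path into zero or a nonempty closed path at
  \<open>w\<close>.\<close>

lemma reduce_to_unipotent:
  assumes a: "a \<in> free_alg X" "\<rho> a \<noteq> 0"
  shows "\<exists>b\<in>free_alg X. \<exists>c\<in>free_alg X. \<exists>w\<in>verts F. \<exists>D \<kappa>. finite D \<and> (\<forall>\<delta>\<in>D. \<delta> \<noteq> [] \<and> awalk w \<delta> w) \<and>
    \<rho> (b * a * c) = \<rho> (unipotent w D \<kappa>)"
proof -
  obtain N where N: "\<And>m r w. r \<in> real_span (N + m) w \<Longrightarrow> \<rho> a * r \<in> real_span m w"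
    using free_alg_real_span[OF a(1)] by blast
  obtain u xs w where xs: "awalk u xs w" "N \<le> length xs \<or> out_arcs F w = {}" "\<rho> a * P xs w \<noteq> 0"
    using extend_path[OF a, of N] by blast
  have "P xs w \<in> real_span (N + 0) w" using xs(1,2) by (intro real_span_P) auto
  then have "\<rho> a * P xs w \<in> real_span 0 w" by (rule N)
  from real_span_expand[OF this] obtain B \<kappa> where B': "finite B \<and> (\<forall>\<beta>\<in>B. (\<exists>u. awalk u \<beta> w) \<and> \<kappa> \<beta> \<noteq> 0) \<and>
    \<rho> a * P xs w = (\<Sum>\<beta>\<in>B. sc (\<kappa> \<beta>) * P \<beta> w)" by (elim exE)
  then have B: "finite B" "\<And>\<beta>. \<beta> \<in> B \<Longrightarrow> (\<exists>u. awalk u \<beta> w) \<and> \<kappa> \<beta> \<noteq> 0"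
    "\<rho> a * P xs w = (\<Sum>\<beta>\<in>B. sc (\<kappa> \<beta>) * P \<beta> w)" by simp_all
  have "B \<noteq> {}" using B(3) xs(3) by auto
  then obtain \<beta>0 where "\<beta>0 \<in> B" by blast
  then obtain \<beta> where \<beta>: "\<beta> \<in> B" "\<And>\<gamma>. \<gamma> \<in> B \<Longrightarrow> length \<beta> \<le> length \<gamma>"
    using ex_has_least_nat[of "\<lambda>\<beta>. \<beta> \<in> B" \<beta>0 length] by auto
  then obtain v where v: "awalk v \<beta> w" using B(2) by blast
  have w: "w \<in> verts F" using v by auto
  define D where "D = {\<delta>. \<delta> \<noteq> [] \<and> \<beta> @ \<delta> \<in> B \<and> awalk w \<delta> w}"
  have finD: "finite D"
  proof (rule finite_subset)
    show "D \<subseteq> drop (length \<beta>) ` B" by (force simp: D_def)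
  qed (use B(1) in simp)
  have "Q \<beta> w * (\<rho> a * P xs w) = (\<Sum>\<gamma>\<in>B. sc (\<kappa> \<gamma>) * (Q \<beta> w * P \<gamma> w))"
    unfolding B(3) by (simp add: sum_distrib_left sc_left_commute)
  also have "\<dots> = (\<Sum>\<gamma>\<in>B. if \<exists>\<delta>. \<gamma> = \<beta> @ \<delta> \<and> awalk w \<delta> w then sc (\<kappa> \<gamma>) * P (drop (length \<beta>) \<gamma>) w else 0)"
  proof (intro sum.cong refl)
    fix \<gamma> assume \<gamma>: "\<gamma> \<in> B"
    then obtain u' where "awalk u' \<gamma> w" using B(2) by blast
    moreover have "(\<exists>\<delta>. \<gamma> = \<beta> @ \<delta> \<and> awalk w \<delta> w) \<longleftrightarrow> take (length \<beta>) \<gamma> = \<beta> \<and> awalk w (drop (length \<beta>) \<gamma>) w"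
      by (metis append_eq_conv_conj)
    ultimately show "sc (\<kappa> \<gamma>) * (Q \<beta> w * P \<gamma> w) = (if \<exists>\<delta>. \<gamma> = \<beta> @ \<delta> \<and> awalk w \<delta> w then sc (\<kappa> \<gamma>) * P (drop (length \<beta>) \<gamma>) w else 0)"
      using Q_P[OF v _ \<beta>(2)[OF \<gamma>]] by simp
  qed
  also have "\<dots> = (\<Sum>\<gamma> \<in> {\<gamma>\<in>B. \<exists>\<delta>. \<gamma> = \<beta> @ \<delta> \<and> awalk w \<delta> w}. sc (\<kappa> \<gamma>) * P (drop (length \<beta>) \<gamma>) w)"
    using B(1) by (rule sum.inter_filter[symmetric])
  also have "{\<gamma>\<in>B. \<exists>\<delta>. \<gamma> = \<beta> @ \<delta> \<and> awalk w \<delta> w} = (@) \<beta> ` insert [] D"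
    using \<beta>(1) w by (force simp: D_def awalk_Nil_iff)
  also have "(\<Sum>\<gamma> \<in> (@) \<beta> ` insert [] D. sc (\<kappa> \<gamma>) * P (drop (length \<beta>) \<gamma>) w) = (\<Sum>\<delta>\<in>insert [] D. sc (\<kappa> (\<beta> @ \<delta>)) * P \<delta> w)"
    by (subst sum.reindex) (auto simp: inj_on_def)
  also have "\<dots> = sc (\<kappa> \<beta>) * V w + (\<Sum>\<delta>\<in>D. sc (\<kappa> (\<beta> @ \<delta>)) * P \<delta> w)"
    using finD by (subst sum.insert) (auto simp: D_def)
  finally have main: "Q \<beta> w * (\<rho> a * P xs w) = sc (\<kappa> \<beta>) * V w + (\<Sum>\<delta>\<in>D. sc (\<kappa> (\<beta> @ \<delta>)) * P \<delta> w)" .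
  define \<kappa>' where "\<kappa>' \<delta> = inverse (\<kappa> \<beta>) * \<kappa> (\<beta> @ \<delta>)" for \<delta>
  have \<kappa>0: "\<kappa> \<beta> \<noteq> 0" using B(2) \<beta>(1) by blast
  have "\<rho> (const (inverse (\<kappa> \<beta>)) * ghostp \<beta> w * a * pathp xs w) = sc (inverse (\<kappa> \<beta>)) * (Q \<beta> w * (\<rho> a * P xs w))"
    by (simp only: mult mult.assoc)
  also have "\<dots> = sc (inverse (\<kappa> \<beta>)) * (sc (\<kappa> \<beta>) * V w + (\<Sum>\<delta>\<in>D. sc (\<kappa> (\<beta> @ \<delta>)) * P \<delta> w))"
    by (simp only: main)
  also have "\<dots> = V w + (\<Sum>\<delta>\<in>D. sc (\<kappa>' \<delta>) * P \<delta> w)"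
    unfolding distrib_left sum_distrib_left mult.assoc[symmetric] sc_sc
    using \<kappa>0 by (simp add: sc_one \<kappa>'_def del: single_one)
  also have "\<dots> = \<rho> (unipotent w D \<kappa>')"
    by (simp add: unipotent_def \<rho>_add sum mult)
  finally show ?thesis
    using ghostp_free_alg[OF v] pathp_free_alg[OF xs(1)] w finD
    by (intro bexI[of _ "const (inverse (\<kappa> \<beta>)) * ghostp \<beta> w"] bexI[of _ "pathp xs w"] bexI[of _ w] exI[of _ D] exI[of _ \<kappa>'])
      (auto simp: D_def intro: free_alg_const)
qed

lemma unipotent_square:
  assumes "w \<in> verts F" "\<And>\<delta>. \<delta> \<in> D \<Longrightarrow> \<delta> \<noteq> []"
  shows "\<rho> (unipotent w D \<kappa>) * \<rho> (unipotent w D \<kappa>) \<noteq> 0"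
  using unipotent_square_notin_ideal[OF row_finite assms(1), of D "unipotent w D \<kappa>" \<kappa>] assms(2)
  by (auto simp: unipotent_def pathp_def simp flip: kernel mult)

lemma V_nonzero: "w \<in> verts F \<Longrightarrow> V w \<noteq> 0"
  using unipotent_square[of w "{}"] by (auto simp: unipotent_def)

subsection \<open>Cycles with and without exits\<close>

definition reduced :: "'r \<Rightarrow> bool" where
  "reduced r \<longleftrightarrow> r \<noteq> 0 \<and> (r * r = r \<or> (\<exists>s\<in>free_alg X. r * \<rho> s * r \<noteq> 0) \<and>
     (\<forall>s\<in>free_alg X. \<forall>t\<in>free_alg X. r * \<rho> s * r * \<rho> t * r = r * \<rho> t * r * \<rho> s * r))"

lemma walk_unique:
  assumes S: "\<And>v e. v \<in> S \<Longrightarrow> e \<in> out_arcs F v \<Longrightarrow> head F e \<in> S \<and> out_arcs F v = {e}"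
    and "awalk v xs x" "awalk v ys y" "v \<in> S" "length xs = length ys"
  shows "xs = ys"
  using assms(2-)
proof (induction xs arbitrary: v ys)
  case (Cons e xs)
  then obtain f zs where ys: "ys = f # zs" by (cases ys) auto
  have "e \<in> out_arcs F v" "f \<in> out_arcs F v" using Cons.prems ys by (auto simp: awalk_Cons_iff)
  then have "e = f" "head F e \<in> S" using S Cons.prems(3) by blast+
  then show ?case using Cons ys by (auto simp: awalk_Cons_iff)
qed simp

text \<open>At a vertex \<open>v\<close> that emits only \<open>e\<close>, relation (iv) reads
  \<open>e e^* = v\<close>.\<close>

lemma P_Q_exitless:
  assumes S: "\<And>v e. v \<in> S \<Longrightarrow> e \<in> out_arcs F v \<Longrightarrow> head F e \<in> S \<and> out_arcs F v = {e}"
    and "awalk v xs w" "v \<in> S"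
  shows "P xs w * Q xs w = V v"
  using assms(2-)
proof (induction xs arbitrary: v)
  case Nil
  then show ?case by (auto simp: awalk_Nil_iff)
next
  case (Cons e xs)
  then have e: "e \<in> arcs F" "tail F e = v" "awalk (head F e) xs w" by (auto simp: awalk_Cons_iff)
  then have out: "head F e \<in> S" "out_arcs F v = {e}" using S[OF Cons.prems(2), of e] by auto
  have "P (e # xs) w * Q (e # xs) w = Ed e * (P xs w * Q xs w) * Gh e"
    by (simp add: P_Cons Q_Cons mult.assoc)
  also have "\<dots> = Ed e * Gh e" using Cons.IH[OF e(3) out(1)] fam.ed_vx[OF e(1)] by simp
  also have "\<dots> = V v" using fam.ed_gh[of v] out(2) e by auto
  finally show ?case .
qed

lemma walk_heads: "awalk u c v \<Longrightarrow> e \<in> set c \<Longrightarrow> head F e \<in> tail F ` set c \<union> {v}"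
proof (induction c arbitrary: u)
  case (Cons f c)
  then have c: "awalk (head F f) c v" by (simp add: awalk_Cons_iff)
  show ?case
  proof (cases "e \<in> set c")
    case True
    then show ?thesis using Cons.IH[OF c] by auto
  next
    case False
    then show ?thesis using Cons.prems c by (cases c) (auto simp: awalk_simps)
  qed
qed simp

lemma awalk_power: "awalk w c w \<Longrightarrow> awalk w (concat (replicate n c)) w"
  by (induction n) (auto simp: awalk_Nil_iff intro: awalk_appendI)

lemma length_power: "length (concat (replicate n c)) = n * length c"
  by (induction n) auto

text \<open>\<open>V w\<close> discards the paths that do not start at \<open>w\<close>, and
  \<open>x\<close> commutes with the remaining ones.\<close>

lemma closed_span_commute:
  assumes "r \<in> real_span m w" "w \<in> verts F"
    and x: "\<And>\<beta>. awalk w \<beta> w \<Longrightarrow> x * P \<beta> w = P \<beta> w * x" and xs: "\<And>k. x * sc k = sc k * x"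
  shows "x * (V w * r) = (V w * r) * x"
  using assms(1)
proof induction
  case (add u xs r k)
  have "x * (V w * P xs w) = (V w * P xs w) * x"
  proof (cases "u = w")
    case True
    then show ?thesis using add.hyps(1) x V_P by simp
  next
    case False
    then show ?thesis using V_P_zero[OF add.hyps(1) assms(2)] by simp
  qed
  then have "x * (V w * (sc k * P xs w)) = (V w * (sc k * P xs w)) * x"
    by (simp add: sc_left_commute mult.assoc) (metis xs mult.assoc)
  then show ?case using add.IH by (simp add: distrib_left distrib_right)
qed simp

text \<open>Multiplied by a high power \<open>g\<close> of the cycle, elements of the corner at
  \<open>w\<close> become combinations of closed paths at \<open>w\<close>. These commute because a
  walk from \<open>w\<close> is determined by its length. Within the corner \<open>g\<close> is
  invertible, its inverse being its ghost, so it can be removed again.\<close>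

lemma exitless_commute:
  assumes w: "w \<in> S" "awalk w c w" "c \<noteq> []"
    and S: "\<And>v e. v \<in> S \<Longrightarrow> e \<in> out_arcs F v \<Longrightarrow> head F e \<in> S \<and> out_arcs F v = {e}"
    and st: "s \<in> free_alg X" "t \<in> free_alg X"
  shows "(V w * \<rho> s * V w) * (V w * \<rho> t * V w) = (V w * \<rho> t * V w) * (V w * \<rho> s * V w)"
proof -
  have wv: "w \<in> verts F" using w(2) by auto
  obtain N where N: "\<And>r. r \<in> real_span (N + 0) w \<Longrightarrow> \<rho> s * r \<in> real_span 0 w"
    using free_alg_real_span[OF st(1)] by blast
  obtain M where M: "\<And>r. r \<in> real_span (M + 0) w \<Longrightarrow> \<rho> t * r \<in> real_span 0 w"
    using free_alg_real_span[OF st(2)] by blast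
  define g where "g = concat (replicate (N + M) c)"
  have g: "awalk w g w" "N \<le> length g" "M \<le> length g"
    using awalk_power[OF w(2)] w(3) by (auto simp: g_def length_power) (metis One_nat_def Suc_leI length_greater_0_conv mult_le_mono mult.right_neutral add_leD1 add_leD2 order_refl)+
  let ?C = "P g w" and ?C' = "Q g w"
  have C: "V w * ?C = ?C" "?C * V w = ?C" using V_P[OF g(1)] P_V[OF wv] by auto
  have CC: "?C * ?C' = V w" "?C' * ?C = V w" using P_Q_exitless[OF S g(1) w(1)] Q_P_same[OF g(1)] by auto
  have PP: "P \<beta> w * P \<gamma> w = P \<gamma> w * P \<beta> w" if "awalk w \<beta> w" "awalk w \<gamma> w" for \<beta> \<gamma>
  proof -
    have "\<beta> @ \<gamma> = \<gamma> @ \<beta>"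
      using walk_unique[OF S awalk_appendI[OF that] awalk_appendI[OF that(2,1)] w(1)] by simp
    then show ?thesis using P_append that by metis
  qed
  have span: "V w * r * P \<beta> w = P \<beta> w * (V w * r)" if "r \<in> real_span m w" "awalk w \<beta> w" for r m \<beta>
    by (rule closed_span_commute[OF that(1) wv, symmetric]) (use PP that(2) sc_central in \<open>auto simp: mult.assoc\<close>)
  have sc_comm: "x * sc k = sc k * x" if "x = \<rho> a" for x a k using that sc_central by metis
  have span2: "(V w * (\<rho> a * ?C)) * (V w * (\<rho> b * ?C)) = (V w * (\<rho> b * ?C)) * (V w * (\<rho> a * ?C))"
    if "\<rho> a * ?C \<in> real_span 0 w" "\<rho> b * ?C \<in> real_span 0 w" for a b
    by (rule closed_span_commute[OF that(2) wv])
      (use span[OF that(1)] in \<open>simp_all add: sc_comm[of _ "gen (Vertex w) * (a * pathp g w)"] mult\<close>)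
  have sC: "\<rho> s * ?C \<in> real_span 0 w" and tC: "\<rho> t * ?C \<in> real_span 0 w"
    using N M real_span_P[OF g(1)] g(2,3) by simp_all
  \<comment> \<open>What commutes with \<open>P g w\<close> also commutes with its inverse.\<close>
  have C'_comm: "(V w * (\<rho> a * ?C)) * ?C' = ?C' * (V w * (\<rho> a * ?C))" if a: "\<rho> a * ?C \<in> real_span 0 w" for a
  proof -
    let ?y = "V w * (\<rho> a * ?C)"
    have y: "V w * ?y = ?y" "?y * V w = ?y" by (simp add: wv flip: mult.assoc) (simp add: C mult.assoc)
    have "?y * ?C' = (?C' * ?C) * ?y * ?C'" using y CC by simp
    also have "\<dots> = ?C' * (?C * ?y) * ?C'" by (simp only: mult.assoc)
    also have "\<dots> = ?C' * (?y * ?C) * ?C'" using span[OF a g(1)] by (simp only: mult.assoc)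
    also have "\<dots> = ?C' * ?y * (?C * ?C')" by (simp only: mult.assoc)
    also have "\<dots> = ?C' * ?y" using y CC by (simp add: mult.assoc)
    finally show ?thesis .
  qed
  have S_eq: "V w * \<rho> a * V w = (V w * (\<rho> a * ?C)) * ?C'" for a
    using CC(1) by (simp add: mult.assoc)
  have mix: "(V w * \<rho> a * V w) * (V w * \<rho> b * V w) = ((V w * (\<rho> a * ?C)) * (V w * (\<rho> b * ?C))) * (?C' * ?C')"
    if "\<rho> b * ?C \<in> real_span 0 w" for a b
  proof -
    have "(V w * \<rho> a * V w) * (V w * \<rho> b * V w) = (V w * (\<rho> a * ?C)) * (?C' * (V w * (\<rho> b * ?C))) * ?C'"
      unfolding S_eq by (simp only: mult.assoc)
    also have "\<dots> = (V w * (\<rho> a * ?C)) * ((V w * (\<rho> b * ?C)) * ?C') * ?C'" by (simp only: C'_comm[OF that])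
    finally show ?thesis by (simp only: mult.assoc)
  qed
  show ?thesis unfolding mix[OF sC] mix[OF tC] span2[OF sC tC] ..
qed

text \<open>If some walk \<open>\<tau>\<close> satisfies \<open>\<tau>^* \<delta> \<tau> = 0\<close>
  for all \<open>\<delta>\<close> in \<open>D\<close>, multiplication by \<open>\<tau>^*\<close> and
  \<open>\<tau>\<close> leaves only a vertex. If there is none, the cycle at \<open>w\<close> has no
  exit and the corner at \<open>w\<close> is commutative.\<close>

lemma unipotent_reduced:
  assumes w: "w \<in> verts F" and D: "finite D" "\<And>\<delta>. \<delta> \<in> D \<Longrightarrow> \<delta> \<noteq> [] \<and> awalk w \<delta> w"
  shows "\<exists>b\<in>free_alg X. \<exists>c\<in>free_alg X. reduced (\<rho> (b * unipotent w D \<kappa> * c))"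
proof (cases "\<exists>\<tau> w'. awalk w \<tau> w' \<and> (\<forall>\<delta>\<in>D. Q \<tau> w' * P \<delta> w * P \<tau> w' = 0)")
  case True
  then obtain \<tau> w' where \<tau>: "awalk w \<tau> w'" "\<And>\<delta>. \<delta> \<in> D \<Longrightarrow> Q \<tau> w' * P \<delta> w * P \<tau> w' = 0" by blast
  have w': "w' \<in> verts F" using \<tau>(1) by auto
  have "\<rho> (ghostp \<tau> w' * unipotent w D \<kappa> * pathp \<tau> w') =
      Q \<tau> w' * (V w * P \<tau> w') + (\<Sum>\<delta>\<in>D. sc (\<kappa> \<delta>) * (Q \<tau> w' * P \<delta> w * P \<tau> w'))"
    by (simp add: unipotent_def \<rho>_add mult sum distrib_left distrib_right sum_distrib_left sum_distrib_right
        sc_left_commute mult.assoc)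
  also have "\<dots> = V w'" using \<tau>(2) V_P[OF \<tau>(1)] Q_P_same[OF \<tau>(1)] by simp
  finally have "reduced (\<rho> (ghostp \<tau> w' * unipotent w D \<kappa> * pathp \<tau> w'))"
    using V_nonzero[OF w'] w' by (simp add: reduced_def)
  then show ?thesis using ghostp_free_alg[OF \<tau>(1)] pathp_free_alg[OF \<tau>(1)] by blast
next
  case no_exit: False
  \<comment> \<open>For empty \<open>D\<close> the empty walk would do.\<close>
  then have "D \<noteq> {}" using w by (auto simp: awalk_Nil_iff dest: spec[of _ "[]"])
  then obtain c where c: "cycle_based_at F w c"
    using closed_walk_cycle[OF wf_digraph] D(2) by blast
  then have cw: "c \<noteq> []" "awalk w c w" by (auto simp: cycle_based_at_def)
  define S where "S = tail F ` set c"
  have wS: "w \<in> S" using cw by (cases c) (auto simp: S_def awalk_Cons_iff)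
  have S: "head F e \<in> S \<and> out_arcs F v = {e}" if v: "v \<in> S" "e \<in> out_arcs F v" for v e
  proof -
    obtain j where j: "j < length c" "tail F (c ! j) = v" using v(1) by (auto simp: S_def in_set_conv_nth)
    have cj: "c ! j \<in> arcs F" using cw j(1) nth_mem[of j c] by (auto simp: awalk_def)
    have out: "f = c ! j" if f: "f \<in> out_arcs F v" for f
    proof (rule ccontr)
      assume ne: "f \<noteq> c ! j"
      have fc: "f \<notin> set c"
      proof
        assume "f \<in> set c"
        then obtain i where "i < length c" "c ! i = f" by (auto simp: in_set_conv_nth)
        then show False using c j f ne unfolding cycle_based_at_def by (metis in_out_arcs_conv)
      qed
      \<comment> \<open>Go around \<open>c\<close> so often that the walk \<open>\<sigma>\<close> is
        at least as long as every \<open>\<delta>\<close>, then leave by the exit \<open>f\<close>.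
        If \<open>\<sigma> @ [f]\<close> were a prefix of \<open>\<delta> @ \<sigma> @ [f]\<close>,
        its last edge \<open>f\<close> would coincide with an edge of \<open>\<sigma>\<close>, hence
        of \<open>c\<close>.\<close>
      define m where "m = Max (length ` D)"
      have m: "length \<delta> \<le> m" if "\<delta> \<in> D" for \<delta> using that D(1) by (simp add: m_def)
      define \<sigma> where "\<sigma> = concat (replicate m c) @ take j c"
      have len: "m \<le> length \<sigma>"
        using cw(1) by (cases "length c") (auto simp: \<sigma>_def length_power)
      have \<sigma>: "awalk w \<sigma> v"
        unfolding \<sigma>_def using awalk_power[OF cw(2)] awalk_take_drop(1)[OF cw(2) j(1)] j(2) by (blast intro: awalk_appendI)
      have f_walk: "awalk v [f] (head F f)" using f by (auto simp: awalk_simps)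
      have \<tau>: "awalk w (\<sigma> @ [f]) (head F f)" using \<sigma> f_walk by (rule awalk_appendI)
      have set\<sigma>: "set \<sigma> \<subseteq> set c" by (auto simp: \<sigma>_def dest: in_set_takeD)
      have "Q (\<sigma> @ [f]) (head F f) * P \<delta> w * P (\<sigma> @ [f]) (head F f) = 0" if \<delta>: "\<delta> \<in> D" for \<delta>
      proof -
        have "take (length (\<sigma> @ [f])) (\<delta> @ \<sigma> @ [f]) \<noteq> \<sigma> @ [f]"
        proof
          assume eq: "take (length (\<sigma> @ [f])) (\<delta> @ \<sigma> @ [f]) = \<sigma> @ [f]"
          let ?i = "length \<sigma> - length \<delta>"
          have d: "0 < length \<delta>" "length \<delta> \<le> length \<sigma>" using D(2)[OF \<delta>] m[OF \<delta>] len by auto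
          have i: "?i < length \<sigma>" using d by linarith
          have "f = take (length (\<sigma> @ [f])) (\<delta> @ \<sigma> @ [f]) ! length \<sigma>" unfolding eq by simp
          also have "\<dots> = (\<delta> @ \<sigma> @ [f]) ! length \<sigma>" by (rule nth_take) simp
          also have "\<dots> = (\<sigma> @ [f]) ! ?i" using d(2) by (simp add: nth_append)
          also have "\<dots> = \<sigma> ! ?i" using i by (simp only: nth_append if_True)
          also have "\<dots> \<in> set \<sigma>" using i by simp
          finally show False using fc set\<sigma> by blast
        qed
        then show ?thesis
          using Q_P[OF \<tau> awalk_appendI[OF conjunct2[OF D(2)[OF \<delta>]] \<tau>]] P_append[OF \<tau>, of \<delta>]
          by (simp add: mult.assoc)
      qed
      then show False using no_exit \<tau> by blast
    qed
    have "c ! j \<in> out_arcs F v" using cj j(2) by simp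
    then have "out_arcs F v = {c ! j}" using out by blast
    moreover have "head F (c ! j) \<in> S" using walk_heads[OF cw(2), of "c ! j"] j(1) wS by (auto simp: S_def)
    ultimately show ?thesis using v(2) by auto
  qed
  let ?U = "unipotent w D \<kappa>"
  let ?u = "\<rho> ?U"
  have Vu: "V w * ?u = ?u"
  proof -
    have "V w * P \<delta> w = P \<delta> w" if "\<delta> \<in> D" for \<delta> using D(2)[OF that] V_P by blast
    then have "(\<Sum>\<delta>\<in>D. V w * (sc (\<kappa> \<delta>) * P \<delta> w)) = (\<Sum>\<delta>\<in>D. sc (\<kappa> \<delta>) * P \<delta> w)"
      by (intro sum.cong refl) (simp add: sc_left_commute)
    then show ?thesis by (simp only: unipotent_def \<rho>_add mult sum distrib_left sum_distrib_left V_idem[OF w])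
  qed
  have uV: "?u * V w = ?u"
    by (simp only: unipotent_def \<rho>_add mult sum distrib_right sum_distrib_right mult.assoc P_V[OF w] V_idem[OF w])
  have Vw: "gen (Vertex w) \<in> free_alg X" using w by (simp add: lpa_gens_def)
  have U_fa: "?U \<in> free_alg X"
    unfolding unipotent_def using Vw D pathp_free_alg by (blast intro: free_alg_add free_alg_sum free_alg_const)
  have u2: "?u * ?u \<noteq> 0" using unipotent_square[OF w] D(2) by blast
  have comm: "(V w * \<rho> s * V w) * (V w * \<rho> t * V w) = (V w * \<rho> t * V w) * (V w * \<rho> s * V w)"
    if "s \<in> free_alg X" "t \<in> free_alg X" for s t
    by (rule exitless_commute[OF wS cw(2,1) S that])
  have comm_u: "?u * (V w * \<rho> s * V w) = (V w * \<rho> s * V w) * ?u" if "s \<in> free_alg X" for s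
    using comm[OF U_fa that] Vu uV by simp
  \<comment> \<open>The element commutes with the corner at \<open>w\<close>, so all its three
    copies can be moved to the left.\<close>
  have eq: "?u * \<rho> s * ?u * \<rho> t * ?u = ?u * ?u * ?u * ((V w * \<rho> s * V w) * (V w * \<rho> t * V w))"
    if st: "s \<in> free_alg X" "t \<in> free_alg X" for s t
  proof -
    let ?s = "V w * \<rho> s * V w" and ?t = "V w * \<rho> t * V w"
    have "?u * \<rho> s * ?u * \<rho> t * ?u = (?u * V w) * \<rho> s * (V w * ?u * V w) * \<rho> t * (V w * ?u)"
      by (simp only: Vu uV)
    also have "\<dots> = ?u * ?s * ?u * ?t * ?u" by (simp only: mult.assoc)
    also have "\<dots> = ?u * (?s * ?u) * (?t * ?u)" by (simp only: mult.assoc)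
    also have "\<dots> = ?u * (?u * ?s) * (?u * ?t)" by (simp only: comm_u[OF st(1)] comm_u[OF st(2)])
    also have "\<dots> = ?u * ?u * (?s * ?u) * ?t" by (simp only: mult.assoc)
    also have "\<dots> = ?u * ?u * (?u * ?s) * ?t" by (simp only: comm_u[OF st(1)])
    finally show ?thesis by (simp only: mult.assoc)
  qed
  have "reduced ?u"
    unfolding reduced_def
  proof (intro conjI disjI2 ballI)
    show "?u \<noteq> 0" using u2 by auto
    show "\<exists>s\<in>free_alg X. ?u * \<rho> s * ?u \<noteq> 0" using Vw u2 uV by (intro bexI[of _ "gen (Vertex w)"]) simp_all
    show "?u * \<rho> s * ?u * \<rho> t * ?u = ?u * \<rho> t * ?u * \<rho> s * ?u" if "s \<in> free_alg X" "t \<in> free_alg X" for s t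
      unfolding eq[OF that] eq[OF that(2,1)] comm[OF that] ..
  qed
  then have "reduced (\<rho> (gen (Vertex w) * ?U * gen (Vertex w)))" by (simp add: mult Vu uV)
  then show ?thesis using Vw by blast
qed

lemma reduction_property: "reduction_property (presented_alg X (lpa_rels F) :: ('k, _) alg)"
  unfolding reduction_property_presented_alg[OF lpa_rels_free_alg[OF wf_digraph]]
proof (intro ballI impI)
  fix a :: "('c, 'd) lpa_gen word \<Rightarrow>\<^sub>0 'k" assume a: "a \<in> free_alg X" "a \<notin> ideal_of (lpa_rels F)"
  then have "\<rho> a \<noteq> 0" by (simp add: kernel)
  from reduce_to_unipotent[OF a(1) this] obtain b c w D \<kappa> where bc: "b \<in> free_alg X" "c \<in> free_alg X"
    and wD: "w \<in> verts F" "finite D" "\<forall>\<delta>\<in>D. \<delta> \<noteq> [] \<and> awalk w \<delta> w" and eq: "\<rho> (b * a * c) = \<rho> (unipotent w D \<kappa>)"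
    by (elim bexE exE conjE)
  obtain b' c' where bc': "b' \<in> free_alg X" "c' \<in> free_alg X" and red: "reduced (\<rho> (b' * unipotent w D \<kappa> * c'))"
    using unipotent_reduced[OF wD(1,2)] wD(3) by blast
  have "\<rho> (b' * unipotent w D \<kappa> * c') = \<rho> (b' * b * a * (c * c'))"
    using eq by (simp add: mult) (metis mult.assoc)
  then have "reduced (\<rho> (b' * b * a * (c * c')))" using red by simp
  then have "let u = b' * b * a * (c * c') in u \<notin> ideal_of (lpa_rels F) \<and>
        (u * u - u \<in> ideal_of (lpa_rels F) \<or>
          (\<exists>s\<in>free_alg X. u * s * u \<notin> ideal_of (lpa_rels F)) \<and>
          (\<forall>s\<in>free_alg X. \<forall>t\<in>free_alg X. u * s * u * t * u - u * t * u * s * u \<in> ideal_of (lpa_rels F)))"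
    unfolding reduced_def Let_def kernel[symmetric] by (simp add: diff mult mult.assoc)
  then show "\<exists>b\<in>free_alg X. \<exists>c\<in>free_alg X. let u = b * a * c in u \<notin> ideal_of (lpa_rels F) \<and>
        (u * u - u \<in> ideal_of (lpa_rels F) \<or>
          (\<exists>s\<in>free_alg X. u * s * u \<notin> ideal_of (lpa_rels F)) \<and>
          (\<forall>s\<in>free_alg X. \<forall>t\<in>free_alg X. u * s * u * t * u - u * t * u * s * u \<in> ideal_of (lpa_rels F)))"
    using bc bc' by (intro bexI[of _ "b' * b"] bexI[of _ "c * c'"]) (auto intro: free_alg_mult)
qed

end

theorem reduction_property_leavitt_path_alg:
  fixes F :: "('c, 'd) pre_digraph"
  assumes "wf_digraph F" "row_finite F"
  shows "reduction_property (leavitt_path_alg F :: ('k::field, _) alg)"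
proof -
  obtain \<rho> :: "(('c, 'd) lpa_gen word \<Rightarrow>\<^sub>0 'k) \<Rightarrow> (('c, 'd) lpa_gen word \<Rightarrow>\<^sub>0 'k) endo" where \<rho>:
    "\<And>a b. \<rho> (a + b) = \<rho> a + \<rho> b" "\<And>a b. \<rho> (a * b) = \<rho> a * \<rho> b" "\<And>a. \<rho> a = 0 \<longleftrightarrow> a \<in> ideal_of (lpa_rels F)"
    by (rule quotient_ring[of "lpa_rels F"]) blast
  interpret lpa_quotient F \<rho>
    using assms(1) by (intro lpa_quotient.intro nonunital_ring_hom.intro lpa_quotient_axioms.intro) (use assms \<rho> in auto)
  show ?thesis unfolding leavitt_path_alg_def by (rule reduction_property)
qed

section \<open>The combinatorics of Condition (LPA)\<close>

locale lpa_graph =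
  fixes E :: "('v, 'e) pre_digraph" and w :: "'e \<Rightarrow> nat"
begin

abbreviation "Wt \<equiv> weighted_edges E w"

definition T :: "'v set" where
  "T = tree E (head E ` Wt)"

text \<open>The edges that will be reversed.\<close>

definition R :: "'e set" where
  "R = Wt \<union> {g \<in> arcs E. tail E g \<in> T}"

text \<open>The vertices that will be split in two.\<close>

definition S :: "'v set" where
  "S = {v. \<exists>e\<in>Wt. \<exists>f\<in>arcs E. tail E e = v \<and> tail E f = v \<and> e \<noteq> f}"

definition special :: "'v \<Rightarrow> 'e" where
  "special v = (SOME e. e \<in> Wt \<and> tail E e = v)"

end

locale lpa_condition = lpa_graph E w
  for E :: "('v, 'e) pre_digraph" and w :: "'e \<Rightarrow> nat" +
  assumes weighted_graph: "weighted_graph E w"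
    and row_finite: "row_finite E"
    and LPA: "condition_LPA E w"

sublocale lpa_condition \<subseteq> wf_digraph E
  using weighted_graph by (simp add: weighted_graph_def)

context lpa_condition
begin

lemma Wt_arcs: "e \<in> Wt \<Longrightarrow> e \<in> arcs E" and Wt_weight: "e \<in> Wt \<Longrightarrow> 1 < w e"
  by (auto simp: weighted_edges_def)

lemma arc_weight_pos: "e \<in> arcs E \<Longrightarrow> 1 \<le> w e"
  using weighted_graph by (simp add: weighted_graph_def)

lemma finite_out_arcs: "v \<in> verts E \<Longrightarrow> finite (out_arcs E v)"
  using row_finite by (simp add: row_finite_def)

lemma weight_le_vertex_weight: "e \<in> arcs E \<Longrightarrow> w e \<le> vertex_weight E w (tail E e)"
  using finite_out_arcs[of "tail E e"] by (auto simp: vertex_weight_def)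

lemma T_iff: "v \<in> T \<longleftrightarrow> (\<exists>e\<in>Wt. \<exists>p. awalk (head E e) p v)"
  unfolding T_def tree_def path_to_def by auto

lemma T_verts: "v \<in> T \<Longrightarrow> v \<in> verts E"
  by (auto simp: T_def tree_def)

lemma LPA1: "e \<in> Wt \<Longrightarrow> f \<in> Wt \<Longrightarrow> tail E e = tail E f \<Longrightarrow> e = f"
  using LPA Wt_arcs unfolding condition_LPA_def LPA1_def by (metis tail_in_verts)

lemma LPA2: "tail E e \<in> T \<Longrightarrow> e \<in> arcs E \<Longrightarrow> f \<in> arcs E \<Longrightarrow> tail E f = tail E e \<Longrightarrow> e = f"
  using LPA unfolding condition_LPA_def LPA2_def T_def by auto

lemma head_T: "e \<in> Wt \<Longrightarrow> head E e \<in> T"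
  unfolding T_iff using Wt_arcs by (intro bexI[of _ e] exI[of _ "[]"]) (auto simp: awalk_Nil_iff)

lemma walk_T: "v \<in> T \<Longrightarrow> awalk v p x \<Longrightarrow> x \<in> T"
  unfolding T_iff using awalk_appendI by blast

lemma R_arcs: "g \<in> R \<Longrightarrow> g \<in> arcs E"
  by (auto simp: R_def Wt_arcs)

lemma R_head_T: "g \<in> R \<Longrightarrow> head E g \<in> T"
  using head_T walk_T[of "tail E g" "[g]"] by (auto simp: R_def awalk_simps)

text \<open>A vertex of \<open>T\<close> emits at most one edge and \<open>T\<close> is closed under
  walks, so walks from such a vertex are determined by their lengths.\<close>

lemma T_walks_comparable:
  "v \<in> T \<Longrightarrow> awalk v xs x \<Longrightarrow> awalk v ys y \<Longrightarrow> length xs \<le> length ys \<Longrightarrow> \<exists>zs. ys = xs @ zs \<and> awalk x zs y"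
proof (induction xs arbitrary: v ys)
  case Nil
  then show ?case by (auto simp: awalk_Nil_iff)
next
  case (Cons e xs)
  then obtain f zs where ys: "ys = f # zs" by (cases ys) auto
  have e: "e \<in> arcs E" "tail E e = v" "awalk (head E e) xs x" and f: "f \<in> arcs E" "tail E f = v" "awalk (head E f) zs y"
    using Cons.prems ys by (auto simp: awalk_Cons_iff)
  have "e = f" using LPA2[of e f] Cons.prems(1) e f by simp
  moreover have "head E e \<in> T" using e Cons.prems(1) R_head_T[of e] by (simp add: R_def)
  ultimately show ?case using Cons.IH[OF _ e(3), of zs] f(3) Cons.prems(4) ys by auto
qed

text \<open>The longer closed walk is the shorter one followed by a further closed walk at
  \<open>y\<close>; descend as in Euclid's algorithm.\<close>

lemma closed_walks_last:
  assumes "y \<in> T" "awalk y r y" "awalk y r' y" "r \<noteq> []" "r' \<noteq> []"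
  shows "last r = last r'"
  using assms(2-)
proof (induction "length r + length r'" arbitrary: r r' rule: less_induct)
  case less
  have *: "last r = last r'" if le: "length r \<le> length r'" and r: "awalk y r y" "awalk y r' y" "r \<noteq> []" "r' \<noteq> []"
    and IH: "\<And>s. length s < length r' \<Longrightarrow> awalk y s y \<Longrightarrow> s \<noteq> [] \<Longrightarrow> last r = last s" for r r'
  proof -
    obtain s where s: "r' = r @ s" "awalk y s y" using T_walks_comparable[OF assms(1) r(1,2) le] by blast
    then show ?thesis using IH[of s] r(3) by (cases "s = []") auto
  qed
  show ?case
  proof (cases "length r \<le> length r'")
    case True
    show ?thesis
    proof (rule *[OF True less.prems])
      fix s assume "length s < length r'" "awalk y s y" "s \<noteq> []"
      then show "last r = last s" using less.hyps[of r s] less.prems by simp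
    qed
  next
    case False
    then have le: "length r' \<le> length r" by simp
    have "last r' = last r"
    proof (rule *[OF le less.prems(2,1,4,3)])
      fix s assume "length s < length r" "awalk y s y" "s \<noteq> []"
      then show "last r' = last s" using less.hyps[of r' s] less.prems by simp
    qed
    then show ?thesis by simp
  qed
qed

lemma R_walk:
  assumes "g \<in> R"
  shows "\<exists>e\<in>Wt. \<exists>p. awalk (head E e) p (head E g) \<and> last (e # p) = g"
proof (cases "g \<in> Wt")
  case True
  then show ?thesis using Wt_arcs by (intro bexI[of _ g] exI[of _ "[]"]) (auto simp: awalk_Nil_iff)
next
  case False
  then have g: "g \<in> arcs E" "tail E g \<in> T" using assms by (auto simp: R_def)
  then obtain e p where "e \<in> Wt" "awalk (head E e) p (tail E g)" by (auto simp: T_iff)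
  then show ?thesis
    using g by (intro bexI[of _ e] exI[of _ "p @ [g]"]) (auto simp: awalk_simps intro!: awalk_appendI)
qed

text \<open>The longer walk extends the shorter one by a closed walk at \<open>y\<close>. If that is
  nonempty, (LPA4) puts \<open>e\<close> on a cycle at \<open>y\<close>; the part of the cycle
  before \<open>e\<close>, continued by \<open>e # p\<close> or \<open>e # p'\<close>, gives closed
  walks at \<open>y\<close>, which end in the same edge. Prefixing \<open>e\<close> covers the empty
  walk.\<close>

lemma last_from_weighted:
  assumes e: "e \<in> Wt" and p: "awalk (head E e) p y" "awalk (head E e) p' y"
  shows "last (e # p) = last (e # p')"
proof -
  have y: "y \<in> T" using walk_T[OF head_T[OF e] p(1)] .
  have closed: "last (e # p) = last (e # p')" if r: "awalk y r y" "r \<noteq> []" for r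
  proof -
    obtain c where c: "cycle_based_at E y c" using closed_walk_cycle[OF wf_digraph r] by blast
    have "y \<in> tree E {head E e}" using p(1) y T_verts by (auto simp: tree_def path_to_def)
    then have "e \<in> set c" using LPA e c unfolding condition_LPA_def LPA4_def by blast
    then obtain c1 c2 where "c = c1 @ e # c2" by (meson split_list)
    then have c1: "awalk y c1 (tail E e)" using c by (auto simp: cycle_based_at_def awalk_Cons_iff)
    have "awalk y (c1 @ e # p) y" "awalk y (c1 @ e # p') y"
      using c1 p Wt_arcs[OF e] by (auto intro!: awalk_appendI simp: awalk_Cons_iff simp del: awalk_append_iff)
    from closed_walks_last[OF y this] show ?thesis by simp
  qed
  show ?thesis
  proof (cases "length p \<le> length p'")
    case True
    then obtain s where "p' = p @ s" "awalk y s y" using T_walks_comparable[OF head_T[OF e] p] by blast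
    then show ?thesis using closed by (cases "s = []") auto
  next
    case False
    then obtain s where "p = p' @ s" "awalk y s y" using T_walks_comparable[OF head_T[OF e] p(2,1)] by auto
    then show ?thesis using closed by (cases "s = []") auto
  qed
qed

text \<open>
  Two edges of \<open>R\<close> with the same head lie on walks starting with weighted edges; by (LPA3) one
  of these weighted edges precedes the other, so that both walks may be assumed to start with it.
\<close>

lemma inj_on_head_R: "inj_on (head E) R"
proof (rule inj_onI)
  fix g g' assume g: "g \<in> R" "g' \<in> R" and hd: "head E g = head E g'"
  have *: "last (e # p) = last (e' # p')"
    if "e \<in> Wt" "e' \<in> Wt" "awalk (head E e) p y" "awalk (head E e') p' y" and conn: "e = e' \<or> path_to E (head E e) (tail E e')"
    for e e' p p' y
  proof (cases "e = e'")
    case True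
    then show ?thesis using last_from_weighted that by blast
  next
    case False
    then obtain q where q: "awalk (head E e) q (tail E e')" using conn False unfolding path_to_def by blast
    then have "awalk (head E e) (q @ e' # p') y"
      using that Wt_arcs by (auto intro!: awalk_appendI simp: awalk_Cons_iff simp del: awalk_append_iff)
    from last_from_weighted[OF that(1,3) this] show ?thesis by simp
  qed
  obtain e p where e: "e \<in> Wt" "awalk (head E e) p (head E g)" "last (e # p) = g" using R_walk[OF g(1)] by blast
  obtain e' p' where e': "e' \<in> Wt" "awalk (head E e') p' (head E g)" "last (e' # p') = g'" using R_walk[OF g(2)] hd by auto
  have "head E g \<in> tree E {head E e} \<inter> tree E {head E e'}"
    using e e' R_arcs[OF g(1)] by (auto simp: tree_def path_to_def)
  then have "in_line E e e'" using LPA e(1) e'(1) unfolding condition_LPA_def LPA3_def by blast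
  then show "g = g'"
    using *[OF e(1) e'(1) e(2) e'(2)] *[OF e'(1) e(1) e'(2) e(2)] e(3) e'(3) by (auto simp: in_line_def)
qed

lemma S_T: "v \<in> S \<Longrightarrow> v \<notin> T"
  using LPA2 Wt_arcs by (auto simp: S_def)

lemma S_verts: "v \<in> S \<Longrightarrow> v \<in> verts E"
  by (auto simp: S_def Wt_arcs)

lemma special_S: "v \<in> S \<Longrightarrow> special v \<in> Wt \<and> tail E (special v) = v"
  unfolding special_def by (rule someI_ex) (auto simp: S_def)

lemma special_R: "v \<in> S \<Longrightarrow> special v \<in> R"
  using special_S by (simp add: R_def)

lemma R_special: "g \<in> R \<Longrightarrow> tail E g \<in> S \<Longrightarrow> g = special (tail E g)"
  using special_S[of "tail E g"] S_T[of "tail E g"] LPA1 by (auto simp: R_def)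

lemma R_only: "g \<in> R \<Longrightarrow> tail E g \<notin> S \<Longrightarrow> out_arcs E (tail E g) = {g}"
proof -
  assume g: "g \<in> R" "tail E g \<notin> S"
  have "f = g" if "f \<in> out_arcs E (tail E g)" for f
  proof (cases "g \<in> Wt")
    case True
    then show ?thesis using g(2) that by (auto simp: S_def)
  next
    case False
    then have "tail E g \<in> T" using g(1) by (auto simp: R_def)
    then show ?thesis using LPA2[of g f] R_arcs[OF g(1)] that by simp
  qed
  then show ?thesis using R_arcs[OF g(1)] by (intro equalityI subsetI) auto
qed

lemma not_R: "f \<in> arcs E \<Longrightarrow> f \<notin> R \<Longrightarrow> w f = 1 \<and> tail E f \<notin> T"
  using arc_weight_pos[of f] by (auto simp: R_def weighted_edges_def)

lemma R_same_tail: "g \<in> R \<Longrightarrow> g' \<in> R \<Longrightarrow> tail E g = tail E g' \<Longrightarrow> g = g'"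
  using R_special R_only R_arcs by (metis in_out_arcs_conv singletonD)

lemma out_arcs_S: "v \<in> S \<Longrightarrow> out_arcs E v = insert (special v) (out_arcs E v - R)"
  using special_S[of v] special_R[of v] R_special Wt_arcs by auto

lemma out_arcs_not_R: "v \<notin> S \<Longrightarrow> f \<in> out_arcs E v \<Longrightarrow> f \<notin> R \<Longrightarrow> out_arcs E v - R = out_arcs E v"
proof -
  assume *: "v \<notin> S" "f \<in> out_arcs E v" "f \<notin> R"
  have "g \<notin> R" if "g \<in> out_arcs E v" for g
    using R_only[of g] that * by (metis in_out_arcs_conv singletonD)
  then show ?thesis by auto
qed

text \<open>Edges outside \<open>R\<close> have weight 1, and no second edge of \<open>R\<close>
  leaves the same vertex.\<close>

lemma vertex_weight_R:
  assumes "g \<in> R"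
  shows "vertex_weight E w (tail E g) = w g"
proof (rule antisym)
  have g: "g \<in> arcs E" using R_arcs[OF assms] .
  show "w g \<le> vertex_weight E w (tail E g)" using weight_le_vertex_weight[OF g] .
  have "w f \<le> w g" if "f \<in> out_arcs E (tail E g)" for f
  proof (cases "f = g")
    case False
    then have "f \<notin> R" using that R_same_tail[OF assms, of f] by auto
    then show ?thesis using not_R[of f] that arc_weight_pos[OF g] by auto
  qed simp
  then have "Max (w ` out_arcs E (tail E g)) \<le> w g"
    using finite_out_arcs[of "tail E g"] g by (intro Max.boundedI) auto
  then show "vertex_weight E w (tail E g) \<le> w g" by (simp add: vertex_weight_def)
qed

lemma vertex_weight_not_R:
  assumes "v \<in> verts E" "out_arcs E v - R = out_arcs E v" "out_arcs E v \<noteq> {}"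
  shows "vertex_weight E w v = 1"
proof -
  have "w f = 1" if "f \<in> out_arcs E v" for f
  proof -
    have "f \<notin> R" using that assms(2) by blast
    then show ?thesis using not_R[of f] that by simp
  qed
  then have "w ` out_arcs E v = (\<lambda>_. 1) ` out_arcs E v" by (intro image_cong) auto
  also have "\<dots> = {1}" using assms(3) by (simp add: image_constant_conv)
  finally have "w ` out_arcs E v = {1}" .
  then show ?thesis using assms(3) by (simp add: vertex_weight_def)
qed

end

section \<open>The unweighted graph\<close>

context lpa_graph
begin

text \<open>
  The edges in \<open>R\<close> are reversed: the letters below are the edges \<open>f\<close> outside \<open>R\<close> and the
  ghost edges \<open>g\<^sub>i\<^sup>*\<close> for \<open>g \<in> R\<close>. A vertex \<open>v \<in> S\<close> is split into \<open>v - g\<^sub>1g\<^sub>1\<^sup>*\<close> (index \<open>False\<close>) and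
  \<open>g\<^sub>1g\<^sub>1\<^sup>*\<close> (index \<open>True\<close>), where \<open>g\<close> is the weighted edge at \<open>v\<close>, and with it the letters ending
  in \<open>v\<close>; only \<open>g\<^sub>1\<^sup>*\<close> ends entirely in the second half.
\<close>

definition graph_letters :: "('v, 'e) wlpa_gen set" where
  "graph_letters = {WEdge f 1 | f. f \<in> arcs E - R} \<union> {WGhost g i | g i. g \<in> R \<and> 1 \<le> i \<and> i \<le> w g}"

definition exceptional :: "('v, 'e) wlpa_gen \<Rightarrow> bool" where
  "exceptional a \<longleftrightarrow> (\<exists>g. a = WGhost g 1 \<and> tail E g \<in> S)"

definition halves :: "'v \<Rightarrow> bool set" where
  "halves v = {b. b \<longrightarrow> v \<in> S}"

definition end_halves :: "('v, 'e) wlpa_gen \<Rightarrow> bool set" where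
  "end_halves a = (if exceptional a then {True} else halves (lrange E a))"

text \<open>The vertices and edges of \<open>F\<close> have to be words in the generators, so a
  letter together with the index of a half is written as that letter once or twice.\<close>

definition enc :: "('v, 'e) wlpa_gen \<Rightarrow> bool \<Rightarrow> ('v, 'e) universe" where
  "enc a b = Word (if b then [a, a] else [a])"

definition dec :: "('v, 'e) universe \<Rightarrow> ('v, 'e) wlpa_gen \<times> bool" where
  "dec u = (hd (letters u), length (letters u) = 2)"

text \<open>Every edge starts in a half \<open>False\<close>: at a split vertex the edges outside
  \<open>R\<close> are orthogonal to \<open>g_1 g_1^*\<close>, and the reversed edges start in
  \<open>T\<close>, where no vertex is split. The halves \<open>True\<close> are sinks.\<close>

definition F :: "(('v, 'e) universe, ('v, 'e) universe) pre_digraph" where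
  "F = \<lparr> verts = {enc (WVertex v) b | v b. v \<in> verts E \<and> b \<in> halves v},
         arcs = {enc a b | a b. a \<in> graph_letters \<and> b \<in> end_halves a},
         tail = (\<lambda>u. enc (WVertex (lsource E (fst (dec u)))) False),
         head = (\<lambda>u. enc (WVertex (lrange E (fst (dec u)))) (snd (dec u))) \<rparr>"

lemma dec_enc [simp]: "dec (enc a b) = (a, b)"
  by (simp add: dec_def enc_def)

lemma enc_eq_iff [simp]: "enc a b = enc a' b' \<longleftrightarrow> a = a' \<and> b = b'"
  by (cases b; cases b') (auto simp: enc_def)

lemma F_simps [simp]:
  "enc (WVertex v) b \<in> verts F \<longleftrightarrow> v \<in> verts E \<and> b \<in> halves v"
  "enc a b \<in> arcs F \<longleftrightarrow> a \<in> graph_letters \<and> b \<in> end_halves a"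
  "tail F (enc a b) = enc (WVertex (lsource E a)) False"
  "head F (enc a b) = enc (WVertex (lrange E a)) b"
  by (auto simp: F_def)

lemma graph_letters_simps [simp]:
  "WEdge f i \<in> graph_letters \<longleftrightarrow> f \<in> arcs E \<and> f \<notin> R \<and> i = 1"
  "WGhost g i \<in> graph_letters \<longleftrightarrow> g \<in> R \<and> 1 \<le> i \<and> i \<le> w g"
  "WVertex v \<notin> graph_letters"
  by (auto simp: graph_letters_def)

lemma graph_letters_cases [consumes 1, case_names edge ghost]:
  assumes "a \<in> graph_letters"
    "\<And>f. a = WEdge f 1 \<Longrightarrow> f \<in> arcs E \<Longrightarrow> f \<notin> R \<Longrightarrow> thesis"
    "\<And>g i. a = WGhost g i \<Longrightarrow> g \<in> R \<Longrightarrow> 1 \<le> i \<Longrightarrow> i \<le> w g \<Longrightarrow> thesis"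
  shows thesis
  using assms unfolding graph_letters_def by blast

lemma exceptional_simps [simp]:
  "\<not> exceptional (WEdge f i)"
  "exceptional (WGhost g i) \<longleftrightarrow> i = 1 \<and> tail E g \<in> S"
  by (auto simp: exceptional_def)

lemma halves_eq: "halves v = (if v \<in> S then {False, True} else {False})"
  by (auto simp: halves_def)

lemma end_halves_subset: "end_halves a \<subseteq> halves (lrange E a)"
  by (auto simp: end_halves_def halves_def exceptional_def)

end

context lpa_condition
begin

lemma letter_source: "a \<in> graph_letters \<Longrightarrow> lsource E a \<in> verts E"
  and letter_range: "a \<in> graph_letters \<Longrightarrow> lrange E a \<in> verts E"
  by (auto elim!: graph_letters_cases simp: R_arcs)

text \<open>By injectivity of heads on \<open>R\<close>, no other reversed edge starts at
  \<open>head E g\<close>, and edges outside \<open>R\<close> never start in \<open>T\<close>. So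
  relation (iv) of \<open>F\<close> at this vertex is relation (iii) for \<open>g\<close>.\<close>

lemma letters_at_T:
  "g \<in> R \<Longrightarrow> {a \<in> graph_letters. lsource E a = head E g} = WGhost g ` {1..w g}"
proof (intro equalityI subsetI)
  fix a assume g: "g \<in> R" and "a \<in> {a \<in> graph_letters. lsource E a = head E g}"
  then have a: "a \<in> graph_letters" "lsource E a = head E g" by auto
  from a(1) show "a \<in> WGhost g ` {1..w g}"
  proof (cases rule: graph_letters_cases)
    case (edge f)
    then show ?thesis using a(2) R_head_T[OF g] not_R[of f] by simp
  next
    case (ghost g' i)
    then have "g' = g" using inj_onD[OF inj_on_head_R, of g' g] a(2) g by simp
    then show ?thesis using ghost by simp
  qed
qed auto

lemma letters_at_not_T:
  "x \<notin> T \<Longrightarrow> {a \<in> graph_letters. lsource E a = x} = (\<lambda>f. WEdge f 1) ` (out_arcs E x - R)"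
  using R_head_T by (auto elim!: graph_letters_cases)

lemma T_head_R: "x \<in> T \<Longrightarrow> \<exists>g\<in>R. x = head E g"
proof -
  assume x: "x \<in> T"
  then obtain e p where e: "e \<in> Wt" "awalk (head E e) p x" by (auto simp: T_iff)
  show ?thesis
  proof (cases p rule: rev_cases)
    case Nil
    then show ?thesis using e by (intro bexI[of _ e]) (auto simp: awalk_Nil_iff R_def)
  next
    case (snoc p' g)
    then have "awalk (head E e) p' (tail E g)" "g \<in> arcs E" "head E g = x" using e(2) by (auto simp: awalk_simps)
    moreover have "tail E g \<in> T" using walk_T[OF head_T[OF e(1)]] calculation(1) by blast
    ultimately show ?thesis by (intro bexI[of _ g]) (auto simp: R_def)
  qed
qed

lemma finite_letters_at: "x \<in> verts E \<Longrightarrow> finite {a \<in> graph_letters. lsource E a = x}"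
proof (cases "x \<in> T")
  case True
  then obtain g where "g \<in> R" "x = head E g" using T_head_R by blast
  then show ?thesis using letters_at_T by simp
next
  case False
  assume "x \<in> verts E"
  then show ?thesis unfolding letters_at_not_T[OF False] using finite_out_arcs by blast
qed

lemma F_vert_cases: "u \<in> verts F \<Longrightarrow> (\<And>v b. u = enc (WVertex v) b \<Longrightarrow> v \<in> verts E \<Longrightarrow> b \<in> halves v \<Longrightarrow> thesis) \<Longrightarrow> thesis"
  by (auto simp: F_def)

lemma F_arc_cases: "u \<in> arcs F \<Longrightarrow> (\<And>a b. u = enc a b \<Longrightarrow> a \<in> graph_letters \<Longrightarrow> b \<in> end_halves a \<Longrightarrow> thesis) \<Longrightarrow> thesis"
  by (auto simp: F_def)

lemma wf_F: "wf_digraph F"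
proof
  fix u assume "u \<in> arcs F"
  then show "tail F u \<in> verts F" "head F u \<in> verts F"
    using end_halves_subset letter_source letter_range
    by (auto elim!: F_arc_cases simp: halves_def) blast+
qed

lemma out_arcs_F:
  "out_arcs F (enc (WVertex x) b) = (if b then {} else (\<lambda>(a, b). enc a b) ` Sigma {a \<in> graph_letters. lsource E a = x} end_halves)"
  by (auto elim!: F_arc_cases simp: image_iff)

lemma row_finite_F: "row_finite F"
  unfolding row_finite_def
  by (auto elim!: F_vert_cases simp: out_arcs_F finite_letters_at intro!: finite_imageI finite_SigmaI)

lemma sum_out_arcs_F:
  assumes "x \<in> verts E"
  shows "(\<Sum>u \<in> out_arcs F (enc (WVertex x) False). \<phi> u) =
    (\<Sum>a \<in> {a \<in> graph_letters. lsource E a = x}. \<Sum>b\<in>end_halves a. \<phi> (enc a b))"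
proof -
  have "(\<Sum>u \<in> out_arcs F (enc (WVertex x) False). \<phi> u) =
      (\<Sum>p \<in> Sigma {a \<in> graph_letters. lsource E a = x} end_halves. \<phi> (enc (fst p) (snd p)))"
    unfolding out_arcs_F by (simp add: case_prod_beta) (rule sum.reindex_cong[OF _ refl], auto simp: inj_on_def)
  also have "\<dots> = (\<Sum>a \<in> {a \<in> graph_letters. lsource E a = x}. \<Sum>b\<in>end_halves a. \<phi> (enc a b))"
    by (subst sum.Sigma) (use finite_letters_at[OF assms] in \<open>auto simp: case_prod_beta\<close>)
  finally show ?thesis .
qed

end

subsection \<open>From the weighted to the unweighted algebra\<close>

context lpa_graph
begin

text \<open>With \<open>ed\<close> and \<open>gh\<close> exchanged, this yields the star of the
  letter.\<close>

primrec el :: "('v \<Rightarrow> 'r) \<Rightarrow> ('e \<Rightarrow> nat \<Rightarrow> 'r) \<Rightarrow> ('e \<Rightarrow> nat \<Rightarrow> 'r) \<Rightarrow> ('v, 'e) wlpa_gen \<Rightarrow> 'r" where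
  "el vx ed gh (WVertex v) = vx v"
| "el vx ed gh (WEdge e i) = ed e i"
| "el vx ed gh (WGhost e i) = gh e i"

definition half :: "('v \<Rightarrow> 'r::ring) \<Rightarrow> ('e \<Rightarrow> nat \<Rightarrow> 'r) \<Rightarrow> ('e \<Rightarrow> nat \<Rightarrow> 'r) \<Rightarrow> 'v \<Rightarrow> bool \<Rightarrow> 'r" where
  "half vx ed gh v b = (let q = ed (special v) 1 * gh (special v) 1 in
     if v \<in> S then if b then q else vx v - q else vx v)"

definition to_vertex where
  "to_vertex vx ed gh u = half vx ed gh (lsource E (fst (dec u))) (snd (dec u))"

definition to_edge where
  "to_edge vx ed gh u = el vx ed gh (fst (dec u)) * half vx ed gh (lrange E (fst (dec u))) (snd (dec u))"

definition to_ghost where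
  "to_ghost vx ed gh u = half vx ed gh (lrange E (fst (dec u))) (snd (dec u)) * el vx gh ed (fst (dec u))"

end

locale lpa_condition_weighted = lpa_condition E w + wlpa_family E w vx ed gh
  for E :: "('v, 'e) pre_digraph" and w :: "'e \<Rightarrow> nat"
    and vx :: "'v \<Rightarrow> 'r::ring" and ed gh :: "'e \<Rightarrow> nat \<Rightarrow> 'r"
begin

lemma sum_first:
  fixes t :: "nat \<Rightarrow> 'r"
  assumes "\<And>i. 1 < i \<Longrightarrow> t i = 0" "1 \<le> n"
  shows "(\<Sum>i = 1..n. t i) = t 1"
proof -
  have "(\<Sum>i = 1..n. t i) = (\<Sum>i \<in> {1}. t i)"
    using assms by (intro sum.mono_neutral_right) auto
  then show ?thesis by simp
qed

lemma gh_ed_unweighted: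
  assumes "e \<in> arcs E" "f \<in> arcs E" "tail E e = tail E f" "w e = 1 \<or> w f = 1"
  shows "gh e 1 * ed f 1 = (if e = f then vx (head E e) else 0)"
proof -
  have "1 \<le> vertex_weight E w (tail E e)"
    using weight_le_vertex_weight[OF assms(1)] arc_weight_pos[OF assms(1)] by simp
  moreover have "gh e i * ed f i = 0" if "1 < i" for i
    using assms(4) that ed_zero[of f i] gh_zero[of e i] by auto
  ultimately have "(\<Sum>i = 1..vertex_weight E w (tail E e). gh e i * ed f i) = gh e 1 * ed f 1"
    by (intro sum_first) auto
  then show ?thesis using gh_ed[of "tail E e" e f] assms by auto
qed

abbreviation "l \<equiv> el vx ed gh"
abbreviation "d \<equiv> el vx gh ed"
abbreviation "q v \<equiv> ed (special v) 1 * gh (special v) 1"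
abbreviation "h \<equiv> half vx ed gh"

lemma h_simps: "h v b = (if v \<in> S then if b then q v else vx v - q v else vx v)"
  by (simp add: half_def Let_def)

lemma l_vx: "a \<in> graph_letters \<Longrightarrow> l a * vx (lrange E a) = l a"
  and vx_l: "a \<in> graph_letters \<Longrightarrow> vx (lsource E a) * l a = l a"
  and d_vx: "a \<in> graph_letters \<Longrightarrow> d a * vx (lsource E a) = d a"
  and vx_d: "a \<in> graph_letters \<Longrightarrow> vx (lrange E a) * d a = d a"
  by (auto elim!: graph_letters_cases simp: ed_vx gh_vx vx_ed vx_gh R_arcs arc_weight_pos[unfolded One_nat_def])

lemma special_props:
  assumes "v \<in> S"
  shows "special v \<in> arcs E" "tail E (special v) = v" "1 \<le> w (special v)"
  using special_S[OF assms] Wt_arcs arc_weight_pos by auto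

lemma special_edge_zero:
  assumes "v \<in> S" "f \<in> out_arcs E v - R"
  shows "gh (special v) 1 * ed f 1 = 0" "gh f 1 * ed (special v) 1 = 0"
  using gh_ed_unweighted[of "special v" f] gh_ed_unweighted[of f "special v"]
    special_props[OF assms(1)] special_R[OF assms(1)] assms(2) not_R[of f] by auto

lemma split_vertex:
  assumes v: "v \<in> S"
  shows "q v + (\<Sum>f \<in> out_arcs E v - R. ed f 1 * gh f 1) = vx v"
proof -
  have vE: "v \<in> verts E" using S_verts[OF v] .
  have "1 \<le> vertex_weight E w v"
    using weight_le_vertex_weight[of "special v"] special_props[OF v] by auto
  then have "(\<Sum>f \<in> out_arcs E v. ed f 1 * gh f 1) = vx v" using ed_gh[OF vE, of 1 1] by simp
  then show ?thesis
    using finite_out_arcs[OF vE] special_R[OF v] by (subst (asm) out_arcs_S[OF v]) simp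
qed

lemma q_vx: "v \<in> S \<Longrightarrow> q v * vx v = q v" and vx_q: "v \<in> S \<Longrightarrow> vx v * q v = q v"
proof -
  assume v: "v \<in> S"
  show "q v * vx v = q v" using gh_vx[of "special v" 1] special_props[OF v] by (simp add: mult.assoc)
  show "vx v * q v = q v" using vx_ed[of "special v" 1] special_props[OF v] by (simp flip: mult.assoc)
qed

text \<open>For weighted \<open>g\<close>, relation (iii) does not give
  \<open>g_1^* g_1 = r(g)\<close>. Instead, \<open>v - q v\<close> is the sum of
  \<open>f f^*\<close> over the other edges, and these are orthogonal to \<open>g_1\<close>.\<close>

lemma q_idem: "v \<in> S \<Longrightarrow> q v * q v = q v"
proof -
  assume v: "v \<in> S"
  have "q v * (\<Sum>f \<in> out_arcs E v - R. ed f 1 * gh f 1) = (\<Sum>f \<in> out_arcs E v - R. ed (special v) 1 * (gh (special v) 1 * ed f 1) * gh f 1)"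
    by (simp add: sum_distrib_left mult.assoc)
  also have "\<dots> = 0" using special_edge_zero(1)[OF v] by (intro sum.neutral) simp
  finally have "q v * (vx v - q v) = 0" using split_vertex[OF v] by (metis add_diff_cancel_left')
  then show ?thesis using q_vx[OF v] by (simp add: right_diff_distrib)
qed

lemma h_h: "v \<in> verts E \<Longrightarrow> b \<in> halves v \<Longrightarrow> b' \<in> halves v \<Longrightarrow> h v b * h v b' = (if b = b' then h v b else 0)"
  using vx_vx[of v v] q_vx[of v] vx_q[of v] q_idem[of v]
  by (auto simp: h_simps halves_eq left_diff_distrib right_diff_distrib split: if_splits)

lemma vx_h: "v \<in> verts E \<Longrightarrow> vx v * h v b = h v b" and h_vx: "v \<in> verts E \<Longrightarrow> h v b * vx v = h v b"
  using vx_vx[of v v] q_vx[of v] vx_q[of v] by (auto simp: h_simps left_diff_distrib right_diff_distrib)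

lemma sum_h: "(\<Sum>b\<in>halves v. h v b) = vx v"
  by (auto simp: halves_eq h_simps)

lemma h_source_l: "a \<in> graph_letters \<Longrightarrow> h (lsource E a) False * l a = l a"
  and d_h_source: "a \<in> graph_letters \<Longrightarrow> d a * h (lsource E a) False = d a"
proof -
  assume a: "a \<in> graph_letters"
  have "h (lsource E a) False * l a = l a \<and> d a * h (lsource E a) False = d a"
  proof (cases "lsource E a \<in> S")
    case False
    then show ?thesis using vx_l[OF a] d_vx[OF a] by (simp add: h_simps)
  next
    case True
    from a show ?thesis
    proof (cases rule: graph_letters_cases)
      case (edge f)
      then have S: "tail E f \<in> S" and f: "f \<in> out_arcs E (tail E f) - R" using True by auto
      have "q (tail E f) * ed f 1 = ed (special (tail E f)) 1 * (gh (special (tail E f)) 1 * ed f 1)" by (simp only: mult.assoc)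
      moreover have "gh f 1 * q (tail E f) = (gh f 1 * ed (special (tail E f)) 1) * gh (special (tail E f)) 1" by (simp only: mult.assoc)
      ultimately show ?thesis
        using special_edge_zero[OF S f] vx_l[OF a] d_vx[OF a] S edge(1)
        by (simp add: h_simps left_diff_distrib right_diff_distrib)
    next
      case (ghost g i)
      then show ?thesis using True S_T R_head_T by auto
    qed
  qed
  then show "h (lsource E a) False * l a = l a" "d a * h (lsource E a) False = d a" by auto
qed

text \<open>For two letters \<open>g_i^*\<close> and \<open>g_j^*\<close> this is relation (iv) at
  the source of \<open>g\<close>. The other edges there have weight 1 and contribute only for
  \<open>i = j = 1\<close>, which is why only \<open>g_1^*\<close> can be exceptional.\<close>

lemma d_l:
  assumes "a \<in> graph_letters" "a' \<in> graph_letters" "lsource E a = lsource E a'"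
  shows "d a * l a' = (if a = a' then if exceptional a then q (lrange E a) else vx (lrange E a) else 0)"
  using assms(1)
proof (cases rule: graph_letters_cases)
  case (edge f)
  note f = this
  from assms(2) show ?thesis
  proof (cases rule: graph_letters_cases)
    case (edge f')
    then show ?thesis using f assms(3) gh_ed_unweighted[of f f'] not_R[of f] by simp
  next
    case (ghost g i)
    then show ?thesis using f assms(3) R_head_T[of g] not_R[of f] by simp
  qed
next
  case (ghost g i)
  note g = this
  from assms(2) show ?thesis
  proof (cases rule: graph_letters_cases)
    case (edge f)
    then show ?thesis using g assms(3) R_head_T[of g] not_R[of f] by simp
  next
    case (ghost g' j)
    then have "g = g'" using inj_onD[OF inj_on_head_R, of g g'] g assms(3) by simp
    let ?v = "tail E g"
    have v: "?v \<in> verts E" using g R_arcs by auto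
    have W: "vertex_weight E w ?v = w g" using vertex_weight_R g by simp
    then have sum: "(\<Sum>e\<in>out_arcs E ?v. ed e i * gh e j) = (if i = j then vx ?v else 0)"
      using ed_gh[OF v, of i j] g ghost \<open>g = g'\<close> by auto
    show ?thesis
    proof (cases "?v \<in> S")
      case False
      then show ?thesis using sum R_only[OF g(2)] g ghost \<open>g = g'\<close> by auto
    next
      case True
      then have sp: "g = special ?v" using R_special g by blast
      show ?thesis
      proof (cases "i = 1 \<and> j = 1")
        case True
        then show ?thesis using \<open>?v \<in> S\<close> sp g ghost \<open>g = g'\<close> by simp
      next
        case ij: False
        have "ed f i * gh f j = 0" if "f \<in> out_arcs E ?v - R" for f
          using ij g ghost not_R[of f] that ed_zero[of f i] gh_zero[of f j] by auto
        then have "(\<Sum>e\<in>out_arcs E ?v. ed e i * gh e j) = ed g i * gh g j"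
          using finite_out_arcs[OF v] special_R[OF \<open>?v \<in> S\<close>]
          by (subst out_arcs_S[OF \<open>?v \<in> S\<close>]) (simp add: sp[symmetric])
        then show ?thesis using sum ij g ghost \<open>g = g'\<close> by auto
      qed
    qed
  qed
qed

text \<open>\<open>g_1^*\<close> annihilates \<open>v - q v\<close>, a sum of terms
  \<open>f f^*\<close> with \<open>g_1^* f = 0\<close>; dually for \<open>g_1\<close>.\<close>

lemma exceptional_q:
  assumes "a \<in> graph_letters" "exceptional a"
  shows "l a * q (lrange E a) = l a" "q (lrange E a) * d a = d a"
proof -
  obtain g where a: "a = WGhost g 1" "g \<in> R" "tail E g \<in> S" using assms by (auto simp: exceptional_def)
  let ?v = "tail E g"
  have sp: "g = special ?v" using R_special a by blast
  have g: "g \<in> arcs E" "1 \<le> w g" using a R_arcs arc_weight_pos by auto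
  have "gh g 1 * (\<Sum>f \<in> out_arcs E ?v - R. ed f 1 * gh f 1) = (\<Sum>f \<in> out_arcs E ?v - R. (gh g 1 * ed f 1) * gh f 1)"
    by (simp add: sum_distrib_left mult.assoc)
  also have "\<dots> = 0" using special_edge_zero(1)[OF a(3)] sp by (intro sum.neutral) simp
  finally have "gh g 1 * (vx ?v - q ?v) = 0" using split_vertex[OF a(3)] by (metis add_diff_cancel_left')
  then show "l a * q (lrange E a) = l a" using gh_vx[of g 1] g a by (simp add: right_diff_distrib)
  have "(\<Sum>f \<in> out_arcs E ?v - R. ed f 1 * gh f 1) * ed g 1 = (\<Sum>f \<in> out_arcs E ?v - R. ed f 1 * (gh f 1 * ed g 1))"
    by (simp add: sum_distrib_right mult.assoc)
  also have "\<dots> = 0" using special_edge_zero(2)[OF a(3)] sp by (intro sum.neutral) simp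
  finally have "(vx ?v - q ?v) * ed g 1 = 0" using split_vertex[OF a(3)] by (metis add_diff_cancel_left')
  then show "q (lrange E a) * d a = d a" using vx_ed[of g 1] g a by (simp add: left_diff_distrib)
qed

text \<open>At a vertex of \<open>T\<close> this is relation (iii) for the edge of \<open>R\<close>
  that ends there. Elsewhere it is relation (iv) with \<open>i = j = 1\<close>, from which at a
  split vertex the summand \<open>q x\<close> is taken away.\<close>

lemma sum_l_d:
  assumes x: "x \<in> verts E" and ne: "{a \<in> graph_letters. lsource E a = x} \<noteq> {}"
  shows "(\<Sum>a \<in> {a \<in> graph_letters. lsource E a = x}. l a * d a) = h x False"
proof (cases "x \<in> T")
  case True
  then obtain g where g: "g \<in> R" "x = head E g" using T_head_R by blast
  have "(\<Sum>a \<in> {a \<in> graph_letters. lsource E a = x}. l a * d a) = (\<Sum>i = 1..w g. gh g i * ed g i)"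
    unfolding g(2) letters_at_T[OF g(1)] by (subst sum.reindex) (auto simp: inj_on_def)
  also have "\<dots> = vx x"
    using gh_ed[of "tail E g" g g] vertex_weight_R[OF g(1)] R_arcs[OF g(1)] g by simp
  finally show ?thesis using True S_T by (auto simp: h_simps)
next
  case False
  have eq: "(\<Sum>a \<in> {a \<in> graph_letters. lsource E a = x}. l a * d a) = (\<Sum>f \<in> out_arcs E x - R. ed f 1 * gh f 1)"
    unfolding letters_at_not_T[OF False] by (subst sum.reindex) (auto simp: inj_on_def)
  show ?thesis
  proof (cases "x \<in> S")
    case True
    then show ?thesis unfolding eq using split_vertex[OF True] by (simp add: h_simps eq_diff_eq add.commute)
  next
    case xS: False
    have "out_arcs E x - R \<noteq> {}" using ne unfolding letters_at_not_T[OF False] by blast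
    then obtain f where f: "f \<in> out_arcs E x" "f \<notin> R" by blast
    have out: "out_arcs E x - R = out_arcs E x" by (rule out_arcs_not_R[OF xS f])
    have "vertex_weight E w x = 1" using vertex_weight_not_R[OF x out] f by blast
    then show ?thesis unfolding eq out using ed_gh[OF x, of 1 1] xS by (simp add: h_simps)
  qed
qed

lemma lpa_family_F: "lpa_family F (to_vertex vx ed gh) (to_edge vx ed gh) (to_ghost vx ed gh)"
proof
  fix u v assume "u \<in> verts F" "v \<in> verts F"
  then obtain x b y b' where u: "u = enc (WVertex x) b" "x \<in> verts E" "b \<in> halves x"
    and v: "v = enc (WVertex y) b'" "y \<in> verts E" "b' \<in> halves y" by (metis F_vert_cases)
  show "to_vertex vx ed gh u * to_vertex vx ed gh v = (if u = v then to_vertex vx ed gh u else 0)"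
  proof (cases "x = y")
    case True
    then show ?thesis using h_h u v by (simp add: to_vertex_def)
  next
    case False
    have "h x b * h y b' = h x b * (vx x * vx y) * h y b'"
      using vx_h[OF v(2)] h_vx[OF u(2)] by (metis mult.assoc)
    also have "\<dots> = 0" using vx_vx[OF u(2) v(2)] False by simp
    finally show ?thesis using u v False by (simp add: to_vertex_def)
  qed
next
  fix u assume "u \<in> arcs F"
  then obtain a b where u: "u = enc a b" "a \<in> graph_letters" "b \<in> end_halves a" by (rule F_arc_cases)
  have b: "b \<in> halves (lrange E a)" using u end_halves_subset by blast
  note r = letter_range[OF u(2)]
  show "to_vertex vx ed gh (tail F u) * to_edge vx ed gh u = to_edge vx ed gh u"
    using h_source_l[OF u(2)] by (simp add: to_vertex_def to_edge_def u flip: mult.assoc)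
  show "to_edge vx ed gh u * to_vertex vx ed gh (head F u) = to_edge vx ed gh u"
    using h_h[OF r b b] by (simp add: to_vertex_def to_edge_def u mult.assoc)
  show "to_vertex vx ed gh (head F u) * to_ghost vx ed gh u = to_ghost vx ed gh u"
    using h_h[OF r b b] by (simp add: to_vertex_def to_ghost_def u flip: mult.assoc)
  show "to_ghost vx ed gh u * to_vertex vx ed gh (tail F u) = to_ghost vx ed gh u"
    using d_h_source[OF u(2)] by (simp add: to_vertex_def to_ghost_def u mult.assoc)
next
  fix v u u' assume "v \<in> verts F" and uu': "u \<in> out_arcs F v" "u' \<in> out_arcs F v"
  then have "u \<in> arcs F" "u' \<in> arcs F" and tails: "tail F u = tail F u'" by auto
  then obtain a b a' b' where u: "u = enc a b" "a \<in> graph_letters" "b \<in> end_halves a"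
    and u': "u' = enc a' b'" "a' \<in> graph_letters" "b' \<in> end_halves a'" by (metis F_arc_cases)
  have src: "lsource E a = lsource E a'" using tails u u' by simp
  let ?y = "lrange E a"
  have y: "?y \<in> verts E" using letter_range[OF u(2)] .
  have b: "b \<in> halves ?y" using u end_halves_subset by blast
  have "to_ghost vx ed gh u * to_edge vx ed gh u' = h ?y b * (d a * l a') * h (lrange E a') b'"
    by (simp add: to_ghost_def to_edge_def u u' mult.assoc)
  also have "\<dots> = (if u = u' then to_vertex vx ed gh (head F u) else 0)"
  proof (cases "a = a'")
    case False
    then show ?thesis using d_l[OF u(2) u'(2) src] u u' by simp
  next
    case True
    have b': "b' \<in> halves ?y" using u' end_halves_subset True by blast
    show ?thesis
    proof (cases "exceptional a")
      case ex: True
      then have bb: "b" "b'" using u u' True by (simp_all add: end_halves_def)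
      have S: "?y \<in> S" using ex by (auto simp: exceptional_def)
      show ?thesis
        using d_l[OF u(2) u'(2) src] ex True bb S q_idem[OF S] u u'
        by (simp add: h_simps to_vertex_def)
    next
      case False
      then show ?thesis
        using d_l[OF u(2) u'(2) src] True u u' h_h[OF y b b'] h_vx[OF y, of b]
        by (simp add: to_vertex_def)
    qed
  qed
  finally show "to_ghost vx ed gh u * to_edge vx ed gh u' = (if u = u' then to_vertex vx ed gh (head F u) else 0)" .
next
  fix v assume "v \<in> verts F" and ne: "out_arcs F v \<noteq> {}"
  then obtain x b where v: "v = enc (WVertex x) b" "x \<in> verts E" by (metis F_vert_cases)
  have b: "\<not> b" using ne unfolding v out_arcs_F by auto
  let ?A = "{a \<in> graph_letters. lsource E a = x}"
  have "?A \<noteq> {}" using ne b unfolding v out_arcs_F by auto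
  have "(\<Sum>u\<in>out_arcs F v. to_edge vx ed gh u * to_ghost vx ed gh u) =
      (\<Sum>a \<in> ?A. \<Sum>b\<in>end_halves a. l a * h (lrange E a) b * (h (lrange E a) b * d a))"
    using b unfolding v by (simp add: sum_out_arcs_F[OF v(2)] to_edge_def to_ghost_def)
  also have "\<dots> = (\<Sum>a \<in> ?A. l a * d a)"
  proof (rule sum.cong[OF refl])
    fix a assume "a \<in> ?A"
    then have a: "a \<in> graph_letters" by simp
    let ?y = "lrange E a"
    have y: "?y \<in> verts E" using letter_range[OF a] .
    have "(\<Sum>b\<in>end_halves a. l a * h ?y b * (h ?y b * d a)) = (\<Sum>b\<in>end_halves a. l a * (h ?y b * h ?y b) * d a)"
      by (simp add: mult.assoc)
    also have "\<dots> = (\<Sum>b\<in>end_halves a. l a * h ?y b * d a)"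
      using h_h[OF y] end_halves_subset[of a] by (intro sum.cong refl) auto
    also have "\<dots> = l a * (\<Sum>b\<in>end_halves a. h ?y b) * d a"
      by (simp add: sum_distrib_left sum_distrib_right)
    also have "\<dots> = l a * d a"
    proof (cases "exceptional a")
      case True
      then have "?y \<in> S" by (auto simp: exceptional_def)
      then show ?thesis using True exceptional_q(1)[OF a True] by (simp add: end_halves_def h_simps)
    next
      case False
      then show ?thesis using l_vx[OF a] by (simp add: end_halves_def sum_h)
    qed
    finally show "(\<Sum>b\<in>end_halves a. l a * h ?y b * (h ?y b * d a)) = l a * d a" .
  qed
  also have "\<dots> = to_vertex vx ed gh v"
    using sum_l_d[OF v(2) \<open>?A \<noteq> {}\<close>] b by (simp add: to_vertex_def v)
  finally show "(\<Sum>u\<in>out_arcs F v. to_edge vx ed gh u * to_ghost vx ed gh u) = to_vertex vx ed gh v" .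
qed

end

subsection \<open>From the unweighted to the weighted algebra\<close>

context lpa_graph
begin

definition total :: "(('v, 'e) universe \<Rightarrow> 'r::ring) \<Rightarrow> ('v, 'e) wlpa_gen \<Rightarrow> 'r" where
  "total f a = (\<Sum>b\<in>end_halves a. f (enc a b))"

definition from_vertex :: "(('v, 'e) universe \<Rightarrow> 'r::ring) \<Rightarrow> 'v \<Rightarrow> 'r" where
  "from_vertex vx v = (\<Sum>b\<in>halves v. vx (enc (WVertex v) b))"

definition from_edge where
  "from_edge ed gh e i = (if e \<in> R then total gh (WGhost e i) else total ed (WEdge e i))"

definition from_ghost where
  "from_ghost ed gh e i = (if e \<in> R then total ed (WGhost e i) else total gh (WEdge e i))"

end

context lpa_condition
begin

lemma letter_edge:
  assumes "e \<in> arcs E" "1 \<le> i" "i \<le> w e"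
  shows "e \<in> R \<Longrightarrow> WGhost e i \<in> graph_letters" "e \<notin> R \<Longrightarrow> i = 1 \<and> WEdge e i \<in> graph_letters"
  using assms not_R[of e] by auto

end

locale lpa_condition_unweighted = lpa_condition E w + fam: lpa_family "lpa_graph.F E w" vx ed gh
  for E :: "('v, 'e) pre_digraph" and w :: "'e \<Rightarrow> nat"
    and vx :: "('v, 'e) universe \<Rightarrow> 'r::ring" and ed gh :: "('v, 'e) universe \<Rightarrow> 'r"
begin

abbreviation "tv a b \<equiv> vx (enc (WVertex a) b)"

lemma tv_tv:
  "u \<in> verts E \<Longrightarrow> v \<in> verts E \<Longrightarrow> b \<in> halves u \<Longrightarrow> b' \<in> halves v \<Longrightarrow>
    tv u b * tv v b' = (if u = v \<and> b = b' then tv u b else 0)"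
  using fam.vx_vx[of "enc (WVertex u) b" "enc (WVertex v) b'"] by simp

lemma False_halves [simp]: "False \<in> halves v"
  by (simp add: halves_def)

lemma end_halves_letter: "b \<in> end_halves a \<Longrightarrow> b \<in> halves (lrange E a)"
  using end_halves_subset by blast

lemma arc_relations:
  assumes "a \<in> graph_letters" "b \<in> end_halves a"
  shows "tv (lsource E a) False * ed (enc a b) = ed (enc a b)" "ed (enc a b) * tv (lrange E a) b = ed (enc a b)"
    "tv (lrange E a) b * gh (enc a b) = gh (enc a b)" "gh (enc a b) * tv (lsource E a) False = gh (enc a b)"
  using fam.vx_ed[of "enc a b"] fam.ed_vx[of "enc a b"] fam.vx_gh[of "enc a b"] fam.gh_vx[of "enc a b"] assms by simp_all

lemma gh_ed_letters:
  assumes "a \<in> graph_letters" "a' \<in> graph_letters" "lsource E a = lsource E a'" "b \<in> end_halves a" "b' \<in> end_halves a'"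
  shows "gh (enc a b) * ed (enc a' b') = (if a = a' \<and> b = b' then tv (lrange E a) b else 0)"
  using fam.gh_ed[of "enc (WVertex (lsource E a)) False" "enc a b" "enc a' b'"] assms letter_source[OF assms(1)] by auto

lemma from_vertex_half:
  assumes "v \<in> verts E" "b \<in> halves v"
  shows "from_vertex vx v * tv v b = tv v b" "tv v b * from_vertex vx v = tv v b"
proof -
  have "from_vertex vx v * tv v b = (\<Sum>b'\<in>halves v. if b' = b then tv v b else 0)"
    unfolding from_vertex_def sum_distrib_right using assms by (intro sum.cong refl) (auto simp: tv_tv)
  then show "from_vertex vx v * tv v b = tv v b" using assms by (simp add: sum.delta)
  have "tv v b * from_vertex vx v = (\<Sum>b'\<in>halves v. if b' = b then tv v b else 0)"
    unfolding from_vertex_def sum_distrib_left using assms by (intro sum.cong refl) (auto simp: tv_tv)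
  then show "tv v b * from_vertex vx v = tv v b" using assms by (simp add: sum.delta)
qed

lemma total_relations:
  assumes a: "a \<in> graph_letters"
  shows "from_vertex vx (lsource E a) * total ed a = total ed a" "total ed a * from_vertex vx (lrange E a) = total ed a"
    "from_vertex vx (lrange E a) * total gh a = total gh a" "total gh a * from_vertex vx (lsource E a) = total gh a"
proof -
  note s = from_vertex_half[OF letter_source[OF a], of False] and r = from_vertex_half[OF letter_range[OF a]]
  have "from_vertex vx (lsource E a) * ed (enc a b) = ed (enc a b)" "gh (enc a b) * from_vertex vx (lsource E a) = gh (enc a b)"
    "ed (enc a b) * from_vertex vx (lrange E a) = ed (enc a b)" "from_vertex vx (lrange E a) * gh (enc a b) = gh (enc a b)"
    if b: "b \<in> end_halves a" for b
  proof -
    note A = arc_relations[OF a b]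
    show "from_vertex vx (lsource E a) * ed (enc a b) = ed (enc a b)"
      using A(1) s(1) by (metis False_halves mult.assoc)
    show "gh (enc a b) * from_vertex vx (lsource E a) = gh (enc a b)"
      using A(4) s(2) by (metis False_halves mult.assoc)
    show "ed (enc a b) * from_vertex vx (lrange E a) = ed (enc a b)"
      using A(2) r(2)[OF end_halves_letter[OF b]] by (metis mult.assoc)
    show "from_vertex vx (lrange E a) * gh (enc a b) = gh (enc a b)"
      using A(3) r(1)[OF end_halves_letter[OF b]] by (metis mult.assoc)
  qed
  then show "from_vertex vx (lsource E a) * total ed a = total ed a" "total ed a * from_vertex vx (lrange E a) = total ed a"
    "from_vertex vx (lrange E a) * total gh a = total gh a" "total gh a * from_vertex vx (lsource E a) = total gh a"
    by (simp_all add: total_def sum_distrib_left sum_distrib_right)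
qed

lemma total_gh_ed:
  assumes "a \<in> graph_letters" "a' \<in> graph_letters" "lsource E a = lsource E a'"
  shows "total gh a * total ed a' = (if a = a' then \<Sum>b\<in>end_halves a. tv (lrange E a) b else 0)"
proof -
  have "total gh a * total ed a' = (\<Sum>b\<in>end_halves a. \<Sum>b'\<in>end_halves a'. if a = a' \<and> b = b' then tv (lrange E a) b else 0)"
    unfolding total_def sum_product using assms by (intro sum.cong refl) (auto simp: gh_ed_letters)
  also have "\<dots> = (if a = a' then \<Sum>b\<in>end_halves a. tv (lrange E a) b else 0)"
    by (auto simp: sum.delta intro!: sum.cong)
  finally show ?thesis .
qed

text \<open>Mixed products pass through two orthogonal halves of the range.\<close>

lemma total_ed_gh:
  assumes a: "a \<in> graph_letters"
  shows "total ed a * total gh a = (\<Sum>b\<in>end_halves a. ed (enc a b) * gh (enc a b))"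
proof -
  have "ed (enc a b) * gh (enc a b') = (if b = b' then ed (enc a b) * gh (enc a b) else 0)"
    if "b \<in> end_halves a" "b' \<in> end_halves a" for b b'
  proof -
    have "ed (enc a b) * gh (enc a b') = ed (enc a b) * (tv (lrange E a) b * tv (lrange E a) b') * gh (enc a b')"
      using arc_relations(2)[OF a that(1)] arc_relations(3)[OF a that(2)] by (metis mult.assoc)
    then show ?thesis
      using tv_tv[OF letter_range[OF a] letter_range[OF a]] that end_halves_letter by auto
  qed
  then have "total ed a * total gh a = (\<Sum>b\<in>end_halves a. \<Sum>b'\<in>end_halves a. if b = b' then ed (enc a b) * gh (enc a b) else 0)"
    unfolding total_def sum_product by (intro sum.cong refl) auto
  then show ?thesis by (simp add: sum.delta)
qed

lemma sum_total_ed_gh: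
  assumes x: "x \<in> verts E" and ne: "{a \<in> graph_letters. lsource E a = x} \<noteq> {}"
  shows "(\<Sum>a \<in> {a \<in> graph_letters. lsource E a = x}. total ed a * total gh a) = tv x False"
proof -
  obtain a where a: "a \<in> graph_letters" "lsource E a = x" using ne by blast
  have "end_halves a \<noteq> {}" by (auto simp: end_halves_def halves_def)
  then have "out_arcs F (enc (WVertex x) False) \<noteq> {}" using a unfolding out_arcs_F by auto
  then have "tv x False = (\<Sum>u \<in> out_arcs F (enc (WVertex x) False). ed u * gh u)"
    using fam.ed_gh x by simp
  also have "\<dots> = (\<Sum>a \<in> {a \<in> graph_letters. lsource E a = x}. \<Sum>b\<in>end_halves a. ed (enc a b) * gh (enc a b))"
    by (rule sum_out_arcs_F[OF x])
  also have "\<dots> = (\<Sum>a \<in> {a \<in> graph_letters. lsource E a = x}. total ed a * total gh a)"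
    by (intro sum.cong refl) (simp add: total_ed_gh)
  finally show ?thesis by simp
qed

abbreviation "V \<equiv> from_vertex vx"
abbreviation "ED e i \<equiv> (if i \<le> w e then from_edge ed gh e i else 0)"
abbreviation "GH e i \<equiv> (if i \<le> w e then from_ghost ed gh e i else 0)"

lemma V_V: "u \<in> verts E \<Longrightarrow> v \<in> verts E \<Longrightarrow> V u * V v = (if u = v then V u else 0)"
proof -
  assume uv: "u \<in> verts E" "v \<in> verts E"
  show ?thesis
  proof (cases "u = v")
    case True
    have "V u * V u = (\<Sum>b\<in>halves u. V u * tv u b)" by (simp add: from_vertex_def sum_distrib_left)
    also have "\<dots> = V u" using from_vertex_half(1)[OF uv(1)] by (simp add: from_vertex_def[of vx u])
    finally show ?thesis using True by simp
  next
    case False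
    then show ?thesis
      using uv by (simp add: from_vertex_def sum_product tv_tv)
  qed
qed

text \<open>\<open>g_1^*\<close> ends in the half \<open>True\<close> of the source of
  \<open>g\<close>, whereas \<open>f\<close> starts in its half \<open>False\<close>.\<close>

lemma halves_orthogonal:
  assumes "g \<in> R" "tail E g \<in> S" "f \<in> out_arcs E (tail E g)" "f \<notin> R"
  shows "total ed (WGhost g 1) * total ed (WEdge f 1) = 0" "total gh (WEdge f 1) * total gh (WGhost g 1) = 0"
proof -
  let ?v = "tail E g"
  have v: "?v \<in> verts E" using assms(2) S_verts by blast
  have g: "WGhost g 1 \<in> graph_letters" and f: "WEdge f 1 \<in> graph_letters"
    using assms R_arcs arc_weight_pos by auto
  have gT: "True \<in> end_halves (WGhost g 1)" "total x (WGhost g 1) = x (enc (WGhost g 1) True)" for x :: "_ \<Rightarrow> 'r"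
    using assms(2) by (simp_all add: end_halves_def total_def)
  have T: "True \<in> halves ?v" using assms(2) by (simp add: halves_def)
  have tf: "lsource E (WEdge f 1) = ?v" "lrange E (WGhost g 1) = ?v" using assms(3) by auto
  have zero: "tv ?v True * tv ?v False = 0" "tv ?v False * tv ?v True = 0"
    using tv_tv[OF v v] T by simp_all
  have A: "ed (enc (WGhost g 1) True) * tv ?v True = ed (enc (WGhost g 1) True)"
      "tv ?v True * gh (enc (WGhost g 1) True) = gh (enc (WGhost g 1) True)"
    using arc_relations(2,3)[OF g gT(1)] by simp_all
  have "total ed (WGhost g 1) * ed (enc (WEdge f 1) b) = 0" if b: "b \<in> end_halves (WEdge f 1)" for b
  proof -
    have "total ed (WGhost g 1) * ed (enc (WEdge f 1) b) =
        (ed (enc (WGhost g 1) True) * tv ?v True) * (tv ?v False * ed (enc (WEdge f 1) b))"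
      using arc_relations(1)[OF f b] by (simp only: gT(2) A tf)
    also have "\<dots> = ed (enc (WGhost g 1) True) * (tv ?v True * tv ?v False) * ed (enc (WEdge f 1) b)"
      by (simp only: mult.assoc)
    also have "\<dots> = 0" by (simp only: zero mult_zero_left mult_zero_right)
    finally show ?thesis .
  qed
  then show "total ed (WGhost g 1) * total ed (WEdge f 1) = 0"
    unfolding total_def[of _ "WEdge f 1"] by (simp add: sum_distrib_left)
  have "gh (enc (WEdge f 1) b) * total gh (WGhost g 1) = 0" if b: "b \<in> end_halves (WEdge f 1)" for b
  proof -
    have "gh (enc (WEdge f 1) b) * total gh (WGhost g 1) =
        (gh (enc (WEdge f 1) b) * tv ?v False) * (tv ?v True * gh (enc (WGhost g 1) True))"
      using arc_relations(4)[OF f b] by (simp only: gT(2) A tf)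
    also have "\<dots> = gh (enc (WEdge f 1) b) * (tv ?v False * tv ?v True) * gh (enc (WGhost g 1) True)"
      by (simp only: mult.assoc)
    also have "\<dots> = 0" by (simp only: zero mult_zero_left mult_zero_right)
    finally show ?thesis .
  qed
  then show "total gh (WEdge f 1) * total gh (WGhost g 1) = 0"
    unfolding total_def[of _ "WEdge f 1"] by (simp add: sum_distrib_right)
qed

text \<open>If both edges are in \<open>R\<close>, they coincide and this is relation (iv) of
  \<open>F\<close> at their head. If exactly one is, the halves are orthogonal; if none is, this is
  relation (iii) of \<open>F\<close>. In the last two cases one weight is 1, so only
  \<open>i = 1\<close> contributes.\<close>

lemma GH_ED:
  assumes v: "v \<in> verts E" and e: "e \<in> out_arcs E v" and f: "f \<in> out_arcs E v"
  shows "(\<Sum>i = 1..vertex_weight E w v. GH e i * ED f i) = (if e = f then V (head E e) else 0)"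
proof -
  have arcs: "e \<in> arcs E" "f \<in> arcs E" "tail E e = v" "tail E f = v" using e f by auto
  have W: "1 \<le> vertex_weight E w v" using weight_le_vertex_weight[of e] arc_weight_pos[of e] arcs by simp
  have first: "(\<Sum>i = 1..vertex_weight E w v. GH e i * ED f i) = GH e 1 * ED f 1" if "w e = 1 \<or> w f = 1"
  proof -
    have "(\<Sum>i = 1..vertex_weight E w v. GH e i * ED f i) = (\<Sum>i \<in> {1}. GH e i * ED f i)"
      using that W by (intro sum.mono_neutral_right) auto
    then show ?thesis by simp
  qed
  have w1: "1 \<le> w e" "1 \<le> w f" using arcs arc_weight_pos by auto
  have S: "v \<in> S" if "g \<in> R" "h \<notin> R" "g \<in> out_arcs E v" "h \<in> out_arcs E v" for g h
    using R_only[OF that(1)] that by (metis in_out_arcs_conv singletonD)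
  show ?thesis
  proof (cases "e \<in> R")
    case eR: True
    show ?thesis
    proof (cases "f \<in> R")
      case True
      then have "e = f" using R_same_tail eR arcs by simp
      have W: "vertex_weight E w v = w e" using vertex_weight_R[OF eR] arcs by simp
      let ?A = "{a \<in> graph_letters. lsource E a = head E e}"
      have "?A \<noteq> {}" using eR w1 unfolding letters_at_T[OF eR] by auto
      have "(\<Sum>i = 1..vertex_weight E w v. GH e i * ED f i) = (\<Sum>i = 1..w e. total ed (WGhost e i) * total gh (WGhost e i))"
        unfolding W using eR \<open>e = f\<close> by (intro sum.cong refl) (simp add: from_edge_def from_ghost_def)
      also have "\<dots> = (\<Sum>a\<in>?A. total ed a * total gh a)"
        unfolding letters_at_T[OF eR] by (subst sum.reindex) (auto simp: inj_on_def)
      also have "\<dots> = tv (head E e) False" using arcs by (intro sum_total_ed_gh \<open>?A \<noteq> {}\<close>) simp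
      also have "\<dots> = V (head E e)" using R_head_T[OF eR] S_T by (auto simp: from_vertex_def halves_eq)
      finally show ?thesis using \<open>e = f\<close> by simp
    next
      case False
      then have "w f = 1" "e \<noteq> f" using not_R arcs eR by auto
      moreover have "GH e 1 * ED f 1 = 0"
        using halves_orthogonal(1)[of e f] eR False S[OF eR False e f] arcs w1
        by (simp add: from_edge_def from_ghost_def)
      ultimately show ?thesis using first by simp
    qed
  next
    case eR: False
    then have we: "w e = 1" using not_R arcs by simp
    show ?thesis
    proof (cases "f \<in> R")
      case True
      then have "GH e 1 * ED f 1 = 0"
        using halves_orthogonal(2)[of f e] eR True S[OF True eR f e] arcs w1
        by (simp add: from_edge_def from_ghost_def)
      then show ?thesis using first we eR True by auto
    next
      case False
      have "GH e 1 * ED f 1 = total gh (WEdge e 1) * total ed (WEdge f 1)"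
        using eR False w1 by (simp add: from_edge_def from_ghost_def)
      also have "\<dots> = (if e = f then V (head E e) else 0)"
        using total_gh_ed[of "WEdge e 1" "WEdge f 1"] eR False arcs by (simp add: end_halves_def from_vertex_def)
      finally show ?thesis using first we by simp
    qed
  qed
qed

lemma sum_not_R:
  assumes v: "v \<in> verts E" "v \<notin> T" and ne: "out_arcs E v - R \<noteq> {}"
  shows "(\<Sum>f \<in> out_arcs E v - R. ED f 1 * GH f 1) = tv v False"
proof -
  have "(\<Sum>f \<in> out_arcs E v - R. ED f 1 * GH f 1) = (\<Sum>f \<in> out_arcs E v - R. total ed (WEdge f 1) * total gh (WEdge f 1))"
    using arc_weight_pos by (intro sum.cong refl) (auto simp: from_edge_def from_ghost_def)
  also have "\<dots> = (\<Sum>a \<in> {a \<in> graph_letters. lsource E a = v}. total ed a * total gh a)"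
    unfolding letters_at_not_T[OF v(2)] by (subst sum.reindex) (auto simp: inj_on_def)
  also have "\<dots> = tv v False"
    using ne unfolding letters_at_not_T[OF v(2), symmetric] by (intro sum_total_ed_gh v) (use ne letters_at_not_T[OF v(2)] in blast)
  finally show ?thesis .
qed

lemma ED_GH_R:
  assumes g: "g \<in> R" and i: "1 \<le> i" "i \<le> w g" and j: "1 \<le> j" "j \<le> w g"
  shows "ED g i * GH g j = (if i = j then if i = 1 \<and> tail E g \<in> S then tv (tail E g) True else V (tail E g) else 0)"
proof -
  have "ED g i * GH g j = total gh (WGhost g i) * total ed (WGhost g j)"
    using g i j by (simp add: from_edge_def from_ghost_def)
  then show ?thesis
    using total_gh_ed[of "WGhost g i" "WGhost g j"] g i j by (auto simp: end_halves_def from_vertex_def)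
qed

text \<open>At a split vertex and \<open>i = j = 1\<close>, the special edge contributes the half
  \<open>True\<close> and the other edges the half \<open>False\<close>. For all other indices the
  other edges drop out, having weight 1.\<close>

lemma ED_GH:
  assumes v: "v \<in> verts E" and i: "i \<in> {1..vertex_weight E w v}" and j: "j \<in> {1..vertex_weight E w v}"
  shows "(\<Sum>e \<in> out_arcs E v. ED e i * GH e j) = (if i = j then V v else 0)"
proof (cases "v \<in> S")
  case True
  let ?g = "special v"
  have g: "?g \<in> R" "tail E ?g = v" using special_R special_S True by auto
  have W: "vertex_weight E w v = w ?g" using vertex_weight_R[OF g(1)] g(2) by simp
  have ne: "out_arcs E v - R \<noteq> {}"
  proof -
    obtain e f where ef: "e \<in> Wt" "f \<in> arcs E" "tail E e = v" "tail E f = v" "e \<noteq> f" using True by (auto simp: S_def)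
    then have "e \<in> R" by (simp add: R_def)
    then have "f \<notin> R" using R_same_tail ef by metis
    then show ?thesis using ef by auto
  qed
  have "(\<Sum>e \<in> out_arcs E v. ED e i * GH e j) = ED ?g i * GH ?g j + (\<Sum>f \<in> out_arcs E v - R. ED f i * GH f j)"
    using finite_out_arcs[OF v] g by (subst out_arcs_S[OF True], subst sum.insert) auto
  also have "(\<Sum>f \<in> out_arcs E v - R. ED f i * GH f j) = (if i = 1 \<and> j = 1 then tv v False else 0)"
  proof (cases "i = 1 \<and> j = 1")
    case True
    then have ij: "i = 1" "j = 1" by auto
    show ?thesis unfolding ij using sum_not_R[OF v _ ne] S_T[OF \<open>v \<in> S\<close>] by simp
  next
    case False
    have "ED f i * GH f j = 0" if "f \<in> out_arcs E v - R" for f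
      using False not_R[of f] that i j by auto
    then show ?thesis using False by (auto intro: sum.neutral)
  qed
  also have "ED ?g i * GH ?g j = (if i = j then if i = 1 then tv v True else V v else 0)"
    using ED_GH_R[OF g(1)] i j W g(2) True by auto
  finally show ?thesis using True by (auto simp: from_vertex_def[of vx v] halves_eq add.commute)
next
  case vS: False
  have ne: "out_arcs E v \<noteq> {}" using i by (auto simp: vertex_weight_def)
  show ?thesis
  proof (cases "\<exists>g \<in> out_arcs E v. g \<in> R")
    case True
    then obtain g where g: "g \<in> R" "tail E g = v" by auto
    have out: "out_arcs E v = {g}" using R_only[OF g(1)] g(2) vS by simp
    have W: "vertex_weight E w v = w g" using vertex_weight_R[OF g(1)] g(2) by simp
    show ?thesis unfolding out using ED_GH_R[OF g(1), of i j] i j W g(2) vS by simp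
  next
    case False
    then have out: "out_arcs E v - R = out_arcs E v" by blast
    have W: "vertex_weight E w v = 1" by (rule vertex_weight_not_R[OF v out ne])
    have "v \<notin> T" using False ne by (auto simp: R_def)
    have ij: "i = 1" "j = 1" using i j W by auto
    have "(\<Sum>e \<in> out_arcs E v. ED e 1 * GH e 1) = tv v False"
      using sum_not_R[OF v \<open>v \<notin> T\<close>] ne unfolding out by blast
    then show ?thesis using vS by (simp only: ij) (simp add: from_vertex_def halves_eq)
  qed
qed

lemma wlpa_family_E: "wlpa_family E w V (\<lambda>e i. ED e i) (\<lambda>e i. GH e i)"
proof
  fix e i assume e: "e \<in> arcs E" "1 \<le> i" "i \<le> w e"
  have "V (tail E e) * from_edge ed gh e i = from_edge ed gh e i \<and> from_edge ed gh e i * V (head E e) = from_edge ed gh e i \<and>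
    V (head E e) * from_ghost ed gh e i = from_ghost ed gh e i \<and> from_ghost ed gh e i * V (tail E e) = from_ghost ed gh e i"
  proof (cases "e \<in> R")
    case True
    then show ?thesis
      using total_relations[OF letter_edge(1)[OF e]] by (simp add: from_edge_def from_ghost_def)
  next
    case False
    then show ?thesis
      using total_relations[of "WEdge e i"] letter_edge(2)[OF e] by (simp add: from_edge_def from_ghost_def)
  qed
  then show "V (tail E e) * ED e i = ED e i" "ED e i * V (head E e) = ED e i"
    "V (head E e) * GH e i = GH e i" "GH e i * V (tail E e) = GH e i" using e by simp_all
next
  show "u \<in> verts E \<Longrightarrow> v \<in> verts E \<Longrightarrow> V u * V v = (if u = v then V u else 0)" for u v by (rule V_V)
  show "v \<in> verts E \<Longrightarrow> e \<in> out_arcs E v \<Longrightarrow> f \<in> out_arcs E v \<Longrightarrow>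
      (\<Sum>i = 1..vertex_weight E w v. GH e i * ED f i) = (if e = f then V (head E e) else 0)" for v e f by (rule GH_ED)
  show "v \<in> verts E \<Longrightarrow> i \<in> {1..vertex_weight E w v} \<Longrightarrow> j \<in> {1..vertex_weight E w v} \<Longrightarrow>
      (\<Sum>e\<in>out_arcs E v. ED e i * GH e j) = (if i = j then V v else 0)" for v i j by (rule ED_GH)
qed auto

subsection \<open>The two translations are mutually inverse\<close>

lemma half_from:
  assumes "v \<in> verts E" "b \<in> halves v"
  shows "half V (\<lambda>e i. ED e i) (\<lambda>e i. GH e i) v b = tv v b"
proof (cases "v \<in> S")
  case True
  let ?g = "special v"
  have g: "?g \<in> R" "tail E ?g = v" using special_R special_S True by auto
  have "1 \<le> w ?g" using arc_weight_pos R_arcs[OF g(1)] by blast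
  then have "ED ?g 1 * GH ?g 1 = tv v True"
    using ED_GH_R[OF g(1), of 1 1] g(2) True by simp
  then show ?thesis using True by (auto simp: half_def Let_def from_vertex_def halves_eq)
next
  case False
  then show ?thesis using assms by (simp add: half_def from_vertex_def halves_eq)
qed

lemma el_from:
  assumes "a \<in> graph_letters"
  shows "el V (\<lambda>e i. ED e i) (\<lambda>e i. GH e i) a = total ed a"
    and "el V (\<lambda>e i. GH e i) (\<lambda>e i. ED e i) a = total gh a"
  using assms not_R by (auto elim!: graph_letters_cases simp: from_edge_def from_ghost_def)

lemma total_half:
  assumes a: "a \<in> graph_letters" and b: "b \<in> end_halves a"
  shows "total ed a * tv (lrange E a) b = ed (enc a b)" "tv (lrange E a) b * total gh a = gh (enc a b)"
proof -
  let ?y = "lrange E a"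
  have y: "?y \<in> verts E" using letter_range[OF a] .
  have "ed (enc a b') * tv ?y b = (if b' = b then ed (enc a b) else 0)" if b': "b' \<in> end_halves a" for b'
  proof -
    have "ed (enc a b') * tv ?y b = ed (enc a b') * (tv ?y b' * tv ?y b)"
      using arc_relations(2)[OF a b'] by (simp flip: mult.assoc)
    then show ?thesis
      using arc_relations(2)[OF a b'] tv_tv[OF y y end_halves_letter[OF b'] end_halves_letter[OF b]] by auto
  qed
  then show "total ed a * tv ?y b = ed (enc a b)"
    using b by (simp add: total_def sum_distrib_right sum.delta)
  have "tv ?y b * gh (enc a b') = (if b' = b then gh (enc a b) else 0)" if b': "b' \<in> end_halves a" for b'
  proof -
    have "tv ?y b * gh (enc a b') = (tv ?y b * tv ?y b') * gh (enc a b')"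
      using arc_relations(3)[OF a b'] by (simp add: mult.assoc)
    then show ?thesis
      using arc_relations(3)[OF a b'] tv_tv[OF y y end_halves_letter[OF b] end_halves_letter[OF b']] by auto
  qed
  then show "tv ?y b * total gh a = gh (enc a b)"
    using b by (simp add: total_def sum_distrib_left sum.delta)
qed

lemma to_from:
  "u \<in> verts F \<Longrightarrow> to_vertex V (\<lambda>e i. ED e i) (\<lambda>e i. GH e i) u = vx u"
  "u \<in> arcs F \<Longrightarrow> to_edge V (\<lambda>e i. ED e i) (\<lambda>e i. GH e i) u = ed u"
  "u \<in> arcs F \<Longrightarrow> to_ghost V (\<lambda>e i. ED e i) (\<lambda>e i. GH e i) u = gh u"
  by (auto elim!: F_vert_cases F_arc_cases simp: to_vertex_def to_edge_def to_ghost_def half_from el_from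
      total_half letter_range end_halves_letter)

end

context lpa_condition_weighted
begin

lemma total_to:
  assumes a: "a \<in> graph_letters"
  shows "total (to_edge vx ed gh) a = l a" "total (to_ghost vx ed gh) a = d a"
proof -
  have "(\<Sum>b\<in>end_halves a. h (lrange E a) b) = (if exceptional a then q (lrange E a) else vx (lrange E a))"
    using sum_h by (auto simp: end_halves_def h_simps exceptional_def)
  moreover have "total (to_edge vx ed gh) a = l a * (\<Sum>b\<in>end_halves a. h (lrange E a) b)"
    "total (to_ghost vx ed gh) a = (\<Sum>b\<in>end_halves a. h (lrange E a) b) * d a"
    by (simp_all add: total_def to_edge_def to_ghost_def sum_distrib_left sum_distrib_right)
  ultimately show "total (to_edge vx ed gh) a = l a" "total (to_ghost vx ed gh) a = d a"
    using exceptional_q[OF a] l_vx[OF a] vx_d[OF a] by simp_all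
qed

lemma from_to:
  "from_vertex (to_vertex vx ed gh) v = vx v"
  "e \<in> arcs E \<Longrightarrow> 1 \<le> i \<Longrightarrow> i \<le> w e \<Longrightarrow> from_edge (to_edge vx ed gh) (to_ghost vx ed gh) e i = ed e i"
  "e \<in> arcs E \<Longrightarrow> 1 \<le> i \<Longrightarrow> i \<le> w e \<Longrightarrow> from_ghost (to_edge vx ed gh) (to_ghost vx ed gh) e i = gh e i"
proof -
  show "from_vertex (to_vertex vx ed gh) v = vx v"
    by (simp add: from_vertex_def to_vertex_def sum_h)
  assume e: "e \<in> arcs E" "1 \<le> i" "i \<le> w e"
  have "from_edge (to_edge vx ed gh) (to_ghost vx ed gh) e i = ed e i \<and>
      from_ghost (to_edge vx ed gh) (to_ghost vx ed gh) e i = gh e i"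
  proof (cases "e \<in> R")
    case True
    then show ?thesis
      using total_to[OF letter_edge(1)[OF e]] by (simp add: from_edge_def from_ghost_def)
  next
    case False
    then show ?thesis
      using total_to[of "WEdge e i"] letter_edge(2)[OF e] by (simp add: from_edge_def from_ghost_def)
  qed
  then show "from_edge (to_edge vx ed gh) (to_ghost vx ed gh) e i = ed e i"
    "from_ghost (to_edge vx ed gh) (to_ghost vx ed gh) e i = gh e i" by auto
qed

end

section \<open>Compatibility of the translations with homomorphisms, and the isomorphism\<close>

context nonunital_ring_hom
begin

text \<open>The translations are expressions in the generators. The same formulas thus define
  substitutions in the free algebras and families in the quotients, and the lemmas of this context
  identify the two.\<close>

lemma total: "h (lpa_graph.total E w f a) = lpa_graph.total E w (\<lambda>u. h (f u)) a"
  by (simp add: lpa_graph.total_def sum)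

lemma from_vertex: "h (lpa_graph.from_vertex E w vx v) = lpa_graph.from_vertex E w (\<lambda>u. h (vx u)) v"
  by (simp add: lpa_graph.from_vertex_def sum)

lemma from_edge: "h (lpa_graph.from_edge E w ed gh e i) = lpa_graph.from_edge E w (\<lambda>u. h (ed u)) (\<lambda>u. h (gh u)) e i"
  by (simp add: lpa_graph.from_edge_def total)

lemma from_ghost: "h (lpa_graph.from_ghost E w ed gh e i) = lpa_graph.from_ghost E w (\<lambda>u. h (ed u)) (\<lambda>u. h (gh u)) e i"
  by (simp add: lpa_graph.from_ghost_def total)

lemma half: "h (lpa_graph.half E w vx ed gh v b) = lpa_graph.half E w (\<lambda>v. h (vx v)) (\<lambda>e i. h (ed e i)) (\<lambda>e i. h (gh e i)) v b"
  by (simp add: lpa_graph.half_def Let_def diff mult)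

lemma el: "h (lpa_graph.el vx ed gh a) = lpa_graph.el (\<lambda>v. h (vx v)) (\<lambda>e i. h (ed e i)) (\<lambda>e i. h (gh e i)) a"
  by (cases a) (simp_all add: lpa_graph.el.simps)

lemma to_vertex: "h (lpa_graph.to_vertex E w vx ed gh u) =
    lpa_graph.to_vertex E w (\<lambda>v. h (vx v)) (\<lambda>e i. h (ed e i)) (\<lambda>e i. h (gh e i)) u"
  by (simp add: lpa_graph.to_vertex_def half)

lemma to_edge: "h (lpa_graph.to_edge E w vx ed gh u) =
    lpa_graph.to_edge E w (\<lambda>v. h (vx v)) (\<lambda>e i. h (ed e i)) (\<lambda>e i. h (gh e i)) u"
  by (simp add: lpa_graph.to_edge_def half el mult)

lemma to_ghost: "h (lpa_graph.to_ghost E w vx ed gh u) =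
    lpa_graph.to_ghost E w (\<lambda>v. h (vx v)) (\<lambda>e i. h (ed e i)) (\<lambda>e i. h (gh e i)) u"
  by (simp add: lpa_graph.to_ghost_def half el mult)

end

context lpa_condition
begin

primrec wlpa_to_lpa :: "('v, 'e) wlpa_gen \<Rightarrow> (('v, 'e) universe, ('v, 'e) universe) lpa_gen word \<Rightarrow>\<^sub>0 'k::field" where
  "wlpa_to_lpa (WVertex v) = from_vertex (\<lambda>u. gen (Vertex u)) v"
| "wlpa_to_lpa (WEdge e i) = from_edge (\<lambda>u. gen (Edge u)) (\<lambda>u. gen (Ghost u)) e i"
| "wlpa_to_lpa (WGhost e i) = from_ghost (\<lambda>u. gen (Edge u)) (\<lambda>u. gen (Ghost u)) e i"

abbreviation wedge :: "'e \<Rightarrow> nat \<Rightarrow> ('v, 'e) wlpa_gen word \<Rightarrow>\<^sub>0 'k::field" where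
  "wedge e i \<equiv> (if i \<le> w e then gen (WEdge e i) else 0)"

abbreviation wghost :: "'e \<Rightarrow> nat \<Rightarrow> ('v, 'e) wlpa_gen word \<Rightarrow>\<^sub>0 'k::field" where
  "wghost e i \<equiv> (if i \<le> w e then gen (WGhost e i) else 0)"

primrec lpa_to_wlpa :: "(('v, 'e) universe, ('v, 'e) universe) lpa_gen \<Rightarrow> ('v, 'e) wlpa_gen word \<Rightarrow>\<^sub>0 'k::field" where
  "lpa_to_wlpa (Vertex u) = to_vertex (\<lambda>v. gen (WVertex v)) (\<lambda>e i. wedge e i) (\<lambda>e i. wghost e i) u"
| "lpa_to_wlpa (Edge u) = to_edge (\<lambda>v. gen (WVertex v)) (\<lambda>e i. wedge e i) (\<lambda>e i. wghost e i) u"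
| "lpa_to_wlpa (Ghost u) = to_ghost (\<lambda>v. gen (WVertex v)) (\<lambda>e i. wedge e i) (\<lambda>e i. wghost e i) u"

lemma total_free_alg:
  assumes "\<And>b. b \<in> end_halves a \<Longrightarrow> f (enc a b) \<in> free_alg Y"
  shows "total f a \<in> free_alg Y"
  unfolding total_def by (rule free_alg_sum) (rule assms)

lemma wlpa_to_lpa_free_alg: "x \<in> wlpa_gens E w \<Longrightarrow> wlpa_to_lpa x \<in> free_alg (lpa_gens F)"
proof (cases x)
  case (WVertex v)
  assume "x \<in> wlpa_gens E w"
  then show ?thesis
    unfolding WVertex wlpa_to_lpa.simps from_vertex_def
    by (intro free_alg_sum) (auto simp: wlpa_gens_def lpa_gens_def)
next
  case (WEdge e i)
  assume "x \<in> wlpa_gens E w"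
  then have "e \<in> arcs E" "1 \<le> i" "i \<le> w e" using WEdge by (auto simp: wlpa_gens_def)
  from letter_edge[OF this] show ?thesis
    unfolding WEdge wlpa_to_lpa.simps from_edge_def
    by (auto intro!: total_free_alg simp: lpa_gens_def)
next
  case (WGhost e i)
  assume "x \<in> wlpa_gens E w"
  then have "e \<in> arcs E" "1 \<le> i" "i \<le> w e" using WGhost by (auto simp: wlpa_gens_def)
  from letter_edge[OF this] show ?thesis
    unfolding WGhost wlpa_to_lpa.simps from_ghost_def
    by (auto intro!: total_free_alg simp: lpa_gens_def)
qed

lemma half_free_alg:
  assumes "v \<in> verts E"
  shows "half (\<lambda>v. gen (WVertex v)) (\<lambda>e i. wedge e i) (\<lambda>e i. wghost e i) v b \<in> free_alg (wlpa_gens E w)"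
proof -
  have q: "wedge (special v) 1 * wghost (special v) 1 \<in> free_alg (wlpa_gens E w)" if "v \<in> S"
    using special_S[OF that] Wt_arcs
    by (intro free_alg_mult free_alg_if free_alg_zero) (auto simp: wlpa_gens_def)
  have "gen (WVertex v) \<in> free_alg (wlpa_gens E w)" using assms by (simp add: wlpa_gens_def)
  then show ?thesis
    unfolding half_def Let_def by (intro free_alg_if free_alg_diff q) auto
qed

lemma el_free_alg:
  assumes "a \<in> graph_letters"
  shows "el (\<lambda>v. gen (WVertex v)) (\<lambda>e i. wedge e i) (\<lambda>e i. wghost e i) a \<in> free_alg (wlpa_gens E w)"
    "el (\<lambda>v. gen (WVertex v)) (\<lambda>e i. wghost e i) (\<lambda>e i. wedge e i) a \<in> free_alg (wlpa_gens E w)"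
  using assms not_R R_arcs by (auto elim!: graph_letters_cases simp: wlpa_gens_def)

lemma lpa_to_wlpa_free_alg: "y \<in> lpa_gens F \<Longrightarrow> lpa_to_wlpa y \<in> free_alg (wlpa_gens E w)"
  unfolding lpa_gens_def
  by (elim UnE imageE F_vert_cases F_arc_cases)
    (auto simp: to_vertex_def to_edge_def to_ghost_def intro!: free_alg_mult half_free_alg el_free_alg letter_range)

theorem lpa_model_F: "lpa_model TYPE('k::field) E w F"
proof -
  let ?s = "wlpa_to_lpa :: _ \<Rightarrow> (_ \<Rightarrow>\<^sub>0 'k)" and ?t = "lpa_to_wlpa :: _ \<Rightarrow> (_ \<Rightarrow>\<^sub>0 'k)"
  obtain \<rho> :: "(('v, 'e) wlpa_gen word \<Rightarrow>\<^sub>0 'k) \<Rightarrow> (('v, 'e) wlpa_gen word \<Rightarrow>\<^sub>0 'k) endo" where \<rho>: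
    "\<And>a b. \<rho> (a + b) = \<rho> a + \<rho> b" "\<And>a b. \<rho> (a * b) = \<rho> a * \<rho> b" "\<And>a. \<rho> a = 0 \<longleftrightarrow> a \<in> ideal_of (wlpa_rels E w)"
    by (rule quotient_ring[of "wlpa_rels E w"]) blast
  obtain \<tau> :: "((('v, 'e) universe, ('v, 'e) universe) lpa_gen word \<Rightarrow>\<^sub>0 'k) \<Rightarrow> ((('v, 'e) universe, ('v, 'e) universe) lpa_gen word \<Rightarrow>\<^sub>0 'k) endo" where \<tau>:
    "\<And>a b. \<tau> (a + b) = \<tau> a + \<tau> b" "\<And>a b. \<tau> (a * b) = \<tau> a * \<tau> b" "\<And>a. \<tau> a = 0 \<longleftrightarrow> a \<in> ideal_of (lpa_rels F)"
    by (rule quotient_ring[of "lpa_rels F"]) blast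
  interpret \<rho>: nonunital_ring_hom \<rho> by unfold_locales (rule \<rho>)+
  interpret \<tau>: nonunital_ring_hom \<tau> by unfold_locales (rule \<tau>)+
  \<comment> \<open>Each map is a substitution followed by passage to the quotient. Relations and
    inverses are checked after these maps, where the results on families apply.\<close>
  let ?hs = "\<lambda>p. \<tau> (sub ?s p)" and ?ht = "\<lambda>p. \<rho> (sub ?t p)"
  interpret hs: nonunital_ring_hom ?hs by unfold_locales (simp_all add: sub.ev_add sub.ev_mult \<tau>)
  interpret ht: nonunital_ring_hom ?ht by unfold_locales (simp_all add: sub.ev_add sub.ev_mult \<rho>)
  have if_\<rho>: "\<rho> (if b then x else 0) = (if b then \<rho> x else 0)" for b x by simp
  have if_hs: "?hs (if b then x else 0) = (if b then ?hs x else 0)" for b x by simp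
  have famW: "wlpa_family E w (\<lambda>v. \<rho> (gen (WVertex v))) (\<lambda>e i. \<rho> (wedge e i)) (\<lambda>e i. \<rho> (wghost e i))"
    using wlpa_family_iff[OF \<rho>.nonunital_ring_hom_axioms, of E w] \<rho>(3) gen_ideal.rel unfolding if_\<rho> by blast
  have famF: "lpa_family F (\<lambda>v. \<tau> (gen (Vertex v))) (\<lambda>e. \<tau> (gen (Edge e))) (\<lambda>e. \<tau> (gen (Ghost e)))"
    using lpa_family_iff[OF \<tau>.nonunital_ring_hom_axioms, of F] \<tau>(3) gen_ideal.rel by blast
  interpret W: lpa_condition_weighted E w "\<lambda>v. \<rho> (gen (WVertex v))" "\<lambda>e i. \<rho> (wedge e i)" "\<lambda>e i. \<rho> (wghost e i)"
    by (intro lpa_condition_weighted.intro lpa_condition_axioms famW)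
  interpret U: lpa_condition_unweighted E w "\<lambda>v. \<tau> (gen (Vertex v))" "\<lambda>e. \<tau> (gen (Edge e))" "\<lambda>e. \<tau> (gen (Ghost e))"
    by (intro lpa_condition_unweighted.intro lpa_condition_axioms famF)
  have kill_s: "sub ?s r \<in> ideal_of (lpa_rels F)" if "r \<in> wlpa_rels E w" for r
  proof -
    have "wlpa_family E w (\<lambda>v. ?hs (gen (WVertex v))) (\<lambda>e i. if i \<le> w e then ?hs (gen (WEdge e i)) else 0)
        (\<lambda>e i. if i \<le> w e then ?hs (gen (WGhost e i)) else 0)"
      using U.wlpa_family_E by (simp only: sub.ev_gen wlpa_to_lpa.simps \<tau>.from_vertex \<tau>.from_edge \<tau>.from_ghost)
    then have "?hs r = 0" using wlpa_family_iff[OF hs.nonunital_ring_hom_axioms] that by blast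
    then show ?thesis using \<tau>(3) by blast
  qed
  have kill_t: "sub ?t r \<in> ideal_of (wlpa_rels E w)" if "r \<in> lpa_rels F" for r
  proof -
    have "lpa_family F (\<lambda>v. ?ht (gen (Vertex v))) (\<lambda>e. ?ht (gen (Edge e))) (\<lambda>e. ?ht (gen (Ghost e)))"
      using W.lpa_family_F by (simp only: sub.ev_gen lpa_to_wlpa.simps \<rho>.to_vertex \<rho>.to_edge \<rho>.to_ghost)
    then have "?ht r = 0" using lpa_family_iff[OF ht.nonunital_ring_hom_axioms] that by blast
    then show ?thesis using \<rho>(3) by blast
  qed
  have ts: "sub ?t (?s x) - gen x \<in> ideal_of (wlpa_rels E w)" if x: "x \<in> wlpa_gens E w" for x
  proof -
    have "?ht (?s x) = \<rho> (gen x)"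
    proof (cases x)
      case (WVertex v)
      then show ?thesis using W.from_to(1)[of v]
        by (simp only: wlpa_to_lpa.simps ht.from_vertex sub.ev_gen lpa_to_wlpa.simps \<rho>.to_vertex)
    next
      case (WEdge e i)
      then have "e \<in> arcs E" "1 \<le> i" "i \<le> w e" using x by (auto simp: wlpa_gens_def)
      then show ?thesis using W.from_to(2)[of e i] WEdge
        by (simp only: wlpa_to_lpa.simps ht.from_edge sub.ev_gen lpa_to_wlpa.simps \<rho>.to_edge \<rho>.to_ghost if_True)
    next
      case (WGhost e i)
      then have "e \<in> arcs E" "1 \<le> i" "i \<le> w e" using x by (auto simp: wlpa_gens_def)
      then show ?thesis using W.from_to(3)[of e i] WGhost
        by (simp only: wlpa_to_lpa.simps ht.from_ghost sub.ev_gen lpa_to_wlpa.simps \<rho>.to_edge \<rho>.to_ghost if_True)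
    qed
    then show ?thesis by (simp add: \<rho>.diff flip: \<rho>(3))
  qed
  have st: "sub ?s (?t y) - gen y \<in> ideal_of (lpa_rels F)" if y: "y \<in> lpa_gens F" for y
  proof -
    have "?hs (?t y) = \<tau> (gen y)"
    proof (cases y)
      case (Vertex u)
      then have "u \<in> verts F" using y by (auto simp: lpa_gens_def)
      then show ?thesis using U.to_from(1)[of u] Vertex
        by (simp only: lpa_to_wlpa.simps hs.to_vertex if_hs sub.ev_gen wlpa_to_lpa.simps \<tau>.from_vertex \<tau>.from_edge \<tau>.from_ghost)
    next
      case (Edge u)
      then have "u \<in> arcs F" using y by (auto simp: lpa_gens_def)
      then show ?thesis using U.to_from(2)[of u] Edge
        by (simp only: lpa_to_wlpa.simps hs.to_edge if_hs sub.ev_gen wlpa_to_lpa.simps \<tau>.from_vertex \<tau>.from_edge \<tau>.from_ghost)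
    next
      case (Ghost u)
      then have "u \<in> arcs F" using y by (auto simp: lpa_gens_def)
      then show ?thesis using U.to_from(3)[of u] Ghost
        by (simp only: lpa_to_wlpa.simps hs.to_ghost if_hs sub.ev_gen wlpa_to_lpa.simps \<tau>.from_vertex \<tau>.from_edge \<tau>.from_ghost)
    qed
    then show ?thesis by (simp add: \<tau>.diff flip: \<tau>(3))
  qed
  have "alg_isomorphic (presented_alg (wlpa_gens E w) (wlpa_rels E w) :: ('k, _) alg) (presented_alg (lpa_gens F) (lpa_rels F))"
    by (rule presented_alg_isomorphic[OF wlpa_rels_free_alg[OF weighted_graph] lpa_rels_free_alg[OF wf_F], of ?s ?t])
      (fact wlpa_to_lpa_free_alg lpa_to_wlpa_free_alg kill_s kill_t ts st)+
  then show ?thesis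
    using wf_F row_finite_F by (simp add: lpa_model_def weighted_leavitt_path_alg_def leavitt_path_alg_def)
qed

end

section \<open>Necessity for an arbitrary graph, and the equivalence\<close>

lemma lpa_model_condition_LPA:
  fixes E :: "('v, 'e) pre_digraph" and F :: "('c, 'd) pre_digraph"
  assumes E: "weighted_graph E w" "row_finite E" and model: "lpa_model TYPE('k::field) E w F"
  shows "condition_LPA E w"
proof (rule reduction_property_condition_LPA[OF E])
  have F: "wf_digraph F" "row_finite F"
    and iso: "alg_isomorphic (weighted_leavitt_path_alg E w :: ('k, _) alg) (leavitt_path_alg F)"
    using model by (simp_all add: lpa_model_def)
  show "reduction_property (weighted_leavitt_path_alg E w :: ('k, _) alg)"
    by (rule reduction_property_isomorphic[OF iso reduction_property_leavitt_path_alg[OF F]])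
      (simp_all add: weighted_leavitt_path_alg_def presented_alg_closed[OF wlpa_rels_free_alg[OF E(1)]])
qed

theorem theorem38:
  fixes E :: "('v, 'e) pre_digraph" and w :: "'e \<Rightarrow> nat"
  assumes "weighted_graph E w" and "row_finite E"
  shows "((\<exists>F :: (('v, 'e) universe, ('v, 'e) universe) pre_digraph.
             lpa_model TYPE('k::field) E w F) \<longleftrightarrow> condition_LPA E w) \<and>
         (\<forall>F :: ('c, 'd) pre_digraph. lpa_model TYPE('k) E w F \<longrightarrow> condition_LPA E w)"
proof -
  have "lpa_model TYPE('k) E w (lpa_graph.F E w)" if "condition_LPA E w"
    using lpa_condition.lpa_model_F[of E w] assms that by (simp add: lpa_condition_def)
  moreover have "condition_LPA E w" if "\<exists>F :: (('v, 'e) universe, ('v, 'e) universe) pre_digraph. lpa_model TYPE('k) E w F"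
    using that lpa_model_condition_LPA[OF assms] by blast
  moreover have "condition_LPA E w" if "lpa_model TYPE('k) E w F" for F :: "('c, 'd) pre_digraph"
    using that by (rule lpa_model_condition_LPA[OF assms])
  ultimately show ?thesis by blast
qed

end
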